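(* The correspondence which associates to a filiform symplectic Lie algebra $(\mathfrak g,\omega)$ (of dimension $2\ell$) the extension triple $(\mathfrak h,\nabla,[\alpha])$, which is defined with respect to the Lagrangian ideal $C^{\ell-1}\mathfrak g$ of $(\mathfrak g,\omega)$, induces a bijection between isomorphism classes of filiform symplectic Lie algebras and isomorphism classes of flat Lie algebras with filiform symplectic extension cohomology class.
   Context: All Lie algebras are finite-dimensional over a fixed field of characteristic $0$. A symplectic Lie algebra $(\mathfrak g,\omega)$ is a Lie algebra with a non-degenerate alternating form $\omega$ satisfying $\omega([u,v],w)+\omega([w,u],v)+\omega([v,w],u)=0$; isomorphisms are Lie algebra isomorphisms preserving the forms. With $C^0\mathfrak g=\mathfrak g$, $C^{i+1}\mathfrak g=[\mathfrak g,C^i\mathfrak g]$, a nilpotent Lie algebra of dimension $n$ is filiform if its nilpotency class is $n-1$, that is, if $C^{n-1}\mathfrak g=0$ and $C^{n-2}\mathfrak g\neq0$. A symplectic Lie algebra is called filiform if its underlying Lie algebra is. A Lagrangian ideal is an ideal equal to its $\omega$-orthogonal. A flat Lie algebra $(\mathfrak h,\nabla)$ is a Lie algebra with a bilinear map $\nabla:\mathfrak h\times\mathfrak h\to\mathfrak h$, $(u,v)\mapsto\nabla_uv$, with $\nabla_uv-\nabla_vu=[u,v]$ and $\nabla_u\nabla_v-\nabla_v\nabla_u=\nabla_{[u,v]}$. Let $\rho:\mathfrak h\to\mathrm{End}(\mathfrak h^* )$, $\rho(u)\xi=-\xi\circ\nabla_u$. Let $\mathcal C^1_L(\mathfrak h,\mathfrak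 h^* )=\{\varphi\in\mathrm{Hom}(\mathfrak h,\mathfrak h^* ):\varphi(u)(v)=\varphi(v)(u)\}$, $(\partial_\nabla\varphi)(u,v)=\rho(u)\varphi(v)-\rho(v)\varphi(u)-\varphi([u,v])$, let $Z^2_{L,\nabla}(\mathfrak h,\mathfrak h^* )$ be the space of Chevalley–Eilenberg two-cocycles $\alpha\in\mathrm{Hom}(\bigwedge^2\mathfrak h,\mathfrak h^* )$ with respect to $\rho$ satisfying $\alpha(u,v)(w)+\alpha(w,u)(v)+\alpha(v,w)(u)=0$, and $H^2_{L,\nabla}(\mathfrak h,\mathfrak h^* )=Z^2_{L,\nabla}(\mathfrak h,\mathfrak h^* )/\partial_\nabla\mathcal C^1_L(\mathfrak h,\mathfrak h^* )$. A symplectic extension cohomology class for $(\mathfrak h,\nabla)$ is an element of $H^2_{L,\nabla}(\mathfrak h,\mathfrak h^* )$. For $\alpha\in Z^2_{L,\nabla}(\mathfrak h,\mathfrak h^* )$, $\mathfrak g_{\nabla,\alpha}=\mathfrak h\oplus\mathfrak h^*$ is the Lie algebra with brackets $[u,v]=[u,v]_{\mathfrak h}+\alpha(u,v)$, $[u,\xi]=\rho(u)\xi$, $[\xi,\eta]=0$ ($u,v\in\mathfrak h$, $\xi,\eta\in\mathfrak h^*$), equipped with the symplectic form given by $\omega(\xi,u)=\xi(u)=-\omega(u,\xi)$ with $\mathfrak h,\mathfrak h^*$ isotropic; up to isomorphism it depends only on the class $[\alpha]\in H^2_{L,\nabla}(\mathfrak h,\mathfrak h^* )$. The class $[\alpha]$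 (or the triple $(\mathfrak h,\nabla,[\alpha])$) is called filiform if $\mathfrak g_{\nabla,\alpha}$ is filiform. An isomorphism $(\mathfrak h,\nabla,[\alpha])\to(\mathfrak h',\nabla',[\alpha'])$ is a Lie algebra isomorphism $\varphi:\mathfrak h\to\mathfrak h'$ with $\varphi(\nabla_uv)=\nabla'_{\varphi u}\varphi v$ and $\varphi^*[\alpha']=[\alpha]$, where $(\varphi^*\alpha')(u,v)(w)=\alpha'(\varphi u,\varphi v)(\varphi w)$. The extension triple of $(\mathfrak g,\omega)$ with respect to a Lagrangian ideal $\mathfrak a$: $\mathfrak h=\mathfrak g/\mathfrak a$; $\nabla$ is the flat torsion-free connection determined by $\omega(\widetilde{\nabla_uv},a)=-\omega(\tilde v,[\tilde u,a])$ for all $a\in\mathfrak a$ (tildes denoting lifts to $\mathfrak g$); $[\alpha]$ is the class of $\alpha(u,v)(w)=\omega(\pi_{\mathfrak a}([\tilde u,\tilde v]),\tilde w)$, where $N$ is any Lagrangian subspace complementary to $\mathfrak a$, the lifts are taken in $N$, and $\pi_{\mathfrak a}$ is the projection to $\mathfrak a$ along $N$; this class does not depend on $N$.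
   Formalization: Restricted to dim g ≥ 4 (ℓ ≥ 2) and dim h ≥ 2: for ℓ = 1 the abelian symplectic Lie algebra of dimension 2 is filiform, but C^{ℓ-1}g = g is not Lagrangian, so the extension triple is not defined there. *)

theory Defs
  imports "HOL-Algebra.AbelCoset" "Jordan_Normal_Form.VS_Connect"
begin

section \<open>Lie algebras\<close>

text \<open>
  The ground field is a type \<open>'k\<close> of class \<open>field_char_0\<close>, entering the carrier-based library of
  vector spaces as \<open>class_ring\<close>. Carriers are sets and not types, since the construction of the
  extension triple passes to a quotient \<open>\<gg> / \<aa>\<close>. The values of the operations outside
  the carrier, and the fields \<open>mult\<close> and \<open>one\<close> inherited from the record of modules, are irrelevant
  throughout; in particular isomorphisms ignore them.
\<close>

record ('k, 'a) lie = "('k, 'a) module" +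
  bracket :: "'a \<Rightarrow> 'a \<Rightarrow> 'a"

definition scalars :: "('k::field_char_0, 'k) module" where
  "scalars = \<lparr>carrier = UNIV, mult = (*), one = 1, zero = 0, add = (+), smult = (*)\<rparr>"

definition bilinear_map ::
    "('k::field_char_0, 'a, 'r) module_scheme \<Rightarrow> ('k, 'b, 's) module_scheme \<Rightarrow>
     ('k, 'c, 't) module_scheme \<Rightarrow> ('a \<Rightarrow> 'b \<Rightarrow> 'c) \<Rightarrow> bool" where
  "bilinear_map L M N B \<longleftrightarrow>
     (\<forall>x\<in>carrier L. B x \<in> LinearCombinations.module_hom class_ring M N) \<and>
     (\<forall>y\<in>carrier M. (\<lambda>x. B x y) \<in> LinearCombinations.module_hom class_ring L N)"

locale lie_algebra = vectorspace class_ring L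
  for L :: "('k::field_char_0, 'a) lie" (structure) +
  assumes fin_dim: fin_dim
    and bracket_bilinear: "bilinear_map L L L (bracket L)"
    and bracket_alternating: "x \<in> carrier L \<Longrightarrow> bracket L x x = \<zero>"
    and jacobi: "\<lbrakk>x \<in> carrier L; y \<in> carrier L; z \<in> carrier L\<rbrakk> \<Longrightarrow>
      bracket L x (bracket L y z) \<oplus> bracket L y (bracket L z x) \<oplus> bracket L z (bracket L x y) = \<zero>"

abbreviation lie_dim :: "('k::field_char_0, 'a) lie \<Rightarrow> nat" where
  "lie_dim L \<equiv> vectorspace.dim class_ring L"

primrec lower_central :: "('k::field_char_0, 'a) lie \<Rightarrow> nat \<Rightarrow> 'a set" where
  "lower_central L 0 = carrier L"
| "lower_central L (Suc i) =
     LinearCombinations.module.span class_ring L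
       {bracket L x y | x y. x \<in> carrier L \<and> y \<in> lower_central L i}"

text \<open>
  Truncated subtraction does no harm: in dimensions \<open>0\<close> and \<open>1\<close> the two conditions on the lower
  central series contradict each other.
\<close>
definition filiform :: "('k::field_char_0, 'a) lie \<Rightarrow> bool" where
  "filiform L \<longleftrightarrow> lie_algebra L \<and>
     lower_central L (lie_dim L - 1) = {\<zero>\<^bsub>L\<^esub>} \<and> lower_central L (lie_dim L - 2) \<noteq> {\<zero>\<^bsub>L\<^esub>}"

definition lie_ideal :: "('k::field_char_0, 'a) lie \<Rightarrow> 'a set \<Rightarrow> bool" where
  "lie_ideal L I \<longleftrightarrow> VectorSpace.subspace class_ring I L \<and>
     (\<forall>x\<in>carrier L. \<forall>y\<in>I. bracket L x y \<in> I)"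

definition lie_iso :: "('k::field_char_0, 'a) lie \<Rightarrow> ('k, 'b) lie \<Rightarrow> ('a \<Rightarrow> 'b) set" where
  "lie_iso L M = {f \<in> LinearCombinations.module_hom class_ring L M. bij_betw f (carrier L) (carrier M) \<and>
     (\<forall>x\<in>carrier L. \<forall>y\<in>carrier L. f (bracket L x y) = bracket M (f x) (f y))}"

text \<open>The quotient by an ideal; its elements are cosets, as in \<open>HOL-Algebra\<close>.\<close>
definition quotient_lie :: "('k::field_char_0, 'a) lie \<Rightarrow> 'a set \<Rightarrow> ('k, 'a set) lie" where
  "quotient_lie L I =
     \<lparr>carrier = a_rcosets\<^bsub>L\<^esub> I, mult = undefined, one = undefined, zero = I, add = set_add L,
      smult = (\<lambda>c X. \<Union>x\<in>X. I +>\<^bsub>L\<^esub> (c \<odot>\<^bsub>L\<^esub> x)),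
      bracket = (\<lambda>X Y. \<Union>x\<in>X. \<Union>y\<in>Y. I +>\<^bsub>L\<^esub> bracket L x y)\<rparr>"

text \<open>Linear forms are made extensional, so that the dual space is an actual vector space of functions.\<close>
definition dual_space :: "('k::field_char_0, 'a, 'r) module_scheme \<Rightarrow> ('k, 'a \<Rightarrow> 'k) module" where
  "dual_space V = (ring.func_space class_ring (carrier V))
     \<lparr>carrier := LinearCombinations.module_hom class_ring V scalars \<inter> extensional (carrier V)\<rparr>"


section \<open>Symplectic Lie algebras\<close>

locale symplectic_lie_algebra = lie_algebra L
  for L :: "('k::field_char_0, 'a) lie" (structure) and \<omega> :: "'a \<Rightarrow> 'a \<Rightarrow> 'k" +
  assumes form_bilinear: "bilinear_map L L scalars \<omega>"
    and form_alternating: "x \<in> carrier L \<Longrightarrow> \<omega> x x = 0"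
    and form_nondegenerate: "\<lbrakk>x \<in> carrier L; \<And>y. y \<in> carrier L \<Longrightarrow> \<omega> x y = 0\<rbrakk> \<Longrightarrow> x = \<zero>"
    and form_closed: "\<lbrakk>u \<in> carrier L; v \<in> carrier L; w \<in> carrier L\<rbrakk> \<Longrightarrow>
      \<omega> (bracket L u v) w + \<omega> (bracket L w u) v + \<omega> (bracket L v w) u = 0"

definition orthogonal_space ::
    "('k::field_char_0, 'a) lie \<Rightarrow> ('a \<Rightarrow> 'a \<Rightarrow> 'k) \<Rightarrow> 'a set \<Rightarrow> 'a set" where
  "orthogonal_space L \<omega> W = {x \<in> carrier L. \<forall>y\<in>W. \<omega> x y = 0}"

definition lagrangian_subspace ::
    "('k::field_char_0, 'a) lie \<Rightarrow> ('a \<Rightarrow> 'a \<Rightarrow> 'k) \<Rightarrow> 'a set \<Rightarrow> bool" where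
  "lagrangian_subspace L \<omega> W \<longleftrightarrow>
     VectorSpace.subspace class_ring W L \<and> orthogonal_space L \<omega> W = W"

definition lagrangian_ideal ::
    "('k::field_char_0, 'a) lie \<Rightarrow> ('a \<Rightarrow> 'a \<Rightarrow> 'k) \<Rightarrow> 'a set \<Rightarrow> bool" where
  "lagrangian_ideal L \<omega> I \<longleftrightarrow> lie_ideal L I \<and> orthogonal_space L \<omega> I = I"

type_synonym ('k, 'a) sympl = "('k, 'a) lie \<times> ('a \<Rightarrow> 'a \<Rightarrow> 'k)"

definition symplectic_isomorphic ::
    "('k::field_char_0, 'a) sympl \<Rightarrow> ('k, 'b) sympl \<Rightarrow> bool" where
  "symplectic_isomorphic = (\<lambda>(L, \<omega>) (M, \<omega>').
     \<exists>f\<in>lie_iso L M. \<forall>x\<in>carrier L. \<forall>y\<in>carrier L. \<omega>' (f x) (f y) = \<omega> x y)"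


section \<open>Flat Lie algebras and symplectic extensions\<close>

locale flat_lie_algebra = lie_algebra H
  for H :: "('k::field_char_0, 'b) lie" (structure) and conn :: "'b \<Rightarrow> 'b \<Rightarrow> 'b" +
  assumes conn_bilinear: "bilinear_map H H H conn"
    and torsion_free: "\<lbrakk>u \<in> carrier H; v \<in> carrier H\<rbrakk> \<Longrightarrow>
      conn u v \<ominus> conn v u = bracket H u v"
    and flat: "\<lbrakk>u \<in> carrier H; v \<in> carrier H; w \<in> carrier H\<rbrakk> \<Longrightarrow>
      conn u (conn v w) \<ominus> conn v (conn u w) = conn (bracket H u v) w"

definition dual_rep ::
    "('k::field_char_0, 'b) lie \<Rightarrow> ('b \<Rightarrow> 'b \<Rightarrow> 'b) \<Rightarrow> 'b \<Rightarrow> ('b \<Rightarrow> 'k) \<Rightarrow> 'b \<Rightarrow> 'k" where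
  "dual_rep H conn u \<xi> = (\<lambda>w\<in>carrier H. - \<xi> (conn u w))"

definition lagrangian_cochains1 :: "('k::field_char_0, 'b) lie \<Rightarrow> ('b \<Rightarrow> 'b \<Rightarrow> 'k) set" where
  "lagrangian_cochains1 H = {\<phi> \<in> LinearCombinations.module_hom class_ring H (dual_space H) \<inter> extensional (carrier H).
     \<forall>u\<in>carrier H. \<forall>v\<in>carrier H. \<phi> u v = \<phi> v u}"

definition coboundary ::
    "('k::field_char_0, 'b) lie \<Rightarrow> ('b \<Rightarrow> 'b \<Rightarrow> 'b) \<Rightarrow> ('b \<Rightarrow> 'b \<Rightarrow> 'k) \<Rightarrow> 'b \<Rightarrow> 'b \<Rightarrow> 'b \<Rightarrow> 'k" where
  "coboundary H conn \<phi> = (\<lambda>u\<in>carrier H. \<lambda>v\<in>carrier H. \<lambda>w\<in>carrier H.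
     dual_rep H conn u (\<phi> v) w - dual_rep H conn v (\<phi> u) w - \<phi> (bracket H u v) w)"

text \<open>
  \<open>\<alpha> u v w\<close> stands for \<open>\<alpha>(u, v)(w)\<close>. The second set of conditions is the Chevalley--Eilenberg
  cocycle condition for \<^const>\<open>dual_rep\<close>, evaluated at \<open>x\<close>. Cocycles are extensional, so that
  cohomology classes are sets of honest elements of \<open>Hom(\<Lambda>\<^sup>2 \<hh>, \<hh>\<^sup>*)\<close>.
\<close>
definition lagrangian_cocycles2 ::
    "('k::field_char_0, 'b) lie \<Rightarrow> ('b \<Rightarrow> 'b \<Rightarrow> 'b) \<Rightarrow> ('b \<Rightarrow> 'b \<Rightarrow> 'b \<Rightarrow> 'k) set" where
  "lagrangian_cocycles2 H conn =
     {\<alpha> \<in> carrier H \<rightarrow>\<^sub>E carrier H \<rightarrow>\<^sub>E carrier (dual_space H).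
        bilinear_map H H (dual_space H) \<alpha> \<and>
        (\<forall>u\<in>carrier H. \<alpha> u u = \<zero>\<^bsub>dual_space H\<^esub>) \<and>
        (\<forall>u\<in>carrier H. \<forall>v\<in>carrier H. \<forall>w\<in>carrier H. \<forall>x\<in>carrier H.
           dual_rep H conn u (\<alpha> v w) x - dual_rep H conn v (\<alpha> u w) x + dual_rep H conn w (\<alpha> u v) x
           - \<alpha> (bracket H u v) w x + \<alpha> (bracket H u w) v x - \<alpha> (bracket H v w) u x = 0) \<and>
        (\<forall>u\<in>carrier H. \<forall>v\<in>carrier H. \<forall>w\<in>carrier H. \<alpha> u v w + \<alpha> w u v + \<alpha> v w u = 0)}"

definition cohomologous ::
    "('k::field_char_0, 'b) lie \<Rightarrow> ('b \<Rightarrow> 'b \<Rightarrow> 'b) \<Rightarrow> ('b \<Rightarrow> 'b \<Rightarrow> 'b \<Rightarrow> 'k) rel" where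
  "cohomologous H conn = {(\<alpha>, \<beta>).
     \<alpha> \<in> lagrangian_cocycles2 H conn \<and> \<beta> \<in> lagrangian_cocycles2 H conn \<and>
     (\<exists>\<phi>\<in>lagrangian_cochains1 H. \<forall>u\<in>carrier H. \<forall>v\<in>carrier H. \<forall>w\<in>carrier H.
        \<beta> u v w - \<alpha> u v w = coboundary H conn \<phi> u v w)}"

definition lagrangian_cohomology2 ::
    "('k::field_char_0, 'b) lie \<Rightarrow> ('b \<Rightarrow> 'b \<Rightarrow> 'b) \<Rightarrow> ('b \<Rightarrow> 'b \<Rightarrow> 'b \<Rightarrow> 'k) set set" where
  "lagrangian_cohomology2 H conn = lagrangian_cocycles2 H conn // cohomologous H conn"

definition extension_algebra ::
    "('k::field_char_0, 'b) lie \<Rightarrow> ('b \<Rightarrow> 'b \<Rightarrow> 'b) \<Rightarrow> ('b \<Rightarrow> 'b \<Rightarrow> 'b \<Rightarrow> 'k) \<Rightarrow>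
     ('k, 'b \<times> ('b \<Rightarrow> 'k)) lie" where
  "extension_algebra H conn \<alpha> = module.extend (direct_sum H (dual_space H))
     (lie.fields (\<lambda>(u, \<xi>) (v, \<eta>).
        (bracket H u v,
         \<lambda>w\<in>carrier H. \<alpha> u v w + dual_rep H conn u \<eta> w - dual_rep H conn v \<xi> w)))"

text \<open>
  A triple \<open>(\<hh>, \<nabla>, [\<alpha>])\<close> carries the class \<open>[\<alpha>]\<close> as the set of its representatives. The symplectic
  form on \<^const>\<open>extension_algebra\<close> does not enter, as being filiform only concerns the Lie algebra.
\<close>
type_synonym ('k, 'b) triple =
  "('k, 'b) lie \<times> ('b \<Rightarrow> 'b \<Rightarrow> 'b) \<times> ('b \<Rightarrow> 'b \<Rightarrow> 'b \<Rightarrow> 'k) set"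

definition filiform_class ::
    "('k::field_char_0, 'b) lie \<Rightarrow> ('b \<Rightarrow> 'b \<Rightarrow> 'b) \<Rightarrow> ('b \<Rightarrow> 'b \<Rightarrow> 'b \<Rightarrow> 'k) set \<Rightarrow> bool" where
  "filiform_class H conn c \<longleftrightarrow> (\<exists>\<alpha>\<in>c. filiform (extension_algebra H conn \<alpha>))"

definition pullback ::
    "('k::field_char_0, 'a) lie \<Rightarrow> ('a \<Rightarrow> 'b) \<Rightarrow> ('b \<Rightarrow> 'b \<Rightarrow> 'b \<Rightarrow> 'k) \<Rightarrow> 'a \<Rightarrow> 'a \<Rightarrow> 'a \<Rightarrow> 'k" where
  "pullback H f \<alpha> = (\<lambda>u\<in>carrier H. \<lambda>v\<in>carrier H. \<lambda>w\<in>carrier H. \<alpha> (f u) (f v) (f w))"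

definition triple_isomorphic :: "('k::field_char_0, 'a) triple \<Rightarrow> ('k, 'b) triple \<Rightarrow> bool" where
  "triple_isomorphic = (\<lambda>(H, conn, c) (H', conn', c').
     \<exists>f\<in>lie_iso H H'.
       (\<forall>u\<in>carrier H. \<forall>v\<in>carrier H. f (conn u v) = conn' (f u) (f v)) \<and>
       pullback H f ` c' = c)"


section \<open>The extension triple with respect to a Lagrangian ideal\<close>

definition quotient_connection ::
    "('k::field_char_0, 'a) lie \<Rightarrow> ('a \<Rightarrow> 'a \<Rightarrow> 'k) \<Rightarrow> 'a set \<Rightarrow> 'a set \<Rightarrow> 'a set \<Rightarrow> 'a set" where
  "quotient_connection L \<omega> I U V = (THE W. W \<in> carrier (quotient_lie L I) \<and>
     (\<forall>u\<in>U. \<forall>v\<in>V. \<forall>w\<in>W. \<forall>a\<in>I. \<omega> w a = - \<omega> v (bracket L u a)))"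

definition lagrangian_complement ::
    "('k::field_char_0, 'a) lie \<Rightarrow> ('a \<Rightarrow> 'a \<Rightarrow> 'k) \<Rightarrow> 'a set \<Rightarrow> 'a set \<Rightarrow> bool" where
  "lagrangian_complement L \<omega> I N \<longleftrightarrow> lagrangian_subspace L \<omega> N \<and>
     I \<inter> N = {\<zero>\<^bsub>L\<^esub>} \<and> I <+>\<^bsub>L\<^esub> N = carrier L"

definition projection_along ::
    "('k::field_char_0, 'a) lie \<Rightarrow> 'a set \<Rightarrow> 'a set \<Rightarrow> 'a \<Rightarrow> 'a" where
  "projection_along L I N x = (THE a. a \<in> I \<and> x \<ominus>\<^bsub>L\<^esub> a \<in> N)"

text \<open>The lift to \<open>N\<close> of a coset \<open>U\<close> is the unique element of \<open>U \<inter> N\<close>.\<close>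
definition extension_cocycle ::
    "('k::field_char_0, 'a) lie \<Rightarrow> ('a \<Rightarrow> 'a \<Rightarrow> 'k) \<Rightarrow> 'a set \<Rightarrow> 'a set \<Rightarrow>
     'a set \<Rightarrow> 'a set \<Rightarrow> 'a set \<Rightarrow> 'k" where
  "extension_cocycle L \<omega> I N =
     (\<lambda>U\<in>carrier (quotient_lie L I). \<lambda>V\<in>carrier (quotient_lie L I).
      \<lambda>W\<in>carrier (quotient_lie L I).
        \<omega> (projection_along L I N (bracket L (the_elem (U \<inter> N)) (the_elem (V \<inter> N))))
          (the_elem (W \<inter> N)))"

text \<open>The class of the extension cocycle does not depend on the Lagrangian complement \<open>N\<close>.\<close>
definition extension_class ::
    "('k::field_char_0, 'a) lie \<Rightarrow> ('a \<Rightarrow> 'a \<Rightarrow> 'k) \<Rightarrow> 'a set \<Rightarrow>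
     ('a set \<Rightarrow> 'a set \<Rightarrow> 'a set \<Rightarrow> 'k) set" where
  "extension_class L \<omega> I = (THE c. \<exists>N. lagrangian_complement L \<omega> I N \<and>
     c = cohomologous (quotient_lie L I) (quotient_connection L \<omega> I) `` {extension_cocycle L \<omega> I N})"

definition extension_triple ::
    "('k::field_char_0, 'a) lie \<Rightarrow> ('a \<Rightarrow> 'a \<Rightarrow> 'k) \<Rightarrow> 'a set \<Rightarrow> ('k, 'a set) triple" where
  "extension_triple L \<omega> I = (quotient_lie L I, quotient_connection L \<omega> I, extension_class L \<omega> I)"


section \<open>The correspondence\<close>

text \<open>
  In dimension \<open>2 = 2\<ell>\<close> the ideal \<open>C\<^bsup>\<ell>-1\<^esup>\<gg> = \<gg>\<close> is not Lagrangian, so that the correspondence is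
  defined for \<open>\<ell> \<ge> 2\<close> only; hence the bounds on the dimensions of \<open>\<gg>\<close> and \<open>\<hh>\<close> below.

  Isomorphism classes are formed among the structures whose carriers are subsets of a fixed type:
  \<open>'a\<close> for symplectic Lie algebras and \<open>'a set\<close>, where the quotients live, for triples. As
  a vector space of finite non-zero dimension over the infinite field \<open>'k\<close> is equinumerous to
  \<open>'k\<close>, this covers all isomorphism classes as soon as there is an injection from \<open>'k\<close> to \<open>'a\<close>.
\<close>

definition canonical_ideal :: "('k::field_char_0, 'a) lie \<Rightarrow> 'a set" where
  "canonical_ideal L = lower_central L (lie_dim L div 2 - 1)"

definition filiform_symplectic :: "('k::field_char_0, 'a) sympl set" where
  "filiform_symplectic =
     {(L, \<omega>). symplectic_lie_algebra L \<omega> \<and> filiform L \<and> lie_dim L \<ge> 4}"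

definition filiform_symplectic_iso :: "('k::field_char_0, 'a) sympl rel" where
  "filiform_symplectic_iso =
     {(S, S') \<in> filiform_symplectic \<times> filiform_symplectic. symplectic_isomorphic S S'}"

definition filiform_triples :: "('k::field_char_0, 'b) triple set" where
  "filiform_triples = {(H, conn, c). flat_lie_algebra H conn \<and>
     c \<in> lagrangian_cohomology2 H conn \<and> filiform_class H conn c \<and> lie_dim H \<ge> 2}"

definition filiform_triples_iso :: "('k::field_char_0, 'b) triple rel" where
  "filiform_triples_iso =
     {(T, T') \<in> filiform_triples \<times> filiform_triples. triple_isomorphic T T'}"

definition canonical_triple :: "('k::field_char_0, 'a) sympl \<Rightarrow> ('k, 'a set) triple" where
  "canonical_triple = (\<lambda>(L, \<omega>). extension_triple L \<omega> (canonical_ideal L))"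

end

theory Submission
  imports Defs
begin

text \<open>
  In a filiform symplectic Lie algebra of dimension \<open>n = 2\<ell>\<close> closedness of the form gives
  \<open>\<omega>(C\<^sup>i, C\<^sup>j) = 0\<close> for \<open>i + j \<ge> n - 1\<close>. As \<open>C\<^bsup>\<ell>-1\<^esup>\<close> has dimension \<open>\<ell>\<close> and \<open>C\<^sup>\<ell>\<close> has
  codimension one in it, \<open>C\<^bsup>\<ell>-1\<^esup>\<close> is Lagrangian; and it is the only Lagrangian ideal \<open>I\<close>, since the
  chain \<open>C\<^sup>i + I\<close> decreases strictly until it reaches \<open>I\<close>.

  Choosing a Lagrangian complement identifies a symplectic Lie algebra with the extension algebra of
  its extension triple. Hence an isomorphism of extension algebras \<open>\<hh> \<oplus> \<hh>\<^sup>*\<close> that are filiform respects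
  the ideals \<open>\<hh>\<^sup>*\<close>; it therefore induces an isomorphism of the flat Lie algebras, and its component
  \<open>\<hh> \<rightarrow> \<hh>'\<^sup>*\<close> is the Lagrangian cochain relating the two cocycles. So triples are isomorphic exactly when
  their extension algebras are, and the correspondence is bijective because the extension algebra of
  a triple, moved to the prescribed type, is sent back to that triple.
\<close>

text \<open>The vanishing of \<omega>(C^i, C^j) for i + j \<ge> n - 1 is one short of isotropy of
  C^(l-1), because (l-1) + (l-1) = n - 2; the codimension of C^l closes the gap. The dimensions come
  from a squeeze: modulo an ideal that is not yet reached, the first step of the lower central
  series loses at least two dimensions and every later step at least one, and class n - 1 leaves
  room for no more. The same count modulo I gives uniqueness.

  The Jacobi identity of an extension algebra is never computed from the cocycle identity: being
  filiform includes being a Lie algebra, and for the triple of (g, \<omega>) the axioms are carried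
  over from g. One lemma on isomorphisms of extension algebras respecting the dual part serves
  twice: it recovers isomorphisms of triples, and, for isomorphisms inducing the identity on the
  base, it shows that the class does not depend on the complement.

  An extension algebra lives on a product with a function type, not on the prescribed type.
  Surjectivity therefore rests on cardinality: over an infinite field a finite-dimensional space is
  no larger than the field, so it can be moved along \<open>emb\<close>.\<close>

section \<open>Dimensions of subspaces\<close>

context vectorspace
begin

text \<open>Independent sets have at most \<open>dim\<close> elements, so a maximal one inside W
  exists, and maximality makes it span W. Independence and span are those of V, so that bases of
  nested subspaces can be compared in one ambient space.\<close>

lemma subspace_basis_exists:
  assumes "fin_dim" and W: "subspace K W V"
  shows "\<exists>B. finite B \<and> B \<subseteq> W \<and> lin_indpt B \<and> span B = W \<and> card B = vectorspace.dim K (vs W)"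
proof -
  have WV: "W \<subseteq> carrier V"
    using W by (simp add: subspace_def submodule_def)
  have sm: "submodule K W V"
    using W by simp
  obtain B where B: "finite B" "maximal B (\<lambda>S. S \<subseteq> W \<and> lin_indpt S)"
  proof -
    have "finite A \<and> card A \<le> dim" if "A \<subseteq> W \<and> lin_indpt A" for A
      using li_le_dim[OF assms(1), of A] that WV by blast
    moreover have "{} \<subseteq> W \<and> lin_indpt {}" by (auto simp: lin_dep_def)
    ultimately show ?thesis
      using maximal_exists[of "\<lambda>S. S \<subseteq> W \<and> lin_indpt S" dim "{}"] that by blast
  qed
  then have BW: "B \<subseteq> W" and li: "lin_indpt B"
    by (auto simp: maximal_def)
  have "W \<subseteq> span B"
  proof
    fix x assume x: "x \<in> W"
    show "x \<in> span B"
    proof (rule ccontr)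
      assume nx: "x \<notin> span B"
      then have "x \<notin> B" using BW WV by (meson in_own_span subset_trans subsetD)
      then have "lin_indpt (B \<union> {x})"
        using lin_dep_iff_in_span[of B x] li BW WV x nx by blast
      then show False
        using B(2) BW x \<open>x \<notin> B\<close> unfolding maximal_def by blast
    qed
  qed
  moreover have "span B \<subseteq> W" using span_is_subset[OF BW sm] .
  ultimately have sp: "span B = W" by blast
  interpret W: vectorspace K "vs W" using subspace_is_vs[OF W] .
  have "W.basis B"
    unfolding W.basis_def using span_li_not_depend[OF BW sm] li sp BW by simp
  then have "card B = W.dim" using W.dim_basis B(1) by simp
  then show ?thesis using B BW li sp by blast
qed

lemma subspace_fin_dim:
  assumes "fin_dim" and W: "subspace K W V"
  shows "vectorspace.fin_dim K (vs W)"
proof -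
  obtain B where B: "finite B" "B \<subseteq> W" "span B = W"
    using subspace_basis_exists[OF assms] by blast
  interpret W: vectorspace K "vs W" using subspace_is_vs[OF W] .
  show ?thesis
    unfolding W.fin_dim_def using B span_li_not_depend(1)[of B W] W by auto
qed

text \<open>A basis of W together with a vector of W' outside W is still independent in W'.\<close>

lemma subspace_dim_strict_mono:
  assumes "fin_dim" and W: "subspace K W V" and W': "subspace K W' V" and "W \<subset> W'"
  shows "vectorspace.dim K (vs W) < vectorspace.dim K (vs W')"
proof -
  obtain B where B: "finite B" "B \<subseteq> W" "lin_indpt B" "span B = W" "card B = vectorspace.dim K (vs W)"
    using subspace_basis_exists[OF assms(1,2)] by blast
  obtain x where x: "x \<in> W'" "x \<notin> W" using assms(4) by blast
  have W'V: "W' \<subseteq> carrier V"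
    using W' by (simp add: subspace_def submodule_def)
  have xB: "x \<notin> B" using B(2) x by blast
  have li: "lin_indpt (B \<union> {x})"
    using lin_dep_iff_in_span[of B x] B x xB assms(4) W'V by blast
  have sub: "B \<union> {x} \<subseteq> W'" using B x assms(4) by blast
  interpret W': vectorspace K "vs W'" using subspace_is_vs[OF W'] .
  have "card (B \<union> {x}) \<le> W'.dim"
    by (rule W'.li_le_dim(2))
      (use subspace_fin_dim[OF assms(1) W'] sub li span_li_not_depend(2)[OF sub] W' in auto)
  then show ?thesis using B xB by simp
qed

lemma subspace_dim_mono:
  assumes "fin_dim" and "subspace K W V" and "subspace K W' V" and "W \<subseteq> W'"
  shows "vectorspace.dim K (vs W) \<le> vectorspace.dim K (vs W')"
  using subspace_dim_strict_mono[OF assms(1-3)] assms(4) by (metis less_imp_le order_refl psubsetI)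

text \<open>The unit step of the dimension counts: it raises the dimension by at most one
  (\<open>dim_le_adjoin\<close>), and by at least one if the vector is new
  (\<open>subspace_dim_strict_mono\<close>).\<close>

definition adjoin :: "'c set \<Rightarrow> 'c \<Rightarrow> 'c set" where
  "adjoin W x = {w \<oplus>\<^bsub>V\<^esub> c \<odot>\<^bsub>V\<^esub> x | w c. w \<in> W \<and> c \<in> carrier K}"

lemma subspaceD:
  assumes "subspace K W V"
  shows "W \<subseteq> carrier V" "\<zero>\<^bsub>V\<^esub> \<in> W" "\<And>x y. x \<in> W \<Longrightarrow> y \<in> W \<Longrightarrow> x \<oplus>\<^bsub>V\<^esub> y \<in> W"
    "\<And>c x. c \<in> carrier K \<Longrightarrow> x \<in> W \<Longrightarrow> c \<odot>\<^bsub>V\<^esub> x \<in> W"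
  using assms by (auto simp: subspace_def submodule_def)

lemma subspaceI:
  assumes "W \<subseteq> carrier V" "\<zero>\<^bsub>V\<^esub> \<in> W" "\<And>x y. x \<in> W \<Longrightarrow> y \<in> W \<Longrightarrow> x \<oplus>\<^bsub>V\<^esub> y \<in> W"
    "\<And>c x. c \<in> carrier K \<Longrightarrow> x \<in> W \<Longrightarrow> c \<odot>\<^bsub>V\<^esub> x \<in> W"
  shows "subspace K W V"
  by (intro subspace.intro submodule.intro vectorspace_axioms module_axioms assms)

lemma subspace_neg:
  assumes "subspace K W V" "x \<in> W"
  shows "\<ominus>\<^bsub>V\<^esub> x \<in> W"
proof -
  have "(\<ominus>\<^bsub>K\<^esub> \<one>\<^bsub>K\<^esub>) \<odot>\<^bsub>V\<^esub> x = \<ominus>\<^bsub>V\<^esub> x"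
    using subspaceD(1)[OF assms(1)] assms(2) smult_minus_1[of x] by auto
  then show ?thesis
    using subspaceD(4)[OF assms(1) _ assms(2), of "\<ominus>\<^bsub>K\<^esub> \<one>\<^bsub>K\<^esub>"] by simp
qed

lemma subspace_minus:
  assumes "subspace K W V" "x \<in> W" "y \<in> W"
  shows "x \<ominus>\<^bsub>V\<^esub> y \<in> W"
  using assms subspace_neg subspaceD(3) by (simp add: a_minus_def)

lemma subspace_carrier: "subspace K (carrier V) V"
  by (rule subspaceI) auto

lemma subspace_zero: "subspace K {\<zero>\<^bsub>V\<^esub>} V"
  by (rule subspaceI) auto

lemma subspace_adjoin:
  assumes W: "subspace K W V" and x: "x \<in> carrier V"
  shows "subspace K (adjoin W x) V" "W \<subseteq> adjoin W x" "x \<in> adjoin W x"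
proof -
  note D = subspaceD[OF W]
  show sub: "W \<subseteq> adjoin W x"
  proof
    fix w assume w: "w \<in> W"
    then have "w = w \<oplus>\<^bsub>V\<^esub> \<zero>\<^bsub>K\<^esub> \<odot>\<^bsub>V\<^esub> x" using D(1) x by auto
    then show "w \<in> adjoin W x" using w unfolding adjoin_def by blast
  qed
  have "x = \<zero>\<^bsub>V\<^esub> \<oplus>\<^bsub>V\<^esub> \<one>\<^bsub>K\<^esub> \<odot>\<^bsub>V\<^esub> x" using x by simp
  then show "x \<in> adjoin W x" using D(2) unfolding adjoin_def by blast
  show "subspace K (adjoin W x) V"
  proof (rule subspaceI)
    show "adjoin W x \<subseteq> carrier V" using D(1) x by (auto simp: adjoin_def)
    show "\<zero>\<^bsub>V\<^esub> \<in> adjoin W x" using sub D(2) by blast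
  next
    fix y z assume "y \<in> adjoin W x" "z \<in> adjoin W x"
    then obtain w c w' c' where *: "y = w \<oplus>\<^bsub>V\<^esub> c \<odot>\<^bsub>V\<^esub> x" "z = w' \<oplus>\<^bsub>V\<^esub> c' \<odot>\<^bsub>V\<^esub> x"
      "w \<in> W" "c \<in> carrier K" "w' \<in> W" "c' \<in> carrier K" by (auto simp: adjoin_def)
    have "w \<in> carrier V" "w' \<in> carrier V" using * D(1) by auto
    then have "y \<oplus>\<^bsub>V\<^esub> z = (w \<oplus>\<^bsub>V\<^esub> w') \<oplus>\<^bsub>V\<^esub> (c \<oplus>\<^bsub>K\<^esub> c') \<odot>\<^bsub>V\<^esub> x"
      using * x by (simp add: smult_l_distr M.a_ac)
    then show "y \<oplus>\<^bsub>V\<^esub> z \<in> adjoin W x"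
      using * D(3) R.a_closed unfolding adjoin_def by blast
  next
    fix d y assume d: "d \<in> carrier K" and "y \<in> adjoin W x"
    then obtain w c where *: "y = w \<oplus>\<^bsub>V\<^esub> c \<odot>\<^bsub>V\<^esub> x"
      "w \<in> W" "c \<in> carrier K" by (auto simp: adjoin_def)
    have "w \<in> carrier V" using * D(1) by auto
    then have "d \<odot>\<^bsub>V\<^esub> y = d \<odot>\<^bsub>V\<^esub> w \<oplus>\<^bsub>V\<^esub> (d \<otimes>\<^bsub>K\<^esub> c) \<odot>\<^bsub>V\<^esub> x"
      using * x d by (simp add: smult_r_distr smult_assoc1)
    then show "d \<odot>\<^bsub>V\<^esub> y \<in> adjoin W x"
      using * D(4) d R.m_closed unfolding adjoin_def by blast
  qed
qed

lemma span_insert_adjoin: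
  assumes "B \<subseteq> carrier V" "x \<in> carrier V"
  shows "span (insert x B) = adjoin (span B) x"
proof
  have sB: "subspace K (span B) V" using span_is_subspace assms(1) by simp
  note A = subspace_adjoin[OF sB assms(2)]
  have "insert x B \<subseteq> adjoin (span B) x"
    using A(2,3) in_own_span[OF assms(1)] by blast
  then show "span (insert x B) \<subseteq> adjoin (span B) x"
    using span_is_subset is_module[OF A(1)] by simp
  have s: "subspace K (span (insert x B)) V" using span_is_subspace assms by simp
  have "span B \<subseteq> span (insert x B)" using span_is_monotone by blast
  moreover have "x \<in> span (insert x B)" using in_own_span[of "insert x B"] assms by auto
  ultimately show "adjoin (span B) x \<subseteq> span (insert x B)"
    using subspaceD(3,4)[OF s] by (auto simp: adjoin_def)
qed

lemma dim_le_adjoin: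
  assumes "fin_dim" and W: "subspace K W V" and x: "x \<in> carrier V"
    and U: "subspace K U V" and "U \<subseteq> adjoin W x"
  shows "vectorspace.dim K (vs U) \<le> Suc (vectorspace.dim K (vs W))"
proof -
  obtain B where B: "finite B" "B \<subseteq> W" "span B = W" "card B = vectorspace.dim K (vs W)"
    using subspace_basis_exists[OF assms(1,2)] by blast
  have BV: "B \<subseteq> carrier V" using B(2) subspaceD(1)[OF W] by blast
  let ?A = "adjoin W x"
  note A = subspace_adjoin[OF W x]
  have sp: "span (insert x B) = ?A" using span_insert_adjoin[OF BV x] B(3) by simp
  have sub: "insert x B \<subseteq> ?A" using A B(2) by blast
  interpret A: vectorspace K "vs ?A" using subspace_is_vs[OF A(1)] .
  have "A.dim \<le> card (insert x B)"
    by (rule A.gen_ge_dim) (use B(1) sub sp span_li_not_depend(1)[OF sub] A(1) in auto)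
  also have "\<dots> \<le> Suc (card B)" using B(1) by (simp add: card_insert_if)
  finally show ?thesis
    using subspace_dim_mono[OF assms(1) U A(1) assms(5)] B(4) by simp
qed

lemma dim_zero_subspace: "vectorspace.dim K (vs {\<zero>\<^bsub>V\<^esub>}) = 0"
proof -
  interpret Z: vectorspace K "vs {\<zero>\<^bsub>V\<^esub>}" using subspace_is_vs[OF subspace_zero] .
  have "Z.gen_set {}"
    using Z.span_empty by simp
  then show ?thesis using Z.gen_ge_dim[of "{}"] by simp
qed

end

section \<open>Linear maps and isomorphisms\<close>

abbreviation linear_maps :: "('k::field_char_0, 'a, 'r) module_scheme \<Rightarrow> ('k, 'b, 's) module_scheme \<Rightarrow> ('a \<Rightarrow> 'b) set" where
  "linear_maps \<equiv> LinearCombinations.module_hom class_ring"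

lemma linear_mapsI:
  assumes "\<And>x. x \<in> carrier L \<Longrightarrow> f x \<in> carrier M"
    and "\<And>x y. x \<in> carrier L \<Longrightarrow> y \<in> carrier L \<Longrightarrow> f (x \<oplus>\<^bsub>L\<^esub> y) = f x \<oplus>\<^bsub>M\<^esub> f y"
    and "\<And>c x. x \<in> carrier L \<Longrightarrow> f (c \<odot>\<^bsub>L\<^esub> x) = c \<odot>\<^bsub>M\<^esub> f x"
  shows "f \<in> linear_maps L M"
  using assms by (auto simp: LinearCombinations.module_hom_def)

lemma linear_mapsD:
  assumes "f \<in> linear_maps L M"
  shows "\<And>x. x \<in> carrier L \<Longrightarrow> f x \<in> carrier M"
    and "\<And>x y. x \<in> carrier L \<Longrightarrow> y \<in> carrier L \<Longrightarrow> f (x \<oplus>\<^bsub>L\<^esub> y) = f x \<oplus>\<^bsub>M\<^esub> f y"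
    and "\<And>c x. x \<in> carrier L \<Longrightarrow> f (c \<odot>\<^bsub>L\<^esub> x) = c \<odot>\<^bsub>M\<^esub> f x"
  using assms by (auto simp: LinearCombinations.module_hom_def)

lemma linear_map_if_linear_maps:
  assumes "vectorspace class_ring L" "vectorspace class_ring M" "f \<in> linear_maps L M"
  shows "linear_map class_ring L M f"
  using assms by (auto simp: linear_map_def mod_hom_def mod_hom_axioms_def vectorspace_def)

lemma scalars_simps [simp]:
  "carrier scalars = UNIV" "add scalars = (+)" "zero scalars = 0" "smult scalars = (*)"
  by (simp_all add: scalars_def)

lemma bilinear_mapI:
  assumes "\<And>x y. x \<in> carrier L \<Longrightarrow> y \<in> carrier M \<Longrightarrow> B x y \<in> carrier N"
    and "\<And>x x' y. x \<in> carrier L \<Longrightarrow> x' \<in> carrier L \<Longrightarrow> y \<in> carrier M \<Longrightarrow> B (x \<oplus>\<^bsub>L\<^esub> x') y = B x y \<oplus>\<^bsub>N\<^esub> B x' y"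
    and "\<And>c x y. x \<in> carrier L \<Longrightarrow> y \<in> carrier M \<Longrightarrow> B (c \<odot>\<^bsub>L\<^esub> x) y = c \<odot>\<^bsub>N\<^esub> B x y"
    and "\<And>x y y'. x \<in> carrier L \<Longrightarrow> y \<in> carrier M \<Longrightarrow> y' \<in> carrier M \<Longrightarrow> B x (y \<oplus>\<^bsub>M\<^esub> y') = B x y \<oplus>\<^bsub>N\<^esub> B x y'"
    and "\<And>c x y. x \<in> carrier L \<Longrightarrow> y \<in> carrier M \<Longrightarrow> B x (c \<odot>\<^bsub>M\<^esub> y) = c \<odot>\<^bsub>N\<^esub> B x y"
  shows "bilinear_map L M N B"
  using assms by (auto simp: bilinear_map_def intro!: linear_mapsI)

lemma bilinear_mapD:
  assumes "bilinear_map L M N B"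
  shows "\<And>x y. x \<in> carrier L \<Longrightarrow> y \<in> carrier M \<Longrightarrow> B x y \<in> carrier N"
    and "\<And>x x' y. x \<in> carrier L \<Longrightarrow> x' \<in> carrier L \<Longrightarrow> y \<in> carrier M \<Longrightarrow> B (x \<oplus>\<^bsub>L\<^esub> x') y = B x y \<oplus>\<^bsub>N\<^esub> B x' y"
    and "\<And>c x y. x \<in> carrier L \<Longrightarrow> y \<in> carrier M \<Longrightarrow> B (c \<odot>\<^bsub>L\<^esub> x) y = c \<odot>\<^bsub>N\<^esub> B x y"
    and "\<And>x y y'. x \<in> carrier L \<Longrightarrow> y \<in> carrier M \<Longrightarrow> y' \<in> carrier M \<Longrightarrow> B x (y \<oplus>\<^bsub>M\<^esub> y') = B x y \<oplus>\<^bsub>N\<^esub> B x y'"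
    and "\<And>c x y. x \<in> carrier L \<Longrightarrow> y \<in> carrier M \<Longrightarrow> B x (c \<odot>\<^bsub>M\<^esub> y) = c \<odot>\<^bsub>N\<^esub> B x y"
proof -
  have 1: "\<And>x. x \<in> carrier L \<Longrightarrow> B x \<in> linear_maps M N"
    and 2: "\<And>y. y \<in> carrier M \<Longrightarrow> (\<lambda>x. B x y) \<in> linear_maps L N"
    using assms by (auto simp: bilinear_map_def)
  show "\<And>x y. x \<in> carrier L \<Longrightarrow> y \<in> carrier M \<Longrightarrow> B x y \<in> carrier N"
    using linear_mapsD(1)[OF 1] by blast
  show "\<And>x x' y. x \<in> carrier L \<Longrightarrow> x' \<in> carrier L \<Longrightarrow> y \<in> carrier M \<Longrightarrow> B (x \<oplus>\<^bsub>L\<^esub> x') y = B x y \<oplus>\<^bsub>N\<^esub> B x' y"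
    using linear_mapsD(2)[OF 2] by blast
  show "\<And>c x y. x \<in> carrier L \<Longrightarrow> y \<in> carrier M \<Longrightarrow> B (c \<odot>\<^bsub>L\<^esub> x) y = c \<odot>\<^bsub>N\<^esub> B x y"
    using linear_mapsD(3)[OF 2] by blast
  show "\<And>x y y'. x \<in> carrier L \<Longrightarrow> y \<in> carrier M \<Longrightarrow> y' \<in> carrier M \<Longrightarrow> B x (y \<oplus>\<^bsub>M\<^esub> y') = B x y \<oplus>\<^bsub>N\<^esub> B x y'"
    using linear_mapsD(2)[OF 1] by blast
  show "\<And>c x y. x \<in> carrier L \<Longrightarrow> y \<in> carrier M \<Longrightarrow> B x (c \<odot>\<^bsub>M\<^esub> y) = c \<odot>\<^bsub>N\<^esub> B x y"
    using linear_mapsD(3)[OF 1] by blast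
qed

text \<open>M is a bare record whose axioms are equations, pulled back to L along the surjection f.
  As M is not yet known to be a group, f mapping zero to zero has to be assumed here and cannot be
  derived from additivity.\<close>

lemma vectorspace_image:
  assumes L: "vectorspace class_ring L" and f: "f \<in> linear_maps L M"
    and surj: "f ` carrier L = carrier M" and zero: "f \<zero>\<^bsub>L\<^esub> = \<zero>\<^bsub>M\<^esub>"
  shows "vectorspace class_ring M"
proof -
  interpret L: vectorspace class_ring L using L .
  note D = linear_mapsD[OF f]
  have surj: "\<exists>x\<in>carrier L. y = f x" if "y \<in> carrier M" for y
    using surj that by auto
  show ?thesis
  proof (rule vs_criteria, goal_cases)
    case 1 show ?case by (rule class_field)
  next
    case 2 show ?case using D(1)[OF L.M.zero_closed] zero by simp
  next
    case 3 then show ?case using surj D by (metis L.M.a_closed)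
  next
    case 4
    show ?case
    proof
      fix v assume "v \<in> carrier M"
      then obtain x where x: "x \<in> carrier L" "v = f x" using surj by blast
      then have "v \<oplus>\<^bsub>M\<^esub> f (\<ominus>\<^bsub>L\<^esub> x) = \<zero>\<^bsub>M\<^esub>"
        using D(2)[of x "\<ominus>\<^bsub>L\<^esub> x"] zero by (simp add: L.M.r_neg)
      then show "\<exists>w\<in>carrier M. v \<oplus>\<^bsub>M\<^esub> w = \<zero>\<^bsub>M\<^esub>" using D(1) x by blast
    qed
  next
    case 5 then show ?case
      by (metis D(1,3) L.smult_closed surj UNIV_I partial_object.select_convs(1))
  next
    case 6 then show ?case by (metis D(2) L.M.a_comm surj)
  next
    case 7
    have "(f v \<oplus>\<^bsub>M\<^esub> f w) \<oplus>\<^bsub>M\<^esub> f x = f v \<oplus>\<^bsub>M\<^esub> (f w \<oplus>\<^bsub>M\<^esub> f x)"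
      if "v \<in> carrier L" "w \<in> carrier L" "x \<in> carrier L" for v w x
      using that by (simp flip: D(2) add: L.M.a_assoc)
    then show ?case by (metis surj)
  next
    case 8 then show ?case by (metis D(2) L.M.r_zero L.M.zero_closed surj zero)
  next
    case 9
    have "(a * b) \<odot>\<^bsub>M\<^esub> f v = a \<odot>\<^bsub>M\<^esub> (b \<odot>\<^bsub>M\<^esub> f v)" if "v \<in> carrier L" for a b v
      using that L.smult_assoc1[of a b v] by (simp flip: D(3))
    then show ?case by (auto dest!: surj)
  next
    case 10
    have "1 \<odot>\<^bsub>M\<^esub> f v = f v" if "v \<in> carrier L" for v
      using that L.smult_one[of v] by (simp flip: D(3))
    then show ?case by (auto dest!: surj)
  next
    case 11
    have "(a + b) \<odot>\<^bsub>M\<^esub> f v = a \<odot>\<^bsub>M\<^esub> f v \<oplus>\<^bsub>M\<^esub> b \<odot>\<^bsub>M\<^esub> f v" if "v \<in> carrier L" for a b v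
      using that L.smult_l_distr[of a b v] by (simp flip: D(2,3))
    then show ?case by (auto dest!: surj)
  next
    case 12
    have "a \<odot>\<^bsub>M\<^esub> (f v \<oplus>\<^bsub>M\<^esub> f w) = a \<odot>\<^bsub>M\<^esub> f v \<oplus>\<^bsub>M\<^esub> a \<odot>\<^bsub>M\<^esub> f w"
      if "v \<in> carrier L" "w \<in> carrier L" for a v w
      using that L.smult_r_distr[of a v w] by (simp flip: D(2,3))
    then show ?case by (auto dest!: surj)
  qed
qed

lemma linear_maps_zero:
  assumes "vectorspace class_ring L" "vectorspace class_ring M" "f \<in> linear_maps L M"
  shows "f \<zero>\<^bsub>L\<^esub> = \<zero>\<^bsub>M\<^esub>"
proof -
  interpret linear_map class_ring L M f using linear_map_if_linear_maps[OF assms] .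
  show ?thesis by simp
qed

lemma linear_maps_neg:
  assumes "vectorspace class_ring L" "vectorspace class_ring M" "f \<in> linear_maps L M" "x \<in> carrier L"
  shows "f (\<ominus>\<^bsub>L\<^esub> x) = \<ominus>\<^bsub>M\<^esub> f x"
proof -
  interpret linear_map class_ring L M f using linear_map_if_linear_maps[OF assms(1-3)] .
  show ?thesis using assms(4) by simp
qed

lemma linear_maps_compose:
  assumes "f \<in> linear_maps L M" "g \<in> linear_maps M N"
  shows "(\<lambda>x. g (f x)) \<in> linear_maps L N"
  using linear_mapsD[OF assms(1)] linear_mapsD[OF assms(2)] by (auto intro!: linear_mapsI)

lemma linear_maps_inv:
  assumes "vectorspace class_ring L" and f: "f \<in> linear_maps L M"
    and bij: "bij_betw f (carrier L) (carrier M)"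
  shows "inv_into (carrier L) f \<in> linear_maps M L"
proof -
  interpret L: vectorspace class_ring L using assms(1) .
  note D = linear_mapsD[OF f]
  have inv: "inv_into (carrier L) f (f x) = x" if "x \<in> carrier L" for x
    using bij that by (simp add: bij_betw_def)
  have surj: "\<exists>x\<in>carrier L. y = f x" if "y \<in> carrier M" for y
    using bij that by (auto simp: bij_betw_def)
  show ?thesis
  proof (rule linear_mapsI)
    fix x y assume "x \<in> carrier M" "y \<in> carrier M"
    then obtain x' y' where "x' \<in> carrier L" "y' \<in> carrier L" "x = f x'" "y = f y'" using surj by blast
    then show "inv_into (carrier L) f (x \<oplus>\<^bsub>M\<^esub> y) = inv_into (carrier L) f x \<oplus>\<^bsub>L\<^esub> inv_into (carrier L) f y"
      by (simp flip: D(2) add: inv)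
  next
    fix c x assume "x \<in> carrier M"
    then obtain x' where "x' \<in> carrier L" "x = f x'" using surj by blast
    then show "inv_into (carrier L) f (c \<odot>\<^bsub>M\<^esub> x) = c \<odot>\<^bsub>L\<^esub> inv_into (carrier L) f x"
      by (simp flip: D(3) add: inv)
  next
    fix x assume "x \<in> carrier M"
    then show "inv_into (carrier L) f x \<in> carrier L" using inv surj by metis
  qed
qed

lemma linear_maps_dim_eq:
  assumes "vectorspace class_ring L" "vectorspace class_ring M" "vectorspace.fin_dim class_ring L"
    and "f \<in> linear_maps L M" "bij_betw f (carrier L) (carrier M)"
  shows "vectorspace.dim class_ring L = vectorspace.dim class_ring M" "vectorspace.fin_dim class_ring M"
proof -
  interpret linear_map class_ring L M f using linear_map_if_linear_maps assms by blast
  show "V.dim = W.dim" "W.fin_dim"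
    using dim_eq surj_fin_dim assms(3,5) by (auto simp: bij_betw_def)
qed

lemma linear_maps_fin_dim:
  assumes "vectorspace class_ring L" "vectorspace class_ring M" "vectorspace.fin_dim class_ring L"
    and "f \<in> linear_maps L M" "f ` carrier L = carrier M"
  shows "vectorspace.fin_dim class_ring M"
proof -
  interpret linear_map class_ring L M f using linear_map_if_linear_maps assms by blast
  show "W.fin_dim" using surj_fin_dim assms(3,5) by blast
qed

lemma linear_maps_minus:
  assumes "vectorspace class_ring L" "vectorspace class_ring M" "f \<in> linear_maps L M" "x \<in> carrier L" "y \<in> carrier L"
  shows "f (x \<ominus>\<^bsub>L\<^esub> y) = f x \<ominus>\<^bsub>M\<^esub> f y"
proof -
  interpret linear_map class_ring L M f using linear_map_if_linear_maps[OF assms(1-3)] .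
  show ?thesis using assms(4,5) by simp
qed

lemma linear_maps_rank_nullity:
  assumes "vectorspace class_ring L" "vectorspace class_ring M" "vectorspace.fin_dim class_ring L"
    and "f \<in> linear_maps L M" "f ` carrier L = carrier M"
  shows "vectorspace.dim class_ring L =
    vectorspace.dim class_ring M + vectorspace.dim class_ring (L\<lparr>carrier := {x \<in> carrier L. f x = \<zero>\<^bsub>M\<^esub>}\<rparr>)"
proof -
  interpret linear_map class_ring L M f using linear_map_if_linear_maps assms by blast
  show ?thesis
    using rank_nullity[OF assms(3)] surj_imp_imT_carrier[OF assms(5)] by (simp add: ker_def)
qed

text \<open>Both inclusions are minimality of a span: the preimage of the span of f(S) is a subspace
  containing S, and the image of the span of S is a subspace containing f(S).\<close>

lemma linear_maps_span:
  assumes "vectorspace class_ring L" "vectorspace class_ring M" "f \<in> linear_maps L M" "S \<subseteq> carrier L"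
  shows "f ` LinearCombinations.module.span class_ring L S = LinearCombinations.module.span class_ring M (f ` S)"
proof
  interpret V: vectorspace class_ring L using assms(1) .
  interpret W: vectorspace class_ring M using assms(2) .
  have f0_is_0: "f \<zero>\<^bsub>L\<^esub> = \<zero>\<^bsub>M\<^esub>" using linear_maps_zero[OF assms(1-3)] .
  note D = linear_mapsD[OF assms(3)]
  have fS: "f ` S \<subseteq> carrier M" using assms(4) D(1) by blast
  let ?U = "{x \<in> carrier L. f x \<in> W.span (f ` S)}"
  have sM: "subspace class_ring (W.span (f ` S)) M" using W.span_is_subspace[OF fS] .
  have "subspace class_ring ?U L"
    by (rule V.subspaceI) (use W.subspaceD[OF sM] D f0_is_0 in auto)
  moreover have "S \<subseteq> ?U" using W.in_own_span[OF fS] assms(4) by blast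
  ultimately have "V.span S \<subseteq> ?U" using V.span_is_subset V.is_module by blast
  then show "f ` V.span S \<subseteq> W.span (f ` S)" by blast
  have sL: "subspace class_ring (V.span S) L" using V.span_is_subspace[OF assms(4)] .
  have "subspace class_ring (f ` V.span S) M"
  proof (rule W.subspaceI)
    show "f ` V.span S \<subseteq> carrier M" using D(1) V.subspaceD(1)[OF sL] by blast
    show "\<zero>\<^bsub>M\<^esub> \<in> f ` V.span S" using V.subspaceD(2)[OF sL] f0_is_0 by (auto simp: image_iff intro!: bexI[of _ "\<zero>\<^bsub>L\<^esub>"])
  next
    fix x y assume "x \<in> f ` V.span S" "y \<in> f ` V.span S"
    then obtain x' y' where "x' \<in> V.span S" "y' \<in> V.span S" "x = f x'" "y = f y'" by blast
    then have "x \<oplus>\<^bsub>M\<^esub> y = f (x' \<oplus>\<^bsub>L\<^esub> y')" "x' \<oplus>\<^bsub>L\<^esub> y' \<in> V.span S"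
      using V.subspaceD(1,3)[OF sL] D(2) by (auto simp: subset_iff)
    then show "x \<oplus>\<^bsub>M\<^esub> y \<in> f ` V.span S" by blast
  next
    fix c x assume "x \<in> f ` V.span S"
    then obtain x' where "x' \<in> V.span S" "x = f x'" by blast
    then have "c \<odot>\<^bsub>M\<^esub> x = f (c \<odot>\<^bsub>L\<^esub> x')" "c \<odot>\<^bsub>L\<^esub> x' \<in> V.span S"
      using V.subspaceD(1,4)[OF sL] D(3) by auto
    then show "c \<odot>\<^bsub>M\<^esub> x \<in> f ` V.span S" by blast
  qed
  moreover have "f ` S \<subseteq> f ` V.span S" using V.in_own_span[OF assms(4)] by blast
  ultimately show "W.span (f ` S) \<subseteq> f ` V.span S" using W.span_is_subset W.is_module by blast
qed

subsection \<open>Lie algebras\<close>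

declare lower_central.simps(2) [simp del]

context lie_algebra
begin

lemmas bracket_closed [simp, intro] = bilinear_mapD(1)[OF bracket_bilinear]
lemmas bracket_add_left = bilinear_mapD(2)[OF bracket_bilinear]
lemmas bracket_smult_left = bilinear_mapD(3)[OF bracket_bilinear]
lemmas bracket_add_right = bilinear_mapD(4)[OF bracket_bilinear]
lemmas bracket_smult_right = bilinear_mapD(5)[OF bracket_bilinear]

lemma scal_closed [simp, intro]: "x \<in> carrier L \<Longrightarrow> c \<odot> x \<in> carrier L"
  by simp

lemma bracket_right_linear: "x \<in> carrier L \<Longrightarrow> bracket L x \<in> linear_maps L L"
  using bracket_bilinear by (simp add: bilinear_map_def)

lemma bracket_left_linear: "x \<in> carrier L \<Longrightarrow> (\<lambda>y. bracket L y x) \<in> linear_maps L L"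
  using bracket_bilinear by (simp add: bilinear_map_def)

lemma bracket_zero_right [simp]: "x \<in> carrier L \<Longrightarrow> bracket L x \<zero> = \<zero>"
  using linear_maps_zero[OF vectorspace_axioms vectorspace_axioms bracket_right_linear] by simp

lemma bracket_zero_left [simp]: "x \<in> carrier L \<Longrightarrow> bracket L \<zero> x = \<zero>"
  using linear_maps_zero[OF vectorspace_axioms vectorspace_axioms bracket_left_linear] by simp

lemma bracket_neg_right: "x \<in> carrier L \<Longrightarrow> y \<in> carrier L \<Longrightarrow> bracket L x (\<ominus> y) = \<ominus> bracket L x y"
  using linear_maps_neg[OF vectorspace_axioms vectorspace_axioms bracket_right_linear] by simp

lemma bracket_anticomm:
  assumes x: "x \<in> carrier L" and y: "y \<in> carrier L"
  shows "bracket L x y = \<ominus> bracket L y x"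
proof -
  have "\<zero> = bracket L (x \<oplus> y) (x \<oplus> y)"
    using assms by (simp add: bracket_alternating)
  also have "\<dots> = bracket L x x \<oplus> bracket L y x \<oplus> (bracket L x y \<oplus> bracket L y y)"
    using assms by (simp only: bracket_add_left bracket_add_right M.a_closed)
  also have "\<dots> = bracket L y x \<oplus> bracket L x y"
    using assms by (simp add: bracket_alternating)
  finally show ?thesis using assms M.minus_equality
    by (metis M.a_comm bracket_closed)
qed

lemma bracket_bracket:
  assumes x: "x \<in> carrier L" and y: "y \<in> carrier L" and z: "z \<in> carrier L"
  shows "bracket L (bracket L x y) z = bracket L x (bracket L y z) \<ominus> bracket L y (bracket L x z)"
proof -
  have "bracket L (bracket L x y) z = \<ominus> bracket L z (bracket L x y)"
    by (rule bracket_anticomm) (use assms in auto)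
  moreover have "bracket L y (bracket L z x) = \<ominus> bracket L y (bracket L x z)"
    unfolding bracket_anticomm[OF z x] by (rule bracket_neg_right) (use assms in auto)
  moreover have "bracket L x (bracket L y z) \<oplus> bracket L y (bracket L z x) \<oplus> bracket L z (bracket L x y) = \<zero>"
    using jacobi assms by simp
  ultimately show ?thesis
    using M.minus_equality[of "bracket L x (bracket L y z) \<oplus> bracket L y (bracket L z x)" "bracket L z (bracket L x y)"] assms
    by (simp add: a_minus_def)
qed

lemma minus_eq_zero_iff:
  assumes "x \<in> carrier L" "y \<in> carrier L"
  shows "x \<ominus> y = \<zero> \<longleftrightarrow> x = y"
proof
  assume "x \<ominus> y = \<zero>"
  then have "x \<oplus> \<ominus> y = y \<oplus> \<ominus> y" using assms by (simp add: a_minus_def M.r_neg)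
  then show "x = y" using assms M.add.right_cancel[of "\<ominus> y" x y] by simp
qed (use assms in \<open>simp add: a_minus_def M.r_neg\<close>)

lemma minus_add_cancel:
  assumes "x \<in> carrier L" "y \<in> carrier L"
  shows "(x \<ominus> y) \<oplus> y = x" "(x \<oplus> y) \<ominus> y = x"
  using assms by (simp_all add: a_minus_def M.a_assoc M.l_neg M.r_neg)

lemma minus_minus_cancel:
  assumes "x \<in> carrier L" "y \<in> carrier L" "z \<in> carrier L"
  shows "(x \<ominus> y) \<ominus> (x \<ominus> z) = z \<ominus> y"
  using assms by (simp add: a_minus_def M.minus_add M.a_ac M.r_neg1 M.r_neg2)

end

lemma lie_isoD:
  assumes "f \<in> lie_iso L M"
  shows "f \<in> linear_maps L M" "bij_betw f (carrier L) (carrier M)"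
    "\<And>x y. x \<in> carrier L \<Longrightarrow> y \<in> carrier L \<Longrightarrow> f (bracket L x y) = bracket M (f x) (f y)"
  using assms by (auto simp: lie_iso_def)

text \<open>Transport of the Lie axioms along a surjection. The quotient by an ideal, the extension
  algebra of a splitting and the copy on a prescribed type all become Lie algebras this way, without
  a computation of their own.\<close>

lemma lie_algebra_image:
  assumes L: "lie_algebra L" and f: "f \<in> linear_maps L M" "f ` carrier L = carrier M"
    "\<And>x y. x \<in> carrier L \<Longrightarrow> y \<in> carrier L \<Longrightarrow> f (bracket L x y) = bracket M (f x) (f y)"
    and zero: "f \<zero>\<^bsub>L\<^esub> = \<zero>\<^bsub>M\<^esub>"
  shows "lie_algebra M"
proof -
  interpret L: lie_algebra L using L .
  note D = linear_mapsD[OF f(1)]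
  have surj: "\<exists>x\<in>carrier L. y = f x" if "y \<in> carrier M" for y
    using f(2) that by auto
  interpret M: vectorspace class_ring M
    using vectorspace_image[OF L.vectorspace_axioms f(1,2) zero] .
  show ?thesis
  proof
    show "M.fin_dim" using linear_maps_fin_dim[OF L.vectorspace_axioms M.vectorspace_axioms L.fin_dim f(1,2)] .
    show "bilinear_map M M M (bracket M)"
    proof (rule bilinear_mapI)
      fix x y assume "x \<in> carrier M" "y \<in> carrier M"
      then obtain x' y' where "x' \<in> carrier L" "x = f x'" "y' \<in> carrier L" "y = f y'" using surj by metis
      then show "bracket M x y \<in> carrier M"
        using D(1) by (simp flip: f(3))
    next
      fix x y z assume "x \<in> carrier M" "y \<in> carrier M" "z \<in> carrier M"
      then obtain x' y' z' where *: "x' \<in> carrier L" "x = f x'" "y' \<in> carrier L" "y = f y'" "z' \<in> carrier L" "z = f z'"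
        using surj by metis
      show "bracket M (x \<oplus>\<^bsub>M\<^esub> y) z = bracket M x z \<oplus>\<^bsub>M\<^esub> bracket M y z"
        using * by (simp flip: f(3) D(2) add: L.bracket_add_left)
      show "bracket M x (y \<oplus>\<^bsub>M\<^esub> z) = bracket M x y \<oplus>\<^bsub>M\<^esub> bracket M x z"
        using * by (simp flip: f(3) D(2) add: L.bracket_add_right)
    next
      fix c x y assume "x \<in> carrier M" "y \<in> carrier M"
      then obtain x' y' where *: "x' \<in> carrier L" "x = f x'" "y' \<in> carrier L" "y = f y'" using surj by metis
      show "bracket M (c \<odot>\<^bsub>M\<^esub> x) y = c \<odot>\<^bsub>M\<^esub> bracket M x y"
        using * by (simp flip: f(3) D(3) add: L.bracket_smult_left)
      show "bracket M x (c \<odot>\<^bsub>M\<^esub> y) = c \<odot>\<^bsub>M\<^esub> bracket M x y"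
        using * by (simp flip: f(3) D(3) add: L.bracket_smult_right)
    qed
  next
    fix x assume "x \<in> carrier M"
    then obtain x' where "x' \<in> carrier L" "x = f x'" using surj by metis
    then show "bracket M x x = \<zero>\<^bsub>M\<^esub>" using zero by (simp flip: f(3) add: L.bracket_alternating)
  next
    fix x y z assume "x \<in> carrier M" "y \<in> carrier M" "z \<in> carrier M"
    then obtain x' y' z' where *: "x' \<in> carrier L" "x = f x'" "y' \<in> carrier L" "y = f y'" "z' \<in> carrier L" "z = f z'"
      using surj by metis
    then show "bracket M x (bracket M y z) \<oplus>\<^bsub>M\<^esub> bracket M y (bracket M z x) \<oplus>\<^bsub>M\<^esub> bracket M z (bracket M x y) = \<zero>\<^bsub>M\<^esub>"
      using zero L.jacobi[of x' y' z'] by (simp flip: f(3) D(2))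
  qed
qed

lemma lie_iso_inv:
  assumes "lie_algebra L" "f \<in> lie_iso L M"
  shows "inv_into (carrier L) f \<in> lie_iso M L"
proof -
  interpret L: lie_algebra L using assms(1) .
  note f = lie_isoD[OF assms(2)]
  have inv: "inv_into (carrier L) f (f x) = x" if "x \<in> carrier L" for x
    using f(2) that by (simp add: bij_betw_def)
  have "inv_into (carrier L) f (bracket M x y) = bracket L (inv_into (carrier L) f x) (inv_into (carrier L) f y)"
    if xy: "x \<in> carrier M" "y \<in> carrier M" for x y
  proof -
    obtain x' y' where "x' \<in> carrier L" "x = f x'" "y' \<in> carrier L" "y = f y'"
      using f(2) xy unfolding bij_betw_def by blast
    then show ?thesis by (simp flip: f(3) add: inv)
  qed
  then show ?thesis
    using linear_maps_inv[OF L.vectorspace_axioms f(1,2)] bij_betw_inv_into[OF f(2)]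
    by (auto simp: lie_iso_def)
qed

lemma lie_iso_compose:
  assumes "f \<in> lie_iso L M" "g \<in> lie_iso M N"
  shows "(\<lambda>x. g (f x)) \<in> lie_iso L N"
proof -
  note f = lie_isoD[OF assms(1)] and g = lie_isoD[OF assms(2)]
  have "bij_betw (\<lambda>x. g (f x)) (carrier L) (carrier N)"
    using bij_betw_trans[OF f(2) g(2)] by (simp add: comp_def)
  then show ?thesis
    using linear_maps_compose[OF f(1) g(1)] f(3) g(3) linear_mapsD(1)[OF f(1)] by (auto simp: lie_iso_def)
qed

lemma lie_iso_id: "(\<lambda>x. x) \<in> lie_iso L L"
  by (auto simp: lie_iso_def intro!: linear_mapsI bij_betw_byWitness[where f'="\<lambda>x. x"])

section \<open>The lower central series\<close>

context lie_algebra
begin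

lemma lower_central_subspace: "subspace class_ring (lower_central L i) L"
proof (induction i)
  case (Suc i)
  then show ?case
    using span_is_subspace[of "{bracket L x y |x y. x \<in> carrier L \<and> y \<in> lower_central L i}"] subspaceD(1)
    by (fastforce simp: lower_central.simps(2))
qed (simp add: subspace_carrier)

lemmas lower_central_subset = subspaceD(1)[OF lower_central_subspace]

lemma bracket_in_lower_central:
  assumes "x \<in> carrier L" "y \<in> lower_central L i"
  shows "bracket L x y \<in> lower_central L (Suc i)"
proof -
  have "{bracket L x y |x y. x \<in> carrier L \<and> y \<in> lower_central L i} \<subseteq> carrier L"
    using lower_central_subset by blast
  from in_own_span[OF this] show ?thesis using assms by (auto simp: lower_central.simps(2))
qed

lemma lower_central_Suc_le:
  assumes "subspace class_ring W L" "\<And>x y. x \<in> carrier L \<Longrightarrow> y \<in> lower_central L i \<Longrightarrow> bracket L x y \<in> W"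
  shows "lower_central L (Suc i) \<subseteq> W"
proof -
  have "{bracket L x y |x y. x \<in> carrier L \<and> y \<in> lower_central L i} \<subseteq> W"
    using assms(2) by blast
  from span_is_subset[OF this] show ?thesis using assms(1) by (simp add: lower_central.simps(2))
qed

lemma lower_central_Suc_subset: "lower_central L (Suc i) \<subseteq> lower_central L i"
proof (induction i)
  case 0 show ?case using lower_central_subset unfolding lower_central.simps(1) .
next
  case (Suc i)
  show ?case
    by (rule lower_central_Suc_le[OF lower_central_subspace])
      (use Suc bracket_in_lower_central in blast)
qed

lemma lower_central_antimono: "i \<le> j \<Longrightarrow> lower_central L j \<subseteq> lower_central L i"
  by (rule lift_Suc_antimono_le[of "lower_central L"]) (use lower_central_Suc_subset in auto)

text \<open>The extra \<open>Suc\<close> is due to the numbering from C^0 = L. By Jacobi [[x,y],z] =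
  [x,[y,z]] - [y,[x,z]]; for y in C^i the induction hypothesis is needed both at z in C^j and at
  [x,z] in C^(j+1), which is why j is generalised.\<close>

lemma bracket_lower_central:
  assumes "x \<in> lower_central L i" "y \<in> lower_central L j"
  shows "bracket L x y \<in> lower_central L (Suc (i + j))"
  using assms
proof (induction i arbitrary: x y j)
  case 0
  then show ?case using bracket_in_lower_central by simp
next
  case (Suc i)
  \<comment> \<open>C^(i+1) is a span and not just a set of brackets, so the claim is read as
    inclusion in the subspace of all elements that satisfy it; only brackets then remain to be
    checked.\<close>
  let ?W = "{x \<in> carrier L. \<forall>j. \<forall>y\<in>lower_central L j. bracket L x y \<in> lower_central L (Suc (Suc i + j))}"
  note S = subspaceD[OF lower_central_subspace]
  have "lower_central L (Suc i) \<subseteq> ?W"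
  proof (rule lower_central_Suc_le)
    show "subspace class_ring ?W L"
    proof (rule subspaceI)
      have "bracket L \<zero> y \<in> lower_central L (Suc (Suc i + j))" if "y \<in> lower_central L j" for j y
        using that S(1)[of j] S(2)[of "Suc (Suc i + j)"] bracket_zero_left[of y]
        by auto
      then show "\<zero> \<in> ?W" by blast
      show "x \<oplus> y \<in> ?W" if "x \<in> ?W" "y \<in> ?W" for x y
      proof -
        have "bracket L (x \<oplus> y) z \<in> lower_central L (Suc (Suc i + j))" if "z \<in> lower_central L j" for j z
          using bracket_add_left[of x y z] S(1)[of j] S(3)[of _ "Suc (Suc i + j)"] that \<open>x \<in> ?W\<close> \<open>y \<in> ?W\<close>
          by auto
        then show ?thesis using that by auto
      qed
      show "c \<odot> x \<in> ?W" if "x \<in> ?W" for c x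
      proof -
        have "bracket L (c \<odot> x) z \<in> lower_central L (Suc (Suc i + j))" if "z \<in> lower_central L j" for j z
          using bracket_smult_left[of x z c] S(1)[of j] S(4)[of c _ "Suc (Suc i + j)"] that \<open>x \<in> ?W\<close>
          by auto
        then show ?thesis using that by auto
      qed
    qed blast
  next
    fix x y assume x: "x \<in> carrier L" and y: "y \<in> lower_central L i"
    then have yc: "y \<in> carrier L" using lower_central_subset by blast
    have "bracket L (bracket L x y) z \<in> lower_central L (Suc (Suc i + j))" if z: "z \<in> lower_central L j" for j z
    proof -
      have zc: "z \<in> carrier L" using z lower_central_subset by blast
      have "bracket L x (bracket L y z) \<in> lower_central L (Suc (Suc i + j))"
        using bracket_in_lower_central[OF x Suc.IH[OF y z]] by simp
      moreover have "bracket L y (bracket L x z) \<in> lower_central L (Suc (Suc i + j))"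
        using Suc.IH[OF y bracket_in_lower_central[OF x z]] by simp
      ultimately show ?thesis
        using bracket_bracket[OF x yc zc] subspace_minus[OF lower_central_subspace] by simp
    qed
    then show "bracket L x y \<in> ?W" using x yc by blast
  qed
  then show ?case using Suc.prems by blast
qed

end

lemma lower_central_lie_iso:
  assumes "lie_algebra L" "lie_algebra M" "f \<in> lie_iso L M"
  shows "f ` lower_central L i = lower_central M i"
proof -
  interpret L: lie_algebra L using assms(1) .
  interpret M: lie_algebra M using assms(2) .
  note f = lie_isoD[OF assms(3)]
  show ?thesis
  proof (induction i)
    case 0 then show ?case using f(2) by (simp add: bij_betw_def)
  next
    case (Suc i)
    let ?S = "{bracket L x y |x y. x \<in> carrier L \<and> y \<in> lower_central L i}"
    have S: "?S \<subseteq> carrier L" using L.lower_central_subset by blast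
    have fL: "f ` carrier L = carrier M" using f(2) by (simp add: bij_betw_def)
    have "f ` ?S = (\<lambda>(x, y). bracket M (f x) (f y)) ` (carrier L \<times> lower_central L i)"
    proof -
      have "?S = (\<lambda>(x, y). bracket L x y) ` (carrier L \<times> lower_central L i)" by auto
      then have "f ` ?S = (\<lambda>(x, y). f (bracket L x y)) ` (carrier L \<times> lower_central L i)"
        by (simp add: image_image case_prod_unfold)
      also have "\<dots> = (\<lambda>(x, y). bracket M (f x) (f y)) ` (carrier L \<times> lower_central L i)"
        by (rule image_cong) (use f(3) L.lower_central_subset in auto)
      finally show ?thesis .
    qed
    also have "\<dots> = {bracket M x y |x y. x \<in> carrier M \<and> y \<in> lower_central M i}"
      unfolding fL[symmetric] Suc[symmetric] by (auto simp: image_iff Bex_def)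
    finally show ?case
      using linear_maps_span[OF L.vectorspace_axioms M.vectorspace_axioms f(1) S] by (simp add: lower_central.simps(2))
  qed
qed

lemma lie_iso_dim:
  assumes "lie_algebra L" "lie_algebra M" "f \<in> lie_iso L M"
  shows "lie_dim L = lie_dim M"
proof -
  interpret L: lie_algebra L using assms(1) .
  interpret M: lie_algebra M using assms(2) .
  show ?thesis
    using linear_maps_dim_eq(1)[OF L.vectorspace_axioms M.vectorspace_axioms L.fin_dim] lie_isoD[OF assms(3)] by blast
qed

lemma filiform_lie_iso:
  assumes "lie_algebra L" "lie_algebra M" "f \<in> lie_iso L M" "filiform L"
  shows "filiform M"
proof -
  interpret L: lie_algebra L using assms(1) .
  interpret M: lie_algebra M using assms(2) .
  note f = lie_isoD[OF assms(3)]
  note LC = lower_central_lie_iso[OF assms(1-3), symmetric]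
  have f0: "f \<zero>\<^bsub>L\<^esub> = \<zero>\<^bsub>M\<^esub>"
    using linear_maps_zero[OF L.vectorspace_axioms M.vectorspace_axioms f(1)] .
  have "f ` A = {\<zero>\<^bsub>M\<^esub>} \<longleftrightarrow> A = {\<zero>\<^bsub>L\<^esub>}" if "A \<subseteq> carrier L" for A
  proof
    assume "f ` A = {\<zero>\<^bsub>M\<^esub>}"
    then have "f ` A = f ` {\<zero>\<^bsub>L\<^esub>}" using f0 by simp
    then show "A = {\<zero>\<^bsub>L\<^esub>}"
      using f(2) that inj_on_image_eq_iff[of f "carrier L" A "{\<zero>\<^bsub>L\<^esub>}"] by (simp add: bij_betw_def)
  qed (use f0 in simp)
  then show ?thesis
    using assms(2,4) L.lower_central_subset f0
    by (simp add: filiform_def LC lie_iso_dim[OF assms(1-3), symmetric])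
qed

section \<open>Linear algebra of alternating forms\<close>

context lie_algebra
begin

abbreviation rk :: "'a set \<Rightarrow> nat" where
  "rk W \<equiv> vectorspace.dim class_ring (vs W)"

lemmas rk_strict_mono = subspace_dim_strict_mono[OF fin_dim]
lemmas rk_mono = subspace_dim_mono[OF fin_dim]
lemmas rk_le_adjoin = dim_le_adjoin[OF fin_dim]

lemma subspace_scal: "subspace class_ring W L \<Longrightarrow> x \<in> W \<Longrightarrow> c \<odot> x \<in> W"
  using subspaceD(4) by simp

lemma scal_one [simp]: "x \<in> carrier L \<Longrightarrow> 1 \<odot> x = x"
  using smult_one[of x] by simp

lemma scal_zero [simp]: "x \<in> carrier L \<Longrightarrow> 0 \<odot> x = \<zero>"
  using smult_l_null[of x] by simp

lemma scal_inverse: "c \<noteq> 0 \<Longrightarrow> x \<in> carrier L \<Longrightarrow> (1 / c) \<odot> (c \<odot> x) = x"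
  using smult_assoc1[of "1 / c" c x] by simp

lemma rk_eqD:
  assumes "subspace class_ring W L" "subspace class_ring U L" "W \<subseteq> U" "rk U \<le> rk W"
  shows "W = U"
proof (rule ccontr)
  assume "W \<noteq> U"
  then have "rk W < rk U" using rk_strict_mono[OF assms(1,2)] assms(3) by blast
  then show False using assms(4) by simp
qed

lemma rk_pos:
  assumes "subspace class_ring W L" "0 < rk W"
  shows "\<exists>x\<in>W. x \<noteq> \<zero>"
proof (rule ccontr)
  assume "\<not> (\<exists>x\<in>W. x \<noteq> \<zero>)"
  then have "W = {\<zero>}" using subspaceD(2)[OF assms(1)] by blast
  then show False using assms(2) dim_zero_subspace by simp
qed

lemma mem_adjoin: "w \<in> W \<Longrightarrow> w \<oplus> c \<odot> x \<in> adjoin W x"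
  by (auto simp: adjoin_def)

lemma adjoinE:
  assumes "y \<in> adjoin W x"
  obtains w c where "w \<in> W" "y = w \<oplus> c \<odot> x"
  using assms by (auto simp: adjoin_def)

lemma adjoin_subset:
  assumes "subspace class_ring U L" "W \<subseteq> U" "x \<in> U"
  shows "adjoin W x \<subseteq> U"
  using assms subspaceD(3)[OF assms(1)] subspace_scal[OF assms(1)] by (auto elim!: adjoinE)

lemma functional_neg:
  assumes "f \<in> linear_maps L scalars" "x \<in> carrier L"
  shows "f (\<ominus> x) = - f x" "f \<zero> = 0"
proof -
  have "f (\<zero> \<oplus> \<zero>) = f \<zero> + f \<zero>" using linear_mapsD(2)[OF assms(1), of \<zero> \<zero>] by simp
  then show z: "f \<zero> = 0" by simp
  have "f (x \<oplus> \<ominus> x) = f x + f (\<ominus> x)" using linear_mapsD(2)[OF assms(1), of x "\<ominus> x"] assms(2) by simp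
  then have "f x + f (\<ominus> x) = 0" using z assms(2) by (simp add: M.r_neg)
  then show "f (\<ominus> x) = - f x" by (simp add: eq_neg_iff_add_eq_0 add.commute)
qed

lemma functional_minus:
  assumes "f \<in> linear_maps L scalars" "x \<in> carrier L" "y \<in> carrier L"
  shows "f (x \<ominus> y) = f x - f y"
  using assms functional_neg[OF assms(1)] linear_mapsD(2)[OF assms(1), of x "\<ominus> y"] by (simp add: a_minus_def)

lemma subspace_kernel:
  assumes "f \<in> linear_maps L scalars" "subspace class_ring U L"
  shows "subspace class_ring {x \<in> U. f x = 0} L"
proof (rule subspaceI)
  note D = subspaceD[OF assms(2)] linear_mapsD[OF assms(1)]
  show "{x \<in> U. f x = 0} \<subseteq> carrier L" using D by auto
  show "\<zero> \<in> {x \<in> U. f x = 0}" using D functional_neg(2)[OF assms(1), of \<zero>] by auto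
  show "x \<oplus> y \<in> {x \<in> U. f x = 0}" if "x \<in> {x \<in> U. f x = 0}" "y \<in> {x \<in> U. f x = 0}" for x y
  proof -
    have "x \<in> carrier L" "y \<in> carrier L" using that D(1) by auto
    then show ?thesis using that D(3) D(6)[of x y] by auto
  qed
  show "c \<odot> x \<in> {x \<in> U. f x = 0}" if "x \<in> {x \<in> U. f x = 0}" for c x
  proof -
    have "x \<in> carrier L" using that D(1) by auto
    then show ?thesis using that subspace_scal[OF assms(2)] D(7)[of x c] by auto
  qed
qed

lemma decompose_along:
  assumes "f \<in> linear_maps L scalars" "x \<in> carrier L" "f x \<noteq> 0" "y \<in> carrier L"
  defines "c \<equiv> f y / f x"
  shows "y = (y \<ominus> c \<odot> x) \<oplus> c \<odot> x" "f (y \<ominus> c \<odot> x) = 0"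
proof -
  have "c \<odot> x \<in> carrier L" using assms(2) by simp
  then show "y = (y \<ominus> c \<odot> x) \<oplus> c \<odot> x"
    using assms(4) by (simp add: a_minus_def M.a_assoc M.l_neg)
  show "f (y \<ominus> c \<odot> x) = 0"
    using functional_minus[OF assms(1,4), of "c \<odot> x"] linear_mapsD(3)[OF assms(1,2), of c] assms(2,3)
    by (simp add: c_def)
qed

text \<open>If f does not vanish on U, then any x in U with f x \<noteq> 0 together with the kernel
  generates U.\<close>

lemma rk_kernel:
  assumes f: "f \<in> linear_maps L scalars" and U: "subspace class_ring U L"
  shows "rk U \<le> Suc (rk {x \<in> U. f x = 0})"
proof (cases "\<exists>x\<in>U. f x \<noteq> 0")
  case True
  then obtain x where x: "x \<in> U" "f x \<noteq> 0" by blast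
  let ?K = "{x \<in> U. f x = 0}"
  have xc: "x \<in> carrier L" using x subspaceD(1)[OF U] by blast
  have "U \<subseteq> adjoin ?K x"
  proof
    fix y assume y: "y \<in> U"
    then have yc: "y \<in> carrier L" using subspaceD(1)[OF U] by blast
    note d = decompose_along[OF f xc x(2) yc]
    have "y \<ominus> (f y / f x) \<odot> x \<in> ?K"
      using d(2) subspace_minus[OF U y subspace_scal[OF U x(1)]] by blast
    then show "y \<in> adjoin ?K x" using d(1) mem_adjoin by metis
  qed
  then show ?thesis using rk_le_adjoin[OF subspace_kernel[OF f U] xc U] by simp
next
  case False
  then have "{x \<in> U. f x = 0} = U" by blast
  then show ?thesis by simp
qed

text \<open>Ranks are bounded by \<open>lie_dim L\<close>, so a subspace of greatest rank exists. It
  provides the hyperplane of \<open>separating_functional\<close> and the isotropic complement of a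
  Lagrangian subspace.\<close>

lemma ex_max_subspace:
  assumes "P W0" "\<And>W. P W \<Longrightarrow> subspace class_ring W L"
  obtains W where "P W" "\<And>U. P U \<Longrightarrow> rk U \<le> rk W"
proof -
  have "rk W < Suc (lie_dim L)" if "P W" for W
    using rk_mono[OF assms(2)[OF that] subspace_carrier] subspaceD(1)[OF assms(2)[OF that]] by simp
  then show thesis
    using that ex_has_greatest_nat[of P W0 rk "Suc (lie_dim L)"] assms(1) by blast
qed

lemma subspace_sum_mem:
  assumes "x \<in> W" "y \<in> U"
  shows "x \<oplus> y \<in> submodule_sum W U"
  using assms by (auto simp: submodule_sum_def)

lemma subspace_sumE:
  assumes "z \<in> submodule_sum W U"
  obtains x y where "x \<in> W" "y \<in> U" "z = x \<oplus> y"
  using assms by (auto simp: submodule_sum_def)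

lemma subspace_sum_sup:
  assumes W: "subspace class_ring W L" and U: "subspace class_ring U L"
  shows "W \<subseteq> submodule_sum W U" "U \<subseteq> submodule_sum W U" "subspace class_ring (submodule_sum W U) L"
proof -
  show "W \<subseteq> submodule_sum W U" using in_sum_vs[OF W U] .
  show "U \<subseteq> submodule_sum W U" using in_sum_vs[OF U W] vsum_comm[OF U W] by simp
  show "subspace class_ring (submodule_sum W U) L" using sum_is_subspace[OF W U] .
qed

lemma set_add_eq_submodule_sum: "W <+>\<^bsub>L\<^esub> U = submodule_sum W U"
  by (auto simp: set_add_def' submodule_sum_def)

text \<open>A subspace K of greatest rank among those avoiding u is a complement of the line through
  u; f is the coordinate along u in this decomposition.\<close>

lemma separating_functional:
  assumes "u \<in> carrier L" "u \<noteq> \<zero>"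
  obtains f where "f \<in> linear_maps L scalars" "f u = 1"
proof -
  obtain K where K: "subspace class_ring K L \<and> u \<notin> K"
    and max: "\<And>U. subspace class_ring U L \<and> u \<notin> U \<Longrightarrow> rk U \<le> rk K"
    using ex_max_subspace[of "\<lambda>K. subspace class_ring K L \<and> u \<notin> K" "{\<zero>}"] subspace_zero assms(2) by blast
  then have Ks: "subspace class_ring K L" and uK: "u \<notin> K" by auto
  note D = subspaceD[OF Ks]
  have uniq: "c = c'" if "k \<oplus> c \<odot> u = k' \<oplus> c' \<odot> u" "k \<in> K" "k' \<in> K" for k k' c c'
  proof (rule ccontr)
    assume "c \<noteq> c'"
    have kc: "k \<in> carrier L" "k' \<in> carrier L" using that D(1) by auto
    have "(c - c') \<odot> u = k' \<ominus> k"
    proof -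
      have "c \<odot> u = (k' \<oplus> c' \<odot> u) \<ominus> k"
        using kc assms(1) unfolding that(1)[symmetric] by (simp add: a_minus_def M.a_ac M.r_neg1 M.r_neg2)
      then have "c \<odot> u = (k' \<ominus> k) \<oplus> c' \<odot> u"
        using kc assms(1) by (simp add: a_minus_def M.a_ac)
      moreover have "c \<odot> u = (c - c') \<odot> u \<oplus> c' \<odot> u"
        using smult_l_distr[of "c - c'" c' u] assms(1) by simp
      ultimately show ?thesis using kc assms(1) by (metis M.add.right_cancel M.minus_closed scal_closed)
    qed
    then have "(c - c') \<odot> u \<in> K" using subspace_minus[OF Ks] that by simp
    then have "(1 / (c - c')) \<odot> ((c - c') \<odot> u) \<in> K" by (rule subspace_scal[OF Ks])
    moreover have "(1 / (c - c')) \<odot> ((c - c') \<odot> u) = u"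
      using scal_inverse \<open>c \<noteq> c'\<close> assms(1) by simp
    ultimately show False using uK by simp
  qed
  \<comment> \<open>For y outside K, maximality puts u into \<open>adjoin K y\<close>. The
    coefficient of y there is nonzero because u is not in K, so the equation can be solved for
    y.\<close>
  have dec: "\<exists>k\<in>K. \<exists>c. y = k \<oplus> c \<odot> u" if y: "y \<in> carrier L" for y
  proof (cases "y \<in> K")
    case True
    then have "y = y \<oplus> 0 \<odot> u" using y assms(1) smult_l_null by auto
    then show ?thesis using True by metis
  next
    case False
    note A = subspace_adjoin[OF Ks y]
    have "rk K < rk (adjoin K y)" using rk_strict_mono[OF Ks A(1)] A(2,3) False by blast
    then have "u \<in> adjoin K y" using max[of "adjoin K y"] A(1) by fastforce
    then obtain k c where kc: "k \<in> K" "u = k \<oplus> c \<odot> y" by (rule adjoinE)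
    have "k \<in> carrier L" using kc D(1) by blast
    have "c \<noteq> 0" using kc uK y smult_l_null[of y] D(1) by auto
    have "(1 / c) \<odot> u = (1 / c) \<odot> k \<oplus> (1 / c) \<odot> (c \<odot> y)"
      using kc(2) smult_r_distr[of "1 / c" k "c \<odot> y"] \<open>k \<in> carrier L\<close> y by simp
    also have "(1 / c) \<odot> (c \<odot> y) = y"
      using scal_inverse \<open>c \<noteq> 0\<close> y by simp
    finally have "y = \<ominus> ((1 / c) \<odot> k) \<oplus> (1 / c) \<odot> u"
      using \<open>k \<in> carrier L\<close> y by (simp add: M.r_neg1)
    then show ?thesis using subspace_neg[OF Ks subspace_scal[OF Ks kc(1)]] by blast
  qed
  define f where "f y = (THE c. \<exists>k\<in>K. y = k \<oplus> c \<odot> u)" for y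
  have fI: "f (k \<oplus> c \<odot> u) = c" if "k \<in> K" for k c
    unfolding f_def by (rule the_equality) (use that uniq in blast)+
  have "f \<in> linear_maps L scalars"
  proof (rule linear_mapsI)
    fix x y assume "x \<in> carrier L" "y \<in> carrier L"
    then obtain k c k' c' where *: "k \<in> K" "x = k \<oplus> c \<odot> u" "k' \<in> K" "y = k' \<oplus> c' \<odot> u"
      using dec by metis
    have "k \<in> carrier L" "k' \<in> carrier L" using * D(1) by auto
    then have "x \<oplus> y = (k \<oplus> k') \<oplus> (c + c') \<odot> u"
      using * assms(1) smult_l_distr[of c c' u] by (simp add: M.a_ac)
    then show "f (x \<oplus> y) = f x \<oplus>\<^bsub>scalars\<^esub> f y" using * fI D(3) by simp
  next
    fix d x assume "x \<in> carrier L"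
    then obtain k c where *: "k \<in> K" "x = k \<oplus> c \<odot> u"
      using dec by metis
    have "k \<in> carrier L" using * D(1) by auto
    then have "d \<odot> x = d \<odot> k \<oplus> (d * c) \<odot> u"
      using * assms(1) smult_r_distr[of d k "c \<odot> u"] smult_assoc1[of d c u] by simp
    then show "f (d \<odot> x) = d \<odot>\<^bsub>scalars\<^esub> f x" using * fI subspace_scal[OF Ks] by simp
  qed simp
  moreover have "f u = 1" using fI[OF D(2), of 1] assms(1) by simp
  ultimately show thesis using that by blast
qed

end

section \<open>Orthogonal spaces and Lagrangian complements\<close>

context symplectic_lie_algebra
begin

lemmas form_add_left = bilinear_mapD(2)[OF form_bilinear, simplified scalars_simps]
lemmas form_scal_left = bilinear_mapD(3)[OF form_bilinear, simplified scalars_simps]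
lemmas form_add_right = bilinear_mapD(4)[OF form_bilinear, simplified scalars_simps]
lemmas form_scal_right = bilinear_mapD(5)[OF form_bilinear, simplified scalars_simps]

lemma form_linear_right: "x \<in> carrier L \<Longrightarrow> \<omega> x \<in> linear_maps L scalars"
  and form_linear_left: "x \<in> carrier L \<Longrightarrow> (\<lambda>y. \<omega> y x) \<in> linear_maps L scalars"
  using form_bilinear by (auto simp: bilinear_map_def)

lemma form_zero [simp]: "x \<in> carrier L \<Longrightarrow> \<omega> x \<zero> = 0" "x \<in> carrier L \<Longrightarrow> \<omega> \<zero> x = 0"
  using functional_neg(2)[OF form_linear_right] functional_neg(2)[OF form_linear_left] by auto

lemma form_minus_right: "x \<in> carrier L \<Longrightarrow> y \<in> carrier L \<Longrightarrow> z \<in> carrier L \<Longrightarrow> \<omega> x (y \<ominus> z) = \<omega> x y - \<omega> x z"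
  using functional_minus[OF form_linear_right] by simp

lemma form_minus_left: "x \<in> carrier L \<Longrightarrow> y \<in> carrier L \<Longrightarrow> z \<in> carrier L \<Longrightarrow> \<omega> (y \<ominus> z) x = \<omega> y x - \<omega> z x"
  using functional_minus[OF form_linear_left] by simp

lemma form_neg_left: "x \<in> carrier L \<Longrightarrow> y \<in> carrier L \<Longrightarrow> \<omega> (\<ominus> y) x = - \<omega> y x"
  using functional_neg(1)[OF form_linear_left] by simp

lemma form_antisym:
  assumes "x \<in> carrier L" "y \<in> carrier L"
  shows "\<omega> x y = - \<omega> y x"
proof -
  have "\<omega> (x \<oplus> y) (x \<oplus> y) = \<omega> x x + \<omega> y x + (\<omega> x y + \<omega> y y)"
    using assms by (simp only: form_add_left form_add_right M.a_closed)
  then show ?thesis using assms by (simp add: form_alternating eq_neg_iff_add_eq_0 add.commute)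
qed

abbreviation orth :: "'a set \<Rightarrow> 'a set" where
  "orth \<equiv> orthogonal_space L \<omega>"

lemma orthI: "x \<in> carrier L \<Longrightarrow> (\<And>y. y \<in> W \<Longrightarrow> \<omega> x y = 0) \<Longrightarrow> x \<in> orth W"
  and orthD: "x \<in> orth W \<Longrightarrow> y \<in> W \<Longrightarrow> \<omega> x y = 0" "x \<in> orth W \<Longrightarrow> x \<in> carrier L"
  by (auto simp: orthogonal_space_def)

lemma subspace_orth:
  assumes "W \<subseteq> carrier L"
  shows "subspace class_ring (orth W) L"
proof (rule subspaceI)
  show "\<zero> \<in> orth W" using assms by (auto intro!: orthI)
  show "x \<oplus> y \<in> orth W" if "x \<in> orth W" "y \<in> orth W" for x y
    using that assms by (auto simp: orthogonal_space_def form_add_left subset_iff)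
  show "c \<odot> x \<in> orth W" if "x \<in> orth W" for c x
    using that assms by (auto simp: orthogonal_space_def form_scal_left subset_iff)
qed (auto simp: orthogonal_space_def)

lemma orth_antimono: "W \<subseteq> U \<Longrightarrow> orth U \<subseteq> orth W"
  by (auto simp: orthogonal_space_def)

lemma orth_carrier: "orth (carrier L) = {\<zero>}"
  using form_nondegenerate by (auto simp: orthogonal_space_def)

lemma orth_zero: "orth {\<zero>} = carrier L"
  by (auto simp: orthogonal_space_def)

lemma orth_adjoin:
  assumes "subspace class_ring W L" "x \<in> carrier L"
  shows "orth (adjoin W x) = {y \<in> orth W. \<omega> y x = 0}"
proof -
  note A = subspace_adjoin[OF assms]
  have "y \<in> orth (adjoin W x)" if y: "y \<in> orth W" "\<omega> y x = 0" for y
  proof (rule orthI)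
    show yc: "y \<in> carrier L" using orthD(2)[OF y(1)] .
    fix z assume "z \<in> adjoin W x"
    then obtain w c where *: "w \<in> W" "z = w \<oplus> c \<odot> x" by (rule adjoinE)
    then have "w \<in> carrier L" using subspaceD(1)[OF assms(1)] by blast
    then show "\<omega> y z = 0" using * yc y assms(2) orthD(1)[OF y(1) *(1)]
      by (simp add: form_add_right form_scal_right)
  qed
  then show ?thesis using orthD(1) orth_antimono[OF A(2)] A(3) by blast
qed

text \<open>Enlarging W by x imposes a single further linear equation on
  \<open>orth W\<close>.\<close>

lemma rk_orth_adjoin:
  assumes W: "subspace class_ring W L" and x: "x \<in> carrier L"
  shows "rk (orth W) \<le> Suc (rk (orth (adjoin W x)))"
  using rk_kernel[OF form_linear_left[OF x] subspace_orth[OF subspaceD(1)[OF W]]] orth_adjoin[OF assms]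
  by simp

text \<open>Adjoining a new vector raises \<open>rk W\<close> by at least one and lowers
  \<open>rk (orth W)\<close> by at most one, so the sum can only grow on the way from W to
  U.\<close>

lemma rk_orth_add_mono:
  assumes "subspace class_ring W L" "subspace class_ring U L" "W \<subseteq> U"
  shows "rk (orth W) + rk W \<le> rk (orth U) + rk U"
  using assms(1,3)
proof (induction "rk U - rk W" arbitrary: W rule: less_induct)
  case less
  show ?case
  proof (cases "W = U")
    case False
    then obtain x where x: "x \<in> U" "x \<notin> W" using less.prems by blast
    have xc: "x \<in> carrier L" using x subspaceD(1)[OF assms(2)] by blast
    note A = subspace_adjoin[OF less.prems(1) xc]
    have AU: "adjoin W x \<subseteq> U" using adjoin_subset[OF assms(2)] less.prems x by blast
    have lt: "rk W < rk (adjoin W x)" using rk_strict_mono[OF less.prems(1) A(1)] A x by blast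
    moreover have "rk (adjoin W x) \<le> rk U" using rk_mono[OF A(1) assms(2) AU] .
    ultimately have "rk U - rk (adjoin W x) < rk U - rk W" by linarith
    from less.hyps[OF this A(1) AU]
    have "rk (orth (adjoin W x)) + rk (adjoin W x) \<le> rk (orth U) + rk U" .
    then show ?thesis using lt rk_orth_adjoin[OF less.prems(1) xc] by linarith
  qed simp
qed

text \<open>The monotone sum takes the value \<open>lie_dim L\<close> at both ends, at the zero
  subspace and, by non-degeneracy, at the whole space; hence it is constant in between.\<close>

lemma rk_orth:
  assumes "subspace class_ring W L"
  shows "rk (orth W) + rk W = lie_dim L"
proof (rule antisym)
  show "rk (orth W) + rk W \<le> lie_dim L"
    using rk_orth_add_mono[OF assms subspace_carrier subspaceD(1)[OF assms]]
    by (simp add: orth_carrier dim_zero_subspace)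
  show "lie_dim L \<le> rk (orth W) + rk W"
    using rk_orth_add_mono[OF subspace_zero assms] subspaceD(2)[OF assms]
    by (simp add: orth_zero dim_zero_subspace)
qed

lemma orth_orth:
  assumes "subspace class_ring W L"
  shows "orth (orth W) = W"
proof -
  have o: "subspace class_ring (orth W) L" using subspace_orth subspaceD(1)[OF assms] by blast
  have oo: "subspace class_ring (orth (orth W)) L" using subspace_orth subspaceD(1)[OF o] by blast
  have "W \<subseteq> orth (orth W)"
  proof
    fix x assume x: "x \<in> W"
    then have xc: "x \<in> carrier L" using subspaceD(1)[OF assms] by blast
    show "x \<in> orth (orth W)"
    proof (rule orthI[OF xc])
      fix y assume y: "y \<in> orth W"
      show "\<omega> x y = 0" using form_antisym[OF xc orthD(2)[OF y]] orthD(1)[OF y x] by simp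
    qed
  qed
  moreover have "rk (orth (orth W)) = rk W" using rk_orth[OF assms] rk_orth[OF o] by simp
  ultimately show ?thesis using rk_eqD[OF assms oo] by simp
qed

lemma rk_isotropic:
  assumes "subspace class_ring W L" "W \<subseteq> orth W"
  shows "2 * rk W \<le> lie_dim L"
  using rk_orth[OF assms(1)] rk_mono[OF assms(1) subspace_orth assms(2)] subspaceD(1)[OF assms(1)] by simp

lemma rk_lagrangian:
  assumes "subspace class_ring W L" "orth W = W"
  shows "2 * rk W = lie_dim L"
  using rk_orth[OF assms(1)] assms(2) by simp

lemma isotropic_adjoin:
  assumes W: "subspace class_ring W L" and iso: "W \<subseteq> orth W" and x: "x \<in> orth W"
  shows "adjoin W x \<subseteq> orth (adjoin W x)"
proof -
  have xc: "x \<in> carrier L" using orthD x by blast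
  have "W \<subseteq> {y \<in> orth W. \<omega> y x = 0}"
  proof
    fix y assume y: "y \<in> W"
    then have "y \<in> carrier L" using subspaceD(1)[OF W] by blast
    then show "y \<in> {y \<in> orth W. \<omega> y x = 0}"
      using form_antisym[OF _ xc, of y] orthD(1)[OF x y] iso y by auto
  qed
  moreover have "x \<in> {y \<in> orth W. \<omega> y x = 0}" using x xc form_alternating by simp
  ultimately show ?thesis
    using adjoin_subset[OF subspace_orth[OF subspaceD(1)[OF subspace_adjoin(1)[OF W xc]]]]
    by (simp add: orth_adjoin[OF W xc])
qed

text \<open>A vector of \<open>orth W\<close> outside W could be adjoined without losing isotropy,
  and twice the new rank would exceed the dimension. The bound allows one dimension more than 2 * rk
  W, so that it also applies when the parity of the dimension is still open.\<close>

lemma isotropic_imp_lagrangian: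
  assumes W: "subspace class_ring W L" and iso: "W \<subseteq> orth W" and dim: "lie_dim L \<le> Suc (2 * rk W)"
  shows "orth W = W"
proof (rule ccontr)
  assume "orth W \<noteq> W"
  then obtain x where x: "x \<in> orth W" "x \<notin> W" using iso by blast
  have xc: "x \<in> carrier L" using orthD x by blast
  note A = subspace_adjoin[OF W xc]
  have "rk W < rk (adjoin W x)" using rk_strict_mono[OF W A(1)] A x by blast
  then show False using rk_isotropic[OF A(1) isotropic_adjoin[OF W iso x(1)]] dim by linarith
qed

text \<open>The kernel of f \<noteq> 0 is a proper subspace, so it has a nonzero orthogonal vector
  z. Then \<omega>(z, .) vanishes on the kernel and is a multiple of f, a nonzero one by
  non-degeneracy; rescaling z finishes.\<close>

lemma functional_representation:
  assumes f: "f \<in> linear_maps L scalars"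
  obtains z where "z \<in> carrier L" "\<And>y. y \<in> carrier L \<Longrightarrow> f y = \<omega> z y"
proof (cases "\<exists>x\<in>carrier L. f x \<noteq> 0")
  case True
  then obtain x where x: "x \<in> carrier L" "f x \<noteq> 0" by blast
  let ?K = "{x \<in> carrier L. f x = 0}"
  have K: "subspace class_ring ?K L" using subspace_kernel[OF f subspace_carrier] .
  have "rk ?K < lie_dim L" using rk_strict_mono[OF K subspace_carrier] x by auto
  then have "0 < rk (orth ?K)" using rk_orth[OF K] by linarith
  then obtain z where z: "z \<in> orth ?K" "z \<noteq> \<zero>"
    using rk_pos[OF subspace_orth[OF subspaceD(1)[OF K]]] by blast
  have zc: "z \<in> carrier L" using orthD z by blast
  have eq: "\<omega> z y = f y / f x * \<omega> z x" if y: "y \<in> carrier L" for y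
  proof -
    note d = decompose_along[OF f x y]
    have "y \<ominus> (f y / f x) \<odot> x \<in> ?K" using d(2) x y by simp
    then have "\<omega> z (y \<ominus> (f y / f x) \<odot> x) = 0" using orthD(1)[OF z(1)] by blast
    then show ?thesis using x y zc by (simp add: form_minus_right form_scal_right)
  qed
  have "\<omega> z x \<noteq> 0" using form_nondegenerate[OF zc] eq z(2) by fastforce
  then have "f y = \<omega> ((f x / \<omega> z x) \<odot> z) y" if "y \<in> carrier L" for y
    using eq[OF that] zc that x by (simp add: form_scal_left)
  then show thesis using that[of "(f x / \<omega> z x) \<odot> z"] zc by blast
next
  case False
  then show thesis using that[of \<zero>] by auto
qed

text \<open>An isotropic N of greatest rank with I \<inter> N = 0 already satisfies I + N = L, and
  an isotropic complement of a Lagrangian subspace is itself Lagrangian.\<close>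

lemma lagrangian_complement_exists:
  assumes "lagrangian_subspace L \<omega> I"
  obtains N where "lagrangian_complement L \<omega> I N"
proof -
  have I: "subspace class_ring I L" "orth I = I" using assms by (auto simp: lagrangian_subspace_def)
  obtain N where N: "subspace class_ring N L" "N \<subseteq> orth N" "I \<inter> N = {\<zero>}"
    and max: "\<And>U. subspace class_ring U L \<Longrightarrow> U \<subseteq> orth U \<Longrightarrow> I \<inter> U = {\<zero>} \<Longrightarrow> rk U \<le> rk N"
  proof (rule ex_max_subspace[of "\<lambda>N. subspace class_ring N L \<and> N \<subseteq> orth N \<and> I \<inter> N = {\<zero>}" "{\<zero>}"])
    show "subspace class_ring {\<zero>} L \<and> {\<zero>} \<subseteq> orth {\<zero>} \<and> I \<inter> {\<zero>} = {\<zero>}"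
      using subspace_zero orth_zero subspaceD(2)[OF I(1)] by simp
  qed auto
  let ?S = "submodule_sum I N"
  note S = subspace_sum_sup[OF I(1) N(1)]
  have Sc: "?S = carrier L"
  proof (rule ccontr)
    assume "?S \<noteq> carrier L"
    then have "rk ?S < lie_dim L" using rk_strict_mono[OF S(3) subspace_carrier] subspaceD(1)[OF S(3)] by auto
    then have "0 < rk (orth ?S)" using rk_orth[OF S(3)] by linarith
    then obtain z where z: "z \<in> orth ?S" "z \<noteq> \<zero>"
      using rk_pos[OF subspace_orth[OF subspaceD(1)[OF S(3)]]] by blast
    have zc: "z \<in> carrier L" using orthD z by blast
    have zI: "z \<in> I" using orth_antimono[OF S(1)] z I(2) by blast
    \<comment> \<open>z is a nonzero element of I, hence not in N, which is its own double
      orthogonal. The witness y lies in \<open>orth N\<close>, so it can be adjoined isotropically;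
      as z annihilates I + N but not y, y is outside I + N, and the enlarged space still meets I
      trivially. This contradicts the choice of N.\<close>
    then have "z \<notin> orth (orth N)" using orth_orth[OF N(1)] N(3) z(2) by blast
    then obtain y where y: "y \<in> orth N" "\<omega> z y \<noteq> 0" using orthI[OF zc] by blast
    have yS: "y \<notin> ?S" using orthD(1)[OF z(1)] y(2) by blast
    have yc: "y \<in> carrier L" using orthD y by blast
    note A = subspace_adjoin[OF N(1) yc]
    have "I \<inter> adjoin N y \<subseteq> {\<zero>}"
    proof
      fix i assume "i \<in> I \<inter> adjoin N y"
      then obtain m c where i: "i \<in> I" "m \<in> N" "i = m \<oplus> c \<odot> y" by (auto elim: adjoinE)
      have mc: "m \<in> carrier L" using i subspaceD(1)[OF N(1)] by blast
      show "i \<in> {\<zero>}"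
      proof (cases "c = 0")
        case True
        then have "i = m" using i mc yc smult_l_null by simp
        then show ?thesis using i N(3) by blast
      next
        case False
        have "c \<odot> y = i \<ominus> m" using i(3) mc yc by (simp add: a_minus_def M.a_ac M.r_neg1 M.r_neg2)
        moreover have "i \<in> ?S" "m \<in> ?S" using i S by auto
        ultimately have "c \<odot> y \<in> ?S" using subspace_minus[OF S(3)] by simp
        then have "(1 / c) \<odot> (c \<odot> y) \<in> ?S" using subspace_scal[OF S(3)] by blast
        moreover have "(1 / c) \<odot> (c \<odot> y) = y"
          using scal_inverse False yc by simp
        ultimately show ?thesis using yS by simp
      qed
    qed
    then have "rk (adjoin N y) \<le> rk N"
      using max[OF A(1) isotropic_adjoin[OF N(1,2) y(1)]] subspaceD(2)[OF I(1)] subspaceD(2)[OF A(1)] by blast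
    moreover have "rk N < rk (adjoin N y)" using rk_strict_mono[OF N(1) A(1)] A(2,3) yS S(2) by blast
    ultimately show False by simp
  qed
  \<comment> \<open>The I-component of a vector of \<open>orth N\<close> is orthogonal to I and to
    N, hence to everything, so it vanishes.\<close>
  have "orth N \<subseteq> N"
  proof
    fix x assume x: "x \<in> orth N"
    then have xc: "x \<in> carrier L" using orthD by blast
    then have "x \<in> ?S" using Sc by simp
    then obtain i m where im: "i \<in> I" "m \<in> N" "x = i \<oplus> m" by (rule subspace_sumE)
    have c: "i \<in> carrier L" "m \<in> carrier L"
      using im subspaceD(1)[OF N(1)] subspaceD(1)[OF I(1)] by auto
    have "i = x \<ominus> m" unfolding im(3) using c by (simp add: a_minus_def M.a_assoc M.r_neg)
    then have "i \<in> orth N" using subspace_minus[OF subspace_orth[OF subspaceD(1)[OF N(1)]] x] im N(2) by blast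
    have "\<omega> i y = 0" if "y \<in> carrier L" for y
    proof -
      have "y \<in> ?S" using that Sc by simp
      then obtain i' m' where y: "i' \<in> I" "m' \<in> N" "y = i' \<oplus> m'" by (rule subspace_sumE)
      have "i' \<in> carrier L" "m' \<in> carrier L"
        using y subspaceD(1)[OF N(1)] subspaceD(1)[OF I(1)] by auto
      moreover have "\<omega> i i' = 0" using im(1) y(1) I(2) orthD(1) by blast
      moreover have "\<omega> i m' = 0" using \<open>i \<in> orth N\<close> y(2) orthD(1) by blast
      ultimately show ?thesis using y(3) c by (simp add: form_add_right)
    qed
    then have "i = \<zero>" using form_nondegenerate c by blast
    then show "x \<in> N" using im(2) c unfolding im(3) by simp
  qed
  then have "lagrangian_complement L \<omega> I N"
    using N Sc by (auto simp: lagrangian_complement_def lagrangian_subspace_def set_add_eq_submodule_sum)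
  then show thesis using that by blast
qed

end

section \<open>Lagrangian ideals of filiform symplectic Lie algebras\<close>

context lie_algebra
begin

lemma lie_ideal_zero: "lie_ideal L {\<zero>}"
  using subspace_zero by (simp add: lie_ideal_def)

lemma lie_ideal_lower_central: "lie_ideal L (lower_central L i)"
  using lower_central_subspace bracket_in_lower_central lower_central_Suc_subset
  by (fastforce simp: lie_ideal_def)

text \<open>The preimage in L of the lower central series of L/I. Counting inside L keeps quotients
  out of the argument, and I = {\<zero>} gives back the series of L itself.\<close>

abbreviation lower_central_sum :: "'a set \<Rightarrow> nat \<Rightarrow> 'a set" where
  "lower_central_sum I i \<equiv> submodule_sum (lower_central L i) I"

lemma lower_central_sum_zero: "lower_central_sum {\<zero>} i = lower_central L i"
proof -
  have "lower_central_sum {\<zero>} i = (\<lambda>x. x \<oplus> \<zero>) ` lower_central L i"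
    by (auto simp: submodule_sum_def image_iff)
  also have "\<dots> = lower_central L i"
    using lower_central_subset by (force simp: image_iff)
  finally show ?thesis .
qed

context
  fixes I
  assumes I: "lie_ideal L I"
begin

lemma ideal_subspace: "subspace class_ring I L"
  and ideal_bracket: "x \<in> carrier L \<Longrightarrow> y \<in> I \<Longrightarrow> bracket L x y \<in> I"
  using I by (auto simp: lie_ideal_def)

lemmas lower_central_sum_sup = subspace_sum_sup[OF lower_central_subspace ideal_subspace]

lemma lower_central_sum_le:
  assumes "subspace class_ring W L" "lower_central L i \<subseteq> W" "I \<subseteq> W"
  shows "lower_central_sum I i \<subseteq> W"
  using vsum_is_minimal[OF lower_central_subspace ideal_subspace assms(1)] assms(2,3) by blast

lemma bracket_lower_central_sum:
  assumes "x \<in> carrier L" "y \<in> lower_central_sum I i"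
  shows "bracket L x y \<in> lower_central_sum I (Suc i)"
proof -
  obtain c a where *: "c \<in> lower_central L i" "a \<in> I" "y = c \<oplus> a" using assms(2) by (rule subspace_sumE)
  have "c \<in> carrier L" "a \<in> carrier L" using * lower_central_subset subspaceD(1)[OF ideal_subspace] by auto
  then have "bracket L x y = bracket L x c \<oplus> bracket L x a" using * assms(1) by (simp add: bracket_add_right)
  then show ?thesis
    using subspace_sum_mem[OF bracket_in_lower_central[OF assms(1) *(1)] ideal_bracket[OF assms(1) *(2)]] by simp
qed

text \<open>If C^i + I does not shrink at the next step, it never shrinks again: bracketing the
  inclusion with L repeats it one index later. Since C^m lies in I, the constant value is I.\<close>

lemma lower_central_stable:
  assumes m: "lower_central L m \<subseteq> I" and i: "lower_central L i \<subseteq> lower_central_sum I (Suc i)"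
  shows "lower_central L i \<subseteq> I"
proof -
  have "lower_central L i \<subseteq> lower_central_sum I j" if "Suc i \<le> j" for j
    using that
  proof (induction j rule: dec_induct)
    case base show ?case using i .
  next
    case (step j)
    have "lower_central L (Suc i) \<subseteq> lower_central_sum I (Suc j)"
      by (rule lower_central_Suc_le[OF lower_central_sum_sup(3)])
        (use step.IH bracket_lower_central_sum in blast)
    then have "lower_central_sum I (Suc i) \<subseteq> lower_central_sum I (Suc j)"
      using lower_central_sum_le[OF lower_central_sum_sup(3)] lower_central_sum_sup(2) by blast
    then show ?case using i by blast
  qed
  from this[of "max m (Suc i)"]
  have "lower_central L i \<subseteq> lower_central_sum I (max m (Suc i))" by simp
  also have "\<dots> \<subseteq> I"
    using lower_central_sum_le[OF ideal_subspace] lower_central_antimono[of m "max m (Suc i)"] m by auto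
  finally show ?thesis .
qed

lemma rk_lower_central_sum_less:
  assumes "lower_central L m \<subseteq> I" "\<not> lower_central L i \<subseteq> I"
  shows "rk (lower_central_sum I (Suc i)) < rk (lower_central_sum I i)"
proof (rule rk_strict_mono[OF lower_central_sum_sup(3) lower_central_sum_sup(3)])
  have "lower_central_sum I (Suc i) \<subseteq> lower_central_sum I i"
    using lower_central_sum_le[OF lower_central_sum_sup(3)] lower_central_Suc_subset lower_central_sum_sup by blast
  moreover have "lower_central_sum I (Suc i) \<noteq> lower_central_sum I i"
    using lower_central_stable[OF assms(1), of i] assms(2) lower_central_sum_sup(1)[of i] by blast
  ultimately show "lower_central_sum I (Suc i) \<subset> lower_central_sum I i" by blast
qed

text \<open>If \<open>C\<^sup>1 + I\<close> had codimension at most one, then \<open>L\<close> would be spanned by \<open>C\<^sup>1 + I\<close> and a single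
  vector \<open>x\<close>, so that all brackets would already lie in \<open>C\<^sup>2 + I\<close>.\<close>
lemma rk_lower_central_sum_1:
  assumes m: "lower_central L m \<subseteq> I" and n: "\<not> lower_central L 1 \<subseteq> I"
  shows "rk (lower_central_sum I 1) + 2 \<le> lie_dim L"
proof (rule ccontr)
  let ?E = "lower_central_sum I"
  assume "\<not> rk (?E 1) + 2 \<le> lie_dim L"
  then have ge: "lie_dim L \<le> Suc (rk (?E 1))" by simp
  obtain x where x: "x \<in> carrier L" "carrier L \<subseteq> adjoin (?E 1) x"
  proof (cases "?E 1 = carrier L")
    case True
    then show thesis using that[of \<zero>] subspace_adjoin[OF lower_central_sum_sup(3)] by blast
  next
    case False
    then obtain x where x: "x \<in> carrier L" "x \<notin> ?E 1" using subspaceD(1)[OF lower_central_sum_sup(3)] by blast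
    note A = subspace_adjoin[OF lower_central_sum_sup(3)[of 1] x(1)]
    have "rk (?E 1) < rk (adjoin (?E 1) x)" using rk_strict_mono[OF lower_central_sum_sup(3) A(1)] A x by blast
    then have "rk (carrier L) \<le> rk (adjoin (?E 1) x)" using ge by simp
    then have "adjoin (?E 1) x = carrier L" using rk_eqD[OF A(1) subspace_carrier subspaceD(1)[OF A(1)]] by blast
    then show thesis using that x by blast
  qed
  have "lower_central L (Suc 0) \<subseteq> ?E (Suc 1)"
  proof (rule lower_central_Suc_le[OF lower_central_sum_sup(3)])
    note S = lower_central_sum_sup(3)[of "Suc 1"]
    note S1 = lower_central_sum_sup(3)[of 1]
    fix y z assume y: "y \<in> carrier L" and "z \<in> lower_central L 0"
    then have z: "z \<in> carrier L" by simp
    have "y \<in> adjoin (?E 1) x" "z \<in> adjoin (?E 1) x" using x y z by auto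
    then obtain e c e' c' where e: "e \<in> ?E 1" "y = e \<oplus> c \<odot> x" "e' \<in> ?E 1" "z = e' \<oplus> c' \<odot> x"
      by (auto elim!: adjoinE)
    have ec: "e \<in> carrier L" "e' \<in> carrier L" using e subspaceD(1)[OF S1] by auto
    have "bracket L y z = bracket L y e' \<oplus> c' \<odot> bracket L y x"
      using e(4) y ec x(1) by (simp add: bracket_add_right bracket_smult_right)
    \<comment> \<open>The component of y along x drops out because [x,x] = 0, so only brackets with
      elements of C^1 + I remain, and these lie in C^2 + I.\<close>
    also have "bracket L y x = \<ominus> bracket L x e"
      using e(2) ec x(1) bracket_anticomm[OF ec(1) x(1)]
      by (simp add: bracket_add_left bracket_smult_left bracket_alternating)
    finally show "bracket L y z \<in> ?E (Suc 1)"
      using bracket_lower_central_sum[OF y e(3)] bracket_lower_central_sum[OF x(1) e(1)]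
        subspaceD(3)[OF S] subspace_scal[OF S] subspace_neg[OF S] by simp
  qed
  then have "lower_central L 1 \<subseteq> I" using lower_central_stable[OF m, of 1] by simp
  then show False using n by blast
qed

text \<open>The first step costs two dimensions (\<open>rk_lower_central_sum_1\<close>), every
  further one at least one as long as I is not reached; hence codimension at least i + 1.\<close>

lemma rk_lower_central_sum:
  assumes m: "lower_central L m \<subseteq> I" and "1 \<le> i" "\<not> lower_central L i \<subseteq> I"
  shows "rk (lower_central_sum I i) + i + 1 \<le> lie_dim L"
  using assms(2,3)
proof (induction i rule: dec_induct)
  case base
  then show ?case using rk_lower_central_sum_1[OF m] by simp
next
  case (step i)
  then have ni: "\<not> lower_central L i \<subseteq> I" using lower_central_Suc_subset by blast
  show ?case using rk_lower_central_sum_less[OF m ni] step.IH[OF ni] by simp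
qed

end

lemma rk_lower_central_le:
  assumes "lower_central L m = {\<zero>}" "1 \<le> i" "lower_central L i \<noteq> {\<zero>}"
  shows "rk (lower_central L i) + i + 1 \<le> lie_dim L"
  using rk_lower_central_sum[OF lie_ideal_zero, of m i] assms subspaceD(2)[OF lower_central_subspace, of i]
  by (auto simp: lower_central_sum_zero)

end

text \<open>Every inclusion is strict until the series vanishes. With m = n - 2 this and
  \<open>rk_lower_central_le\<close> determine the filiform dimensions exactly: C^i has dimension n
  - 1 - i for 1 \<le> i \<le> n - 2.\<close>

lemma (in lie_algebra) rk_lower_central_ge:
  assumes m: "lower_central L (Suc m) = {\<zero>}" and m': "lower_central L m \<noteq> {\<zero>}" and "i \<le> Suc m"
  shows "Suc m \<le> rk (lower_central L i) + i"
proof -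
  \<comment> \<open>The induction climbs from the bottom: j counts the steps above C^(m+1) = 0, each
    adding at least one dimension.\<close>
  have "j \<le> rk (lower_central L (Suc m - j))" if "j \<le> Suc m" for j
    using that
  proof (induction j)
    case (Suc j)
    have s: "Suc (Suc m - Suc j) = Suc m - j" using Suc.prems by simp
    have "lower_central L m \<subseteq> lower_central L (Suc m - Suc j)" using lower_central_antimono by simp
    then have "\<not> lower_central L (Suc m - Suc j) \<subseteq> {\<zero>}"
      using m' subspaceD(2)[OF lower_central_subspace, of m] by blast
    then have "rk (lower_central L (Suc m - j)) < rk (lower_central L (Suc m - Suc j))"
      using rk_lower_central_sum_less[OF lie_ideal_zero, of "Suc m" "Suc m - Suc j"] m s
      by (simp add: lower_central_sum_zero)
    then show ?case using Suc by simp
  qed simp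
  from this[of "Suc m - i"] assms(3) show ?thesis by (simp add: le_diff_conv)
qed

section \<open>The canonical ideal is the unique Lagrangian ideal\<close>

context symplectic_lie_algebra
begin

text \<open>Closedness moves a bracket from one argument to the other: \<omega>([u,c],z) is
  expressed by \<omega>([z,u],c), covered by the induction hypothesis with j raised by one, and by
  \<omega>([c,z],u), where [c,z] lies in C^(i+j+1), which is zero.\<close>

lemma form_lower_central:
  assumes m: "lower_central L m = {\<zero>}" and "x \<in> lower_central L i" "y \<in> lower_central L j" "m \<le> i + j"
  shows "\<omega> x y = 0"
  using assms(2-)
proof (induction i arbitrary: j x y)
  case 0
  then have "y = \<zero>" using lower_central_antimono[of m j] m by auto
  then show ?case using 0 by simp
next
  case (Suc i)
  have "lower_central L (Suc i) \<subseteq> orth (lower_central L j)"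
  proof (rule lower_central_Suc_le[OF subspace_orth[OF lower_central_subset]])
    fix u c assume u: "u \<in> carrier L" and c: "c \<in> lower_central L i"
    have cc: "c \<in> carrier L" using c lower_central_subset by blast
    show "bracket L u c \<in> orth (lower_central L j)"
    proof (rule orthI)
      fix z assume z: "z \<in> lower_central L j"
      have zc: "z \<in> carrier L" using z lower_central_subset by blast
      have "bracket L c z \<in> lower_central L m"
        using bracket_lower_central[OF c z] lower_central_antimono[of m "Suc (i + j)"] Suc.prems by auto
      then have "bracket L c z = \<zero>" using m by simp
      moreover have "\<omega> (bracket L z u) c = 0"
      proof -
        have "\<omega> (bracket L z u) c = - \<omega> (bracket L u z) c"
          unfolding bracket_anticomm[OF zc u] by (rule form_neg_left) (use cc u zc in auto)
        also have "\<dots> = \<omega> c (bracket L u z)" using form_antisym[of c "bracket L u z"] cc u zc by simp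
        also have "\<dots> = 0" using Suc.IH[OF c bracket_in_lower_central[OF u z]] Suc.prems by simp
        finally show ?thesis .
      qed
      ultimately show "\<omega> (bracket L u c) z = 0" using form_closed[OF u cc zc] u by simp
    qed (use u cc in simp)
  qed
  then show ?case using Suc.prems orthD(1) by blast
qed

lemma canonical_ideal_lagrangian:
  assumes "filiform L" "4 \<le> lie_dim L"
  shows "lagrangian_ideal L \<omega> (canonical_ideal L)"
proof -
  let ?n = "lie_dim L" and ?C = "lower_central L"
  define l where "l = ?n div 2"
  have top: "?C (?n - 1) = {\<zero>}" and bot: "?C (?n - 2) \<noteq> {\<zero>}"
    using assms(1) by (auto simp: filiform_def)
  have Suc: "Suc (?n - 2) = ?n - 1" using assms(2) by simp
  have ge: "?n - 1 \<le> rk (?C i) + i" if "i \<le> ?n - 1" for i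
    using rk_lower_central_ge[of "?n - 2" i] top bot that unfolding Suc by simp
  have le: "rk (?C i) + i + 1 \<le> ?n" if "1 \<le> i" "i \<le> ?n - 2" for i
  proof (rule rk_lower_central_le[OF top that(1)])
    show "?C i \<noteq> {\<zero>}"
      using lower_central_antimono[OF that(2)] bot subspaceD(2)[OF lower_central_subspace, of "?n - 2"] by blast
  qed
  note perp = form_lower_central[OF top]
  \<comment> \<open>For n = 2l + 1 the bound l + l = n - 1 makes C^l isotropic, and its rank is at
    least l. That is enough to make it Lagrangian, which forces n to be even.\<close>
  have even: "?n = 2 * l"
  proof (rule ccontr)
    assume "?n \<noteq> 2 * l"
    then have n: "?n = Suc (2 * l)" unfolding l_def by presburger
    have "?C l \<subseteq> orth (?C l)" using perp[of _ l _ l] lower_central_subset n by (auto intro!: orthI)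
    moreover have "?n \<le> Suc (2 * rk (?C l))" using ge[of l] n by simp
    ultimately have "orth (?C l) = ?C l" using isotropic_imp_lagrangian lower_central_subspace by blast
    then have "2 * rk (?C l) = ?n" using rk_lagrangian lower_central_subspace by blast
    then show False using n by (metis dvd_triv_left even_Suc)
  qed
  then have l: "2 \<le> l" using assms(2) by simp
  let ?W = "?C (l - 1)"
  note W = lower_central_subspace[of "l - 1"]
  \<comment> \<open>Here the vanishing bound fails by one, as 2(l-1) = n - 2. It does hold between
    C^(l-1) and C^l. So if \<omega>(a,b) \<noteq> 0, then a and b are independent modulo C^l,
    whereas C^l has codimension one in C^(l-1).\<close>
  have "?W \<subseteq> orth ?W"
  proof (rule ccontr)
    assume "\<not> ?W \<subseteq> orth ?W"
    then obtain a b where ab: "a \<in> ?W" "b \<in> ?W" "\<omega> a b \<noteq> 0" using orthI lower_central_subset by blast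
    have c: "a \<in> carrier L" "b \<in> carrier L" using ab lower_central_subset by auto
    have perp_a: "\<omega> a w = 0" if "w \<in> ?C l" for w
      using perp[OF ab(1) that] even l by simp
    have perp_b: "\<omega> w b = 0" if "w \<in> ?C l" for w
      using perp[OF that ab(2)] even l by simp
    note S = lower_central_subspace[of l]
    note A = subspace_adjoin[OF S c(1)]
    note B = subspace_adjoin[OF A(1) c(2)]
    have "a \<notin> ?C l" using perp_b ab by blast
    then have 1: "rk (?C l) < rk (adjoin (?C l) a)" using rk_strict_mono[OF S A(1)] A by blast
    have "b \<notin> adjoin (?C l) a"
    proof
      assume "b \<in> adjoin (?C l) a"
      then obtain w d where w: "w \<in> ?C l" "b = w \<oplus> d \<odot> a" by (rule adjoinE)
      have "w \<in> carrier L" using w lower_central_subset by blast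
      then have "\<omega> a b = 0"
        using w perp_a[OF w(1)] c by (simp add: form_add_right form_scal_right form_alternating)
      then show False using ab by simp
    qed
    then have 2: "rk (adjoin (?C l) a) < rk (adjoin (adjoin (?C l) a) b)"
      using rk_strict_mono[OF A(1) B(1)] B by blast
    have "adjoin (adjoin (?C l) a) b \<subseteq> ?W"
      by (intro adjoin_subset W ab lower_central_antimono) simp
    then have 3: "rk (adjoin (adjoin (?C l) a) b) \<le> rk ?W" using rk_mono[OF B(1) W] by blast
    have "rk ?W + (l - 1) + 1 \<le> ?n" by (rule le) (use l even in auto)
    moreover have "?n - 1 \<le> rk (?C l) + l" by (rule ge) (use l even in auto)
    ultimately show False using 1 2 3 even l by linarith
  qed
  \<comment> \<open>This says that the rank of C^(l-1) is at least l, the largest possible for an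
    isotropic subspace.\<close>
  moreover have "?n - 1 \<le> rk ?W + (l - 1)" by (rule ge) (use l even in auto)
  then have "?n \<le> Suc (2 * rk ?W)" using even l by linarith
  ultimately have "orth ?W = ?W" using isotropic_imp_lagrangian[OF W] by blast
  then show ?thesis
    using lie_ideal_lower_central by (simp add: lagrangian_ideal_def canonical_ideal_def l_def)
qed

lemma lagrangian_ideal_subspace: "lagrangian_ideal L \<omega> I \<Longrightarrow> subspace class_ring I L"
  by (simp add: lagrangian_ideal_def lie_ideal_def)

text \<open>Write n = 2l. If C^(l-1) were not contained in I, then C^(l-1) + I would have rank at
  most l, and C^l + I would be strictly smaller while still containing I, which has rank l. Taking
  orthogonals turns C^(l-1) \<subseteq> I into the reverse inclusion.\<close>

lemma lagrangian_ideal_unique: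
  assumes "filiform L" "4 \<le> lie_dim L" and I: "lagrangian_ideal L \<omega> I"
  shows "I = canonical_ideal L"
proof -
  let ?n = "lie_dim L"
  let ?C = "canonical_ideal L"
  note C = canonical_ideal_lagrangian[OF assms(1,2)]
  have id: "lie_ideal L I" and oI: "orth I = I" and oC: "orth ?C = ?C"
    using I C by (auto simp: lagrangian_ideal_def)
  note Is = lagrangian_ideal_subspace[OF I]
  have rI: "2 * rk I = ?n" using rk_lagrangian[OF Is oI] .
  have "?C \<subseteq> I"
  proof (rule ccontr)
    assume "\<not> ?C \<subseteq> I"
    then have n: "\<not> lower_central L (?n div 2 - 1) \<subseteq> I" by (simp add: canonical_ideal_def)
    have top: "lower_central L (?n - 1) \<subseteq> I"
      using assms(1) subspaceD(2)[OF Is] by (simp add: filiform_def)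
    \<comment> \<open>The count starts at C^1, so the index l - 1 has to be at least 1; this is
      where \<open>4 \<le> lie_dim L\<close> enters.\<close>
    have "rk (lower_central_sum I (?n div 2 - 1)) + (?n div 2 - 1) + 1 \<le> ?n"
      by (rule rk_lower_central_sum[OF id top _ n]) (use assms(2) in simp)
    moreover have "rk (lower_central_sum I (Suc (?n div 2 - 1))) < rk (lower_central_sum I (?n div 2 - 1))"
      by (rule rk_lower_central_sum_less[OF id top n])
    moreover have "rk I \<le> rk (lower_central_sum I (Suc (?n div 2 - 1)))"
      using rk_mono[OF Is lower_central_sum_sup(3)[OF id] lower_central_sum_sup(2)[OF id]] .
    ultimately show False using rI assms(2) by linarith
  qed
  moreover have "I \<subseteq> ?C" using orth_antimono[OF \<open>?C \<subseteq> I\<close>] oI oC by simp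
  ultimately show ?thesis by blast
qed

end

section \<open>Dual spaces, cochains and cocycles\<close>

lemma dual_space_carrier:
  "carrier (dual_space V) = linear_maps V scalars \<inter> extensional (carrier V)"
  by (simp add: dual_space_def)

lemma dual_space_simps [simp]:
  "\<zero>\<^bsub>dual_space V\<^esub> = (\<lambda>w\<in>carrier V. 0)"
  "\<xi> \<oplus>\<^bsub>dual_space V\<^esub> \<eta> = (\<lambda>w\<in>carrier V. \<xi> w + \<eta> w)"
  "c \<odot>\<^bsub>dual_space V\<^esub> \<xi> = (\<lambda>w\<in>carrier V. c * \<xi> w)"
  by (simp_all add: dual_space_def class_ring.func_space_def)

lemma linear_maps_cong:
  assumes "vectorspace class_ring V" "\<And>x. x \<in> carrier V \<Longrightarrow> f x = g x" "f \<in> linear_maps V W"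
  shows "g \<in> linear_maps V W"
proof -
  interpret vectorspace class_ring V using assms(1) .
  note D = linear_mapsD[OF assms(3)]
  show ?thesis
  proof (rule linear_mapsI)
    fix x y assume "x \<in> carrier V" "y \<in> carrier V"
    then show "g (x \<oplus>\<^bsub>V\<^esub> y) = g x \<oplus>\<^bsub>W\<^esub> g y"
      using D(2)[of x y] assms(2)[of "x \<oplus>\<^bsub>V\<^esub> y"] assms(2)[of x] assms(2)[of y] by simp
  next
    fix c x assume "x \<in> carrier V"
    then show "g (c \<odot>\<^bsub>V\<^esub> x) = c \<odot>\<^bsub>W\<^esub> g x"
      using D(3)[of x c] assms(2)[of "c \<odot>\<^bsub>V\<^esub> x"] assms(2)[of x] by simp
  qed (use D(1) assms(2) in metis)
qed

lemma dual_spaceI: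
  assumes "vectorspace class_ring V" "f \<in> linear_maps V scalars"
  shows "(\<lambda>w\<in>carrier V. f w) \<in> carrier (dual_space V)"
  using linear_maps_cong[OF assms(1) _ assms(2), of "\<lambda>w\<in>carrier V. f w"]
  by (simp add: dual_space_carrier)

lemma dual_space_zero_closed:
  assumes "vectorspace class_ring V"
  shows "(\<lambda>w\<in>carrier V. 0) \<in> carrier (dual_space V)"
  by (rule dual_spaceI[OF assms]) (auto intro!: linear_mapsI)

lemma dual_spaceD:
  assumes "\<xi> \<in> carrier (dual_space V)"
  shows "\<xi> \<in> linear_maps V scalars" "(\<lambda>w\<in>carrier V. \<xi> w) = \<xi>"
  using assms by (auto simp: dual_space_carrier extensional_restrict)

lemma linear_maps_scalars_sum:
  assumes "f \<in> linear_maps V scalars" "g \<in> linear_maps V scalars"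
  shows "(\<lambda>x. f x + g x) \<in> linear_maps V scalars"
  using linear_mapsD[OF assms(1)] linear_mapsD[OF assms(2)]
  by (auto intro!: linear_mapsI simp: algebra_simps)

lemma linear_maps_scalars_scale:
  assumes "f \<in> linear_maps V scalars"
  shows "(\<lambda>x. c * f x) \<in> linear_maps V scalars"
  using linear_mapsD[OF assms] by (auto intro!: linear_mapsI simp: algebra_simps)

lemma linear_maps_scalars_diff:
  assumes "f \<in> linear_maps V scalars" "g \<in> linear_maps V scalars"
  shows "(\<lambda>x. f x - g x) \<in> linear_maps V scalars"
  using linear_maps_scalars_sum[OF assms(1) linear_maps_scalars_scale[OF assms(2), of "-1"]] by simp

lemma dual_rep_apply: "x \<in> carrier H \<Longrightarrow> dual_rep H conn u \<xi> x = - \<xi> (conn u x)"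
  by (simp add: dual_rep_def)

text \<open>Symmetry of b transfers linearity from the second argument to the first.\<close>

lemma cochains1I:
  assumes "vectorspace class_ring H"
    and "\<And>u. u \<in> carrier H \<Longrightarrow> b u \<in> linear_maps H scalars"
    and "\<And>u v. u \<in> carrier H \<Longrightarrow> v \<in> carrier H \<Longrightarrow> b u v = b v u"
  shows "(\<lambda>u\<in>carrier H. \<lambda>v\<in>carrier H. b u v) \<in> lagrangian_cochains1 H"
proof -
  interpret vectorspace class_ring H using assms(1) .
  note D = linear_mapsD[OF assms(2)]
  have "(\<lambda>u\<in>carrier H. \<lambda>v\<in>carrier H. b u v) \<in> linear_maps H (dual_space H)"
  proof (rule linear_mapsI)
    fix x assume x: "x \<in> carrier H"
    then show "(\<lambda>u\<in>carrier H. \<lambda>v\<in>carrier H. b u v) x \<in> carrier (dual_space H)"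
      using dual_spaceI[OF assms(1,2)] by simp
  next
    fix x y assume "x \<in> carrier H" "y \<in> carrier H"
    then show "(\<lambda>u\<in>carrier H. \<lambda>v\<in>carrier H. b u v) (x \<oplus>\<^bsub>H\<^esub> y) =
      (\<lambda>u\<in>carrier H. \<lambda>v\<in>carrier H. b u v) x \<oplus>\<^bsub>dual_space H\<^esub> (\<lambda>u\<in>carrier H. \<lambda>v\<in>carrier H. b u v) y"
      using D(2) assms(3) by (auto simp: fun_eq_iff)
  next
    fix c x assume "x \<in> carrier H"
    then show "(\<lambda>u\<in>carrier H. \<lambda>v\<in>carrier H. b u v) (c \<odot>\<^bsub>H\<^esub> x) =
      c \<odot>\<^bsub>dual_space H\<^esub> (\<lambda>u\<in>carrier H. \<lambda>v\<in>carrier H. b u v) x"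
      using D(3) assms(3) by (auto simp: fun_eq_iff)
  qed
  then show ?thesis using assms(3) by (simp add: lagrangian_cochains1_def)
qed

lemma cochains1D:
  assumes "\<phi> \<in> lagrangian_cochains1 H"
  shows "\<And>u. u \<in> carrier H \<Longrightarrow> \<phi> u \<in> linear_maps H scalars"
    and "\<And>u. u \<in> carrier H \<Longrightarrow> \<phi> u \<in> carrier (dual_space H)"
    and "\<And>u v. u \<in> carrier H \<Longrightarrow> v \<in> carrier H \<Longrightarrow> \<phi> u v = \<phi> v u"
  using assms linear_mapsD(1)[of \<phi> H "dual_space H"]
  by (auto simp: lagrangian_cochains1_def dual_space_carrier)

lemma coboundary_apply:
  assumes "u \<in> carrier H" "v \<in> carrier H" "w \<in> carrier H"
  shows "coboundary H conn \<phi> u v w = \<phi> u (conn v w) - \<phi> v (conn u w) - \<phi> (bracket H u v) w"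
  using assms by (simp add: coboundary_def dual_rep_def)

text \<open>The cocycle conditions evaluated at points, with the dual representation unfolded and
  extensionality left out. They can thus be checked for an unrestricted formula, which
  \<open>cocycle_restrict\<close> then turns into an element of
  \<open>lagrangian_cocycles2\<close>.\<close>

definition cocycle_conditions ::
    "('k::field_char_0, 'b) lie \<Rightarrow> ('b \<Rightarrow> 'b \<Rightarrow> 'b) \<Rightarrow> ('b \<Rightarrow> 'b \<Rightarrow> 'b \<Rightarrow> 'k) \<Rightarrow> bool" where
  "cocycle_conditions H conn a \<longleftrightarrow>
     (\<forall>u\<in>carrier H. \<forall>v\<in>carrier H. a u v \<in> linear_maps H scalars) \<and>
     (\<forall>u\<in>carrier H. \<forall>w\<in>carrier H. (\<lambda>v. a u v w) \<in> linear_maps H scalars) \<and>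
     (\<forall>v\<in>carrier H. \<forall>w\<in>carrier H. (\<lambda>u. a u v w) \<in> linear_maps H scalars) \<and>
     (\<forall>u\<in>carrier H. \<forall>w\<in>carrier H. a u u w = 0) \<and>
     (\<forall>u\<in>carrier H. \<forall>v\<in>carrier H. \<forall>w\<in>carrier H. \<forall>x\<in>carrier H.
        - a v w (conn u x) + a u w (conn v x) - a u v (conn w x)
        - a (bracket H u v) w x + a (bracket H u w) v x - a (bracket H v w) u x = 0) \<and>
     (\<forall>u\<in>carrier H. \<forall>v\<in>carrier H. \<forall>w\<in>carrier H. a u v w + a w u v + a v w u = 0)"

lemma cocycle_conditionsD:
  assumes "cocycle_conditions H conn a"
  shows "\<And>u v. u \<in> carrier H \<Longrightarrow> v \<in> carrier H \<Longrightarrow> a u v \<in> linear_maps H scalars"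
    "\<And>u w. u \<in> carrier H \<Longrightarrow> w \<in> carrier H \<Longrightarrow> (\<lambda>v. a u v w) \<in> linear_maps H scalars"
    "\<And>v w. v \<in> carrier H \<Longrightarrow> w \<in> carrier H \<Longrightarrow> (\<lambda>u. a u v w) \<in> linear_maps H scalars"
    "\<And>u w. u \<in> carrier H \<Longrightarrow> w \<in> carrier H \<Longrightarrow> a u u w = 0"
    "\<And>u v w x. u \<in> carrier H \<Longrightarrow> v \<in> carrier H \<Longrightarrow> w \<in> carrier H \<Longrightarrow> x \<in> carrier H \<Longrightarrow>
        - a v w (conn u x) + a u w (conn v x) - a u v (conn w x)
        - a (bracket H u v) w x + a (bracket H u w) v x - a (bracket H v w) u x = 0"
    "\<And>u v w. u \<in> carrier H \<Longrightarrow> v \<in> carrier H \<Longrightarrow> w \<in> carrier H \<Longrightarrow> a u v w + a w u v + a v w u = 0"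
  using assms by (simp_all add: cocycle_conditions_def)

lemma cocycles2_iff:
  assumes "flat_lie_algebra H conn"
  shows "\<alpha> \<in> lagrangian_cocycles2 H conn \<longleftrightarrow>
    cocycle_conditions H conn \<alpha> \<and> \<alpha> = (\<lambda>u\<in>carrier H. \<lambda>v\<in>carrier H. \<lambda>w\<in>carrier H. \<alpha> u v w)"
    (is "?L \<longleftrightarrow> ?C \<and> ?E")
proof
  interpret H: flat_lie_algebra H conn using assms .
  {
    assume L: ?L
    then have P: "\<alpha> \<in> carrier H \<rightarrow>\<^sub>E carrier H \<rightarrow>\<^sub>E carrier (dual_space H)"
      and B: "bilinear_map H H (dual_space H) \<alpha>"
      and Z: "\<forall>u\<in>carrier H. \<alpha> u u = \<zero>\<^bsub>dual_space H\<^esub>"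
      by (auto simp: lagrangian_cocycles2_def)
    note B = bilinear_mapD[OF B]
    have ext: "?E"
    proof (rule ext)
      fix u
      show "\<alpha> u = (\<lambda>u\<in>carrier H. \<lambda>v\<in>carrier H. \<lambda>w\<in>carrier H. \<alpha> u v w) u"
      proof (cases "u \<in> carrier H")
        case True
        then have Pu: "\<alpha> u \<in> carrier H \<rightarrow>\<^sub>E carrier (dual_space H)" using P by (rule PiE_mem[rotated])
        have "\<alpha> u v = (\<lambda>v\<in>carrier H. \<lambda>w\<in>carrier H. \<alpha> u v w) v" for v
        proof (cases "v \<in> carrier H")
          case v: True
          show ?thesis using v dual_spaceD(2)[OF PiE_mem[OF Pu v]] by simp
        next
          case False
          then show ?thesis using PiE_arb[OF Pu] by simp
        qed
        then show ?thesis using True by auto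
      next
        case False
        then show ?thesis using PiE_arb[OF P] by simp
      qed
    qed
    have lin: "\<alpha> u v \<in> linear_maps H scalars" if "u \<in> carrier H" "v \<in> carrier H" for u v
      using B(1)[OF that] dual_spaceD(1) by blast
    have lin2: "(\<lambda>v. \<alpha> u v w) \<in> linear_maps H scalars" if "u \<in> carrier H" "w \<in> carrier H" for u w
      by (rule linear_mapsI) (use B(4,5) that in \<open>auto\<close>)
    have lin1: "(\<lambda>u. \<alpha> u v w) \<in> linear_maps H scalars" if "v \<in> carrier H" "w \<in> carrier H" for v w
      by (rule linear_mapsI) (use B(2,3) that in \<open>auto\<close>)
    have "?C"
      unfolding cocycle_conditions_def
    proof (intro conjI ballI)
      fix u v w x assume c: "u \<in> carrier H" "v \<in> carrier H" "w \<in> carrier H" "x \<in> carrier H"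
      have "dual_rep H conn u (\<alpha> v w) x - dual_rep H conn v (\<alpha> u w) x + dual_rep H conn w (\<alpha> u v) x
           - \<alpha> (bracket H u v) w x + \<alpha> (bracket H u w) v x - \<alpha> (bracket H v w) u x = 0"
        using L c by (auto simp: lagrangian_cocycles2_def)
      then show "- \<alpha> v w (conn u x) + \<alpha> u w (conn v x) - \<alpha> u v (conn w x)
        - \<alpha> (bracket H u v) w x + \<alpha> (bracket H u w) v x - \<alpha> (bracket H v w) u x = 0"
        using c by (simp add: dual_rep_apply)
    next
      fix u v w assume "u \<in> carrier H" "v \<in> carrier H" "w \<in> carrier H"
      then show "\<alpha> u v w + \<alpha> w u v + \<alpha> v w u = 0"
        using L by (auto simp: lagrangian_cocycles2_def)
    qed (use lin lin1 lin2 Z in auto)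
    then show "?C \<and> ?E" using ext by blast
  next
    assume CE: "?C \<and> ?E"
    note C = CE[THEN conjunct1, unfolded cocycle_conditions_def]
    have lin: "\<alpha> u v \<in> linear_maps H scalars" if "u \<in> carrier H" "v \<in> carrier H" for u v
      using C that by blast
    have lin2: "(\<lambda>v. \<alpha> u v w) \<in> linear_maps H scalars" if "u \<in> carrier H" "w \<in> carrier H" for u w
      using C that by blast
    have lin1: "(\<lambda>u. \<alpha> u v w) \<in> linear_maps H scalars" if "v \<in> carrier H" "w \<in> carrier H" for v w
      using C that by blast
    note E = CE[THEN conjunct2]
    have r: "\<alpha> u v = (\<lambda>w\<in>carrier H. \<alpha> u v w)" if "u \<in> carrier H" "v \<in> carrier H" for u v
      by (rule trans[OF fun_cong[OF fun_cong[OF E]]]) (use that in simp)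
    have ru: "\<alpha> u = (\<lambda>v\<in>carrier H. \<alpha> u v)" if "u \<in> carrier H" for u
    proof
      fix v
      have "\<alpha> u v = (\<lambda>v\<in>carrier H. \<lambda>w\<in>carrier H. \<alpha> u v w) v"
        by (rule trans[OF fun_cong[OF fun_cong[OF E]]]) (use that in simp)
      then show "\<alpha> u v = (\<lambda>v\<in>carrier H. \<alpha> u v) v" by (cases "v \<in> carrier H") simp_all
    qed
    have rr: "\<alpha> = (\<lambda>u\<in>carrier H. \<alpha> u)"
    proof
      fix u
      have "\<alpha> u = (\<lambda>u\<in>carrier H. \<lambda>v\<in>carrier H. \<lambda>w\<in>carrier H. \<alpha> u v w) u"
        by (rule fun_cong[OF E])
      then show "\<alpha> u = (\<lambda>u\<in>carrier H. \<alpha> u) u" by (cases "u \<in> carrier H") simp_all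
    qed
    have cl: "\<alpha> u v \<in> carrier (dual_space H)" if "u \<in> carrier H" "v \<in> carrier H" for u v
      using dual_spaceI[OF H.vectorspace_axioms lin[OF that]] r[OF that] by simp
    have "\<alpha> \<in> carrier H \<rightarrow>\<^sub>E carrier H \<rightarrow>\<^sub>E carrier (dual_space H)"
    proof (rule PiE_I)
      fix u assume u: "u \<in> carrier H"
      show "\<alpha> u \<in> carrier H \<rightarrow>\<^sub>E carrier (dual_space H)"
        by (subst ru[OF u]) (use cl[OF u] in auto)
    next
      fix u assume "u \<notin> carrier H" then show "\<alpha> u = undefined" by (subst rr) simp
    qed
    moreover have "bilinear_map H H (dual_space H) \<alpha>"
    proof (rule bilinear_mapI)
      fix u u' v assume c: "u \<in> carrier H" "u' \<in> carrier H" "v \<in> carrier H"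
      show "\<alpha> (u \<oplus>\<^bsub>H\<^esub> u') v = \<alpha> u v \<oplus>\<^bsub>dual_space H\<^esub> \<alpha> u' v"
        using c linear_mapsD(2)[OF lin1] by (subst r) (auto simp: fun_eq_iff)
      show "\<alpha> v (u \<oplus>\<^bsub>H\<^esub> u') = \<alpha> v u \<oplus>\<^bsub>dual_space H\<^esub> \<alpha> v u'"
        using c linear_mapsD(2)[OF lin2] by (subst r) (auto simp: fun_eq_iff)
    next
      fix d u v assume c: "u \<in> carrier H" "v \<in> carrier H"
      show "\<alpha> (d \<odot>\<^bsub>H\<^esub> u) v = d \<odot>\<^bsub>dual_space H\<^esub> \<alpha> u v"
        using c linear_mapsD(3)[OF lin1] by (subst r) (auto simp: fun_eq_iff)
      show "\<alpha> u (d \<odot>\<^bsub>H\<^esub> v) = d \<odot>\<^bsub>dual_space H\<^esub> \<alpha> u v"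
        using c linear_mapsD(3)[OF lin2] by (subst r) (auto simp: fun_eq_iff)
    qed (use cl in blast)
    moreover have "\<alpha> u u = \<zero>\<^bsub>dual_space H\<^esub>" if "u \<in> carrier H" for u
      by (subst r[OF that that]) (use cocycle_conditionsD(4)[OF CE[THEN conjunct1]] that in \<open>auto simp: fun_eq_iff\<close>)
    moreover have "dual_rep H conn u (\<alpha> v w) x - dual_rep H conn v (\<alpha> u w) x + dual_rep H conn w (\<alpha> u v) x
           - \<alpha> (bracket H u v) w x + \<alpha> (bracket H u w) v x - \<alpha> (bracket H v w) u x = 0"
      if "u \<in> carrier H" "v \<in> carrier H" "w \<in> carrier H" "x \<in> carrier H" for u v w x
      using C that by (simp add: dual_rep_apply)
    moreover have "\<alpha> u v w + \<alpha> w u v + \<alpha> v w u = 0"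
      if "u \<in> carrier H" "v \<in> carrier H" "w \<in> carrier H" for u v w
      using C that by blast
    ultimately show ?L unfolding lagrangian_cocycles2_def by simp
  }
qed

section \<open>Cohomologous cocycles\<close>

context flat_lie_algebra
begin

lemmas conn_closed [simp, intro] = bilinear_mapD(1)[OF conn_bilinear]

lemma conn_zero [simp]:
  assumes "u \<in> carrier H" shows "conn \<zero> u = \<zero>" "conn u \<zero> = \<zero>"
proof -
  have "conn u \<in> linear_maps H H" "(\<lambda>v. conn v u) \<in> linear_maps H H"
    using conn_bilinear assms by (auto simp: bilinear_map_def)
  then show "conn \<zero> u = \<zero>" "conn u \<zero> = \<zero>"
    using linear_maps_zero[OF vectorspace_axioms vectorspace_axioms] by blast+
qed

lemma cocycle_restrict:
  assumes "cocycle_conditions H conn a"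
  shows "(\<lambda>u\<in>carrier H. \<lambda>v\<in>carrier H. \<lambda>w\<in>carrier H. a u v w) \<in> lagrangian_cocycles2 H conn" (is "?r \<in> _")
proof -
  note D = cocycle_conditionsD[OF assms]
  have "cocycle_conditions H conn ?r"
    unfolding cocycle_conditions_def
  proof (intro conjI ballI)
    fix u v assume c: "u \<in> carrier H" "v \<in> carrier H"
    show "?r u v \<in> linear_maps H scalars"
      by (rule linear_maps_cong[OF vectorspace_axioms _ D(1)[OF c]]) (use c in simp)
    show "(\<lambda>w. ?r u w v) \<in> linear_maps H scalars"
      by (rule linear_maps_cong[OF vectorspace_axioms _ D(2)[OF c]]) (use c in simp)
    show "(\<lambda>w. ?r w u v) \<in> linear_maps H scalars"
      by (rule linear_maps_cong[OF vectorspace_axioms _ D(3)[OF c]]) (use c in simp)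
  next
    fix u v w x assume c: "u \<in> carrier H" "v \<in> carrier H" "w \<in> carrier H" "x \<in> carrier H"
    show "- ?r v w (conn u x) + ?r u w (conn v x) - ?r u v (conn w x)
        - ?r (bracket H u v) w x + ?r (bracket H u w) v x - ?r (bracket H v w) u x = 0"
      using D(5)[OF c] c by simp
  qed (use D(4,6) in auto)
  moreover have "?r = (\<lambda>u\<in>carrier H. \<lambda>v\<in>carrier H. \<lambda>w\<in>carrier H. ?r u v w)"
    by (auto simp: fun_eq_iff)
  ultimately show ?thesis using cocycles2_iff[OF flat_lie_algebra_axioms, of ?r] by blast
qed

lemma cocycles2D:
  assumes "\<alpha> \<in> lagrangian_cocycles2 H conn"
  shows "cocycle_conditions H conn \<alpha>" "\<And>u v. u \<in> carrier H \<Longrightarrow> v \<in> carrier H \<Longrightarrow> (\<lambda>w\<in>carrier H. \<alpha> u v w) = \<alpha> u v"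
    "\<alpha> = (\<lambda>u\<in>carrier H. \<lambda>v\<in>carrier H. \<lambda>w\<in>carrier H. \<alpha> u v w)"
proof -
  show "cocycle_conditions H conn \<alpha>" and *: "\<alpha> = (\<lambda>u\<in>carrier H. \<lambda>v\<in>carrier H. \<lambda>w\<in>carrier H. \<alpha> u v w)"
    using assms cocycles2_iff[OF flat_lie_algebra_axioms] by auto
  fix u v assume "u \<in> carrier H" "v \<in> carrier H"
  then have "(\<lambda>u\<in>carrier H. \<lambda>v\<in>carrier H. \<lambda>w\<in>carrier H. \<alpha> u v w) u v = (\<lambda>w\<in>carrier H. \<alpha> u v w)" by simp
  then show "(\<lambda>w\<in>carrier H. \<alpha> u v w) = \<alpha> u v" using fun_cong[OF fun_cong[OF *], of u v] by (rule trans[OF sym sym])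
qed

lemma cohomologous_iff:
  "(\<alpha>, \<beta>) \<in> cohomologous H conn \<longleftrightarrow>
     \<alpha> \<in> lagrangian_cocycles2 H conn \<and> \<beta> \<in> lagrangian_cocycles2 H conn \<and>
     (\<exists>\<phi>\<in>lagrangian_cochains1 H. \<forall>u\<in>carrier H. \<forall>v\<in>carrier H. \<forall>w\<in>carrier H.
        \<beta> u v w - \<alpha> u v w = \<phi> u (conn v w) - \<phi> v (conn u w) - \<phi> (bracket H u v) w)"
  by (simp add: cohomologous_def coboundary_apply cong: bex_cong)

lemma cochains1_combination:
  assumes "\<phi> \<in> lagrangian_cochains1 H" "\<psi> \<in> lagrangian_cochains1 H"
  shows "(\<lambda>u\<in>carrier H. \<lambda>v\<in>carrier H. c * \<phi> u v + d * \<psi> u v) \<in> lagrangian_cochains1 H"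
  by (rule cochains1I[OF vectorspace_axioms])
    (auto intro!: linear_maps_scalars_sum linear_maps_scalars_scale
      simp: cochains1D(1)[OF assms(1)] cochains1D(1)[OF assms(2)]
      cochains1D(3)[OF assms(1)] cochains1D(3)[OF assms(2)])

lemma cochains1_zero: "(\<lambda>u\<in>carrier H. \<lambda>v\<in>carrier H. 0) \<in> lagrangian_cochains1 H"
  by (rule cochains1I[OF vectorspace_axioms]) (auto intro!: linear_mapsI)

lemma cohomologous_refl:
  assumes "\<alpha> \<in> lagrangian_cocycles2 H conn"
  shows "(\<alpha>, \<alpha>) \<in> cohomologous H conn"
  unfolding cohomologous_iff using assms
  by (intro conjI bexI[OF _ cochains1_zero]) auto

lemma cohomologous_sym:
  assumes "(\<alpha>, \<beta>) \<in> cohomologous H conn"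
  shows "(\<beta>, \<alpha>) \<in> cohomologous H conn"
proof -
  obtain \<phi> where \<phi>: "\<phi> \<in> lagrangian_cochains1 H"
    and eq: "\<And>u v w. u \<in> carrier H \<Longrightarrow> v \<in> carrier H \<Longrightarrow> w \<in> carrier H \<Longrightarrow>
      \<beta> u v w - \<alpha> u v w = \<phi> u (conn v w) - \<phi> v (conn u w) - \<phi> (bracket H u v) w"
    using assms unfolding cohomologous_iff by blast
  show ?thesis
    unfolding cohomologous_iff
  proof (intro conjI bexI[OF _ cochains1_combination[OF \<phi> \<phi>, of "-1" 0]] ballI)
    fix u v w assume "u \<in> carrier H" "v \<in> carrier H" "w \<in> carrier H"
    then show "\<alpha> u v w - \<beta> u v w =
      (\<lambda>u\<in>carrier H. \<lambda>v\<in>carrier H. - 1 * \<phi> u v + 0 * \<phi> u v) u (conn v w) -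
      (\<lambda>u\<in>carrier H. \<lambda>v\<in>carrier H. - 1 * \<phi> u v + 0 * \<phi> u v) v (conn u w) -
      (\<lambda>u\<in>carrier H. \<lambda>v\<in>carrier H. - 1 * \<phi> u v + 0 * \<phi> u v) (bracket H u v) w"
      using eq[of u v w] by (simp add: algebra_simps)
  qed (use assms in \<open>auto simp: cohomologous_iff\<close>)
qed

lemma cohomologous_trans:
  assumes "(\<alpha>, \<beta>) \<in> cohomologous H conn" "(\<beta>, \<gamma>) \<in> cohomologous H conn"
  shows "(\<alpha>, \<gamma>) \<in> cohomologous H conn"
proof -
  obtain \<phi> where \<phi>: "\<phi> \<in> lagrangian_cochains1 H"
    and eq: "\<And>u v w. u \<in> carrier H \<Longrightarrow> v \<in> carrier H \<Longrightarrow> w \<in> carrier H \<Longrightarrow>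
      \<beta> u v w - \<alpha> u v w = \<phi> u (conn v w) - \<phi> v (conn u w) - \<phi> (bracket H u v) w"
    using assms(1) unfolding cohomologous_iff by blast
  obtain \<psi> where \<psi>: "\<psi> \<in> lagrangian_cochains1 H"
    and eq': "\<And>u v w. u \<in> carrier H \<Longrightarrow> v \<in> carrier H \<Longrightarrow> w \<in> carrier H \<Longrightarrow>
      \<gamma> u v w - \<beta> u v w = \<psi> u (conn v w) - \<psi> v (conn u w) - \<psi> (bracket H u v) w"
    using assms(2) unfolding cohomologous_iff by blast
  show ?thesis
    unfolding cohomologous_iff
  proof (intro conjI bexI[OF _ cochains1_combination[OF \<phi> \<psi>, of 1 1]] ballI)
    fix u v w assume "u \<in> carrier H" "v \<in> carrier H" "w \<in> carrier H"
    then show "\<gamma> u v w - \<alpha> u v w =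
      (\<lambda>u\<in>carrier H. \<lambda>v\<in>carrier H. 1 * \<phi> u v + 1 * \<psi> u v) u (conn v w) -
      (\<lambda>u\<in>carrier H. \<lambda>v\<in>carrier H. 1 * \<phi> u v + 1 * \<psi> u v) v (conn u w) -
      (\<lambda>u\<in>carrier H. \<lambda>v\<in>carrier H. 1 * \<phi> u v + 1 * \<psi> u v) (bracket H u v) w"
      using eq[of u v w] eq'[of u v w] by (simp add: diff_eq_eq)
  qed (use assms in \<open>auto simp: cohomologous_iff\<close>)
qed

lemma equiv_cohomologous: "equiv (lagrangian_cocycles2 H conn) (cohomologous H conn)"
proof (rule equivI)
  show "cohomologous H conn \<subseteq> lagrangian_cocycles2 H conn \<times> lagrangian_cocycles2 H conn"
    by (auto simp: cohomologous_def)
  show "refl_on (lagrangian_cocycles2 H conn) (cohomologous H conn)"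
    using cohomologous_refl by (auto simp: refl_on_def cohomologous_def)
  show "sym (cohomologous H conn)" using cohomologous_sym by (auto intro: symI)
  show "trans (cohomologous H conn)" using cohomologous_trans by (blast intro: transI)
qed

end

section \<open>Extension algebras\<close>

text \<open>The canonical symplectic form on the sum of a space and its dual. It depends neither on
  the connection nor on the cocycle, so one constant serves all extension algebras.\<close>

definition extension_form :: "'b \<times> ('b \<Rightarrow> 'k) \<Rightarrow> 'b \<times> ('b \<Rightarrow> 'k) \<Rightarrow> 'k::field_char_0" where
  "extension_form = (\<lambda>(u, \<xi>) (v, \<eta>). \<xi> v - \<eta> u)"

lemma extension_form_apply [simp]: "extension_form (u, \<xi>) (v, \<eta>) = \<xi> v - \<eta> u"
  by (simp add: extension_form_def)

lemma extension_algebra_simps [simp]: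
  "carrier (extension_algebra H conn \<alpha>) = carrier H \<times> carrier (dual_space H)"
  "\<zero>\<^bsub>extension_algebra H conn \<alpha>\<^esub> = (\<zero>\<^bsub>H\<^esub>, \<lambda>w\<in>carrier H. 0)"
  "(u, \<xi>) \<oplus>\<^bsub>extension_algebra H conn \<alpha>\<^esub> (v, \<eta>) = (u \<oplus>\<^bsub>H\<^esub> v, \<lambda>w\<in>carrier H. \<xi> w + \<eta> w)"
  "c \<odot>\<^bsub>extension_algebra H conn \<alpha>\<^esub> (u, \<xi>) = (c \<odot>\<^bsub>H\<^esub> u, \<lambda>w\<in>carrier H. c * \<xi> w)"
  by (simp_all add: extension_algebra_def module.extend_def direct_sum_def)

lemma extension_algebra_bracket [simp]:
  "bracket (extension_algebra H conn \<alpha>) (u, \<xi>) (v, \<eta>) =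
    (bracket H u v, \<lambda>w\<in>carrier H. \<alpha> u v w - \<eta> (conn u w) + \<xi> (conn v w))"
  by (simp add: extension_algebra_def module.extend_def lie.fields_def dual_rep_def fun_eq_iff)

lemma symplectic_isomorphic_iff:
  "symplectic_isomorphic (L, \<omega>) (M, \<omega>') \<longleftrightarrow>
    (\<exists>f\<in>lie_iso L M. \<forall>x\<in>carrier L. \<forall>y\<in>carrier L. \<omega>' (f x) (f y) = \<omega> x y)"
  by (simp add: symplectic_isomorphic_def)

lemma symplectic_isomorphic_sym:
  assumes "lie_algebra L" "symplectic_isomorphic (L, \<omega>) (M, \<omega>')"
  shows "symplectic_isomorphic (M, \<omega>') (L, \<omega>)"
proof -
  obtain f where f: "f \<in> lie_iso L M" "\<forall>x\<in>carrier L. \<forall>y\<in>carrier L. \<omega>' (f x) (f y) = \<omega> x y"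
    using assms(2) by (auto simp: symplectic_isomorphic_iff)
  let ?g = "inv_into (carrier L) f"
  have b: "f (?g x) = x \<and> ?g x \<in> carrier L" if "x \<in> carrier M" for x
    using lie_isoD(2)[OF f(1)] that by (simp add: bij_betw_def f_inv_into_f inv_into_into)
  have "\<omega> (?g x) (?g y) = \<omega>' x y" if "x \<in> carrier M" "y \<in> carrier M" for x y
    using f(2) b[OF that(1)] b[OF that(2)] by metis
  then show ?thesis
    using lie_iso_inv[OF assms(1) f(1)] unfolding symplectic_isomorphic_iff by blast
qed

lemma symplectic_isomorphic_trans:
  assumes "symplectic_isomorphic (L, \<omega>) (M, \<omega>')" "symplectic_isomorphic (M, \<omega>') (N, \<omega>'')"
  shows "symplectic_isomorphic (L, \<omega>) (N, \<omega>'')"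
proof -
  obtain f where f: "f \<in> lie_iso L M" "\<forall>x\<in>carrier L. \<forall>y\<in>carrier L. \<omega>' (f x) (f y) = \<omega> x y"
    using assms(1) by (auto simp: symplectic_isomorphic_iff)
  obtain g where g: "g \<in> lie_iso M N" "\<forall>x\<in>carrier M. \<forall>y\<in>carrier M. \<omega>'' (g x) (g y) = \<omega>' x y"
    using assms(2) by (auto simp: symplectic_isomorphic_iff)
  have "f x \<in> carrier M" if "x \<in> carrier L" for x
    using linear_mapsD(1)[OF lie_isoD(1)[OF f(1)] that] .
  then show ?thesis
    using lie_iso_compose[OF f(1) g(1)] f(2) g(2) unfolding symplectic_isomorphic_iff
    by (intro bexI[of _ "\<lambda>x. g (f x)"]) auto
qed

lemma symplectic_isomorphic_refl: "symplectic_isomorphic (L, \<omega>) (L, \<omega>)"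
  using lie_iso_id unfolding symplectic_isomorphic_iff by (intro bexI[of _ "\<lambda>x. x"]) auto

subsection \<open>From triples to extension algebras\<close>

text \<open>The isomorphism sends (u, \<xi>) to f(u) together with \<xi> + \<phi>(u) transported
  along f, that is, f preceded by a shear along the dual. Symmetry of \<phi> makes it preserve the
  form; the coboundary relation between the cocycles makes it preserve brackets.\<close>

lemma extension_symplectic_isomorphic:
  assumes H: "flat_lie_algebra H conn" and H': "flat_lie_algebra H' conn'"
    and f: "f \<in> lie_iso H H'"
    and conn: "\<And>u v. u \<in> carrier H \<Longrightarrow> v \<in> carrier H \<Longrightarrow> f (conn u v) = conn' (f u) (f v)"
    and \<phi>: "\<phi> \<in> lagrangian_cochains1 H"
    and eq: "\<And>u v w. u \<in> carrier H \<Longrightarrow> v \<in> carrier H \<Longrightarrow> w \<in> carrier H \<Longrightarrow>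
      \<alpha> u v w - \<alpha>' (f u) (f v) (f w) = \<phi> u (conn v w) - \<phi> v (conn u w) - \<phi> (bracket H u v) w"
  shows "symplectic_isomorphic (extension_algebra H conn \<alpha>, extension_form)
    (extension_algebra H' conn' \<alpha>', extension_form)"
proof -
  interpret H: flat_lie_algebra H conn using H .
  interpret H': flat_lie_algebra H' conn' using H' .
  note f' = lie_isoD[OF f]
  note fD = linear_mapsD[OF f'(1)]
  define g where "g = inv_into (carrier H) f"
  have g: "g \<in> lie_iso H' H" unfolding g_def using lie_iso_inv[OF H.lie_algebra_axioms f] .
  note gD = linear_mapsD[OF lie_isoD(1)[OF g]]
  have gf: "g (f x) = x" if "x \<in> carrier H" for x
    using f'(2) that by (simp add: g_def bij_betw_def)
  have fg: "f (g x) = x" if "x \<in> carrier H'" for x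
    using f'(2) that by (simp add: g_def bij_betw_def f_inv_into_f)
  note \<phi>' = cochains1D[OF \<phi>]
  have \<phi>_lin: "(\<lambda>u. \<phi> u v) \<in> linear_maps H scalars" if "v \<in> carrier H" for v
    using linear_maps_cong[OF H.vectorspace_axioms _ \<phi>'(1)[OF that], of "\<lambda>u. \<phi> u v"] \<phi>'(3) that by blast
  note \<phi>_add = linear_mapsD(2)[OF \<phi>_lin, simplified]
  note \<phi>_scal = linear_mapsD(3)[OF \<phi>_lin, simplified]
  let ?G = "extension_algebra H conn \<alpha>" and ?G' = "extension_algebra H' conn' \<alpha>'"
  define F where "F = (\<lambda>(u, \<xi>). (f u, \<lambda>w\<in>carrier H'. \<xi> (g w) + \<phi> u (g w)))"
  define F' where "F' = (\<lambda>(u, \<xi>). (g u, \<lambda>w\<in>carrier H. \<xi> (f w) - \<phi> (g u) w))"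
  have F_dual: "(\<lambda>w\<in>carrier H'. \<xi> (g w) + \<phi> u (g w)) \<in> carrier (dual_space H')"
    if "u \<in> carrier H" "\<xi> \<in> carrier (dual_space H)" for u \<xi>
    by (intro dual_spaceI H'.vectorspace_axioms linear_maps_scalars_sum
        linear_maps_compose[OF lie_isoD(1)[OF g]] \<phi>'(1) that(1) dual_spaceD(1)[OF that(2)])
  have F'_dual: "(\<lambda>w\<in>carrier H. \<xi> (f w) - \<phi> (g u) w) \<in> carrier (dual_space H)"
    if "u \<in> carrier H'" "\<xi> \<in> carrier (dual_space H')" for u \<xi>
    by (intro dual_spaceI H.vectorspace_axioms linear_maps_scalars_diff
        linear_maps_compose[OF f'(1)] \<phi>'(1) gD(1) that(1) dual_spaceD(1)[OF that(2)])
  have "F \<in> lie_iso ?G ?G'"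
    unfolding lie_iso_def
  proof (intro CollectI conjI ballI)
    show "F \<in> linear_maps ?G ?G'"
    proof (rule linear_mapsI)
      fix x assume "x \<in> carrier ?G"
      then show "F x \<in> carrier ?G'"
        using F_dual fD(1) by (auto simp: F_def)
    next
      fix x y assume "x \<in> carrier ?G" "y \<in> carrier ?G"
      then obtain u \<xi> v \<eta> where *: "x = (u, \<xi>)" "y = (v, \<eta>)" "u \<in> carrier H" "v \<in> carrier H" by auto
      then show "F (x \<oplus>\<^bsub>?G\<^esub> y) = F x \<oplus>\<^bsub>?G'\<^esub> F y"
        by (simp add: F_def fD(2) \<phi>_add gD(1) fun_eq_iff)
    next
      fix c x assume "x \<in> carrier ?G"
      then obtain u \<xi> where *: "x = (u, \<xi>)" "u \<in> carrier H" by auto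
      then show "F (c \<odot>\<^bsub>?G\<^esub> x) = c \<odot>\<^bsub>?G'\<^esub> F x"
        by (simp add: F_def fD(3) \<phi>_scal gD(1) fun_eq_iff distrib_left)
    qed
    show "bij_betw F (carrier ?G) (carrier ?G')"
    proof (rule bij_betw_byWitness[where f'=F'])
      show "\<forall>x\<in>carrier ?G. F' (F x) = x"
      proof
        fix x assume "x \<in> carrier ?G"
        then obtain u \<xi> where *: "x = (u, \<xi>)" "u \<in> carrier H" "\<xi> \<in> carrier (dual_space H)" by auto
        have "(\<lambda>w\<in>carrier H. \<xi> w) = \<xi>" using dual_spaceD(2) * by blast
        then show "F' (F x) = x" using * gf fD(1) by (simp add: F_def F'_def cong: restrict_cong)
      qed
      show "\<forall>y\<in>carrier ?G'. F (F' y) = y"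
      proof
        fix y assume "y \<in> carrier ?G'"
        then obtain u \<xi> where *: "y = (u, \<xi>)" "u \<in> carrier H'" "\<xi> \<in> carrier (dual_space H')" by auto
        have "(\<lambda>w\<in>carrier H'. \<xi> w) = \<xi>" using dual_spaceD(2) * by blast
        then show "F (F' y) = y" using * fg gD(1) by (simp add: F_def F'_def cong: restrict_cong)
      qed
      show "F ` carrier ?G \<subseteq> carrier ?G'" using F_dual fD(1) by (auto simp: F_def)
      show "F' ` carrier ?G' \<subseteq> carrier ?G" using F'_dual gD(1) by (auto simp: F'_def)
    qed
  next
    fix x y assume "x \<in> carrier ?G" "y \<in> carrier ?G"
    then obtain u \<xi> v \<eta> where *: "x = (u, \<xi>)" "y = (v, \<eta>)" "u \<in> carrier H" "v \<in> carrier H" by auto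
    \<comment> \<open>Comparison of the dual components of the two brackets: the terms in \<xi> and
      \<eta> match because f intertwines the connections, and the rest is exactly the hypothesis on
      \<alpha>, \<alpha>' and \<phi>.\<close>
    have "\<alpha> u v (g w) - \<eta> (conn u (g w)) + \<xi> (conn v (g w)) + \<phi> (bracket H u v) (g w) =
      \<alpha>' (f u) (f v) w - (\<eta> (g (conn' (f u) w)) + \<phi> v (g (conn' (f u) w)))
      + (\<xi> (g (conn' (f v) w)) + \<phi> u (g (conn' (f v) w)))" if w: "w \<in> carrier H'" for w
    proof -
      have gw: "g w \<in> carrier H" using gD(1) w by blast
      have "g (conn' (f z) w) = conn z (g w)" if "z \<in> carrier H" for z
        using conn[OF that gw] fg[OF w] gf[OF H.conn_closed[OF that gw]] by simp
      then show ?thesis using eq[OF *(3,4) gw] fg[OF w] * by (simp add: algebra_simps)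
    qed
    then show "F (bracket ?G x y) = bracket ?G' (F x) (F y)"
      using * fD(1) gD(1) by (simp add: F_def f'(3) fun_eq_iff)
  qed
  moreover have "extension_form (F x) (F y) = extension_form x y" if "x \<in> carrier ?G" "y \<in> carrier ?G" for x y
    using that \<phi>'(3) gf fD(1) by (auto simp: F_def)
  ultimately show ?thesis unfolding symplectic_isomorphic_iff by blast
qed

subsection \<open>From extension algebras to triples\<close>

text \<open>Respecting the dual parts makes F block triangular: F(u, \<xi>) = (f u, \<sigma> u +
  \<tau> \<xi>). Invariance of the form says that \<tau> is dual to the inverse of f and that
  \<sigma> u (f v) is symmetric. Brackets of two base vectors give the homomorphism property of f
  and the relation between the cocycles; brackets of a base vector with a dual one give
  compatibility with the connections.\<close>

lemma extension_iso_imp_flat_iso: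
  fixes H :: "('k::field_char_0, 'b) lie" and H' :: "('k, 'c) lie"
  assumes H: "flat_lie_algebra H conn" and H': "flat_lie_algebra H' conn'"
    and \<alpha>: "\<alpha> \<in> lagrangian_cocycles2 H conn" and \<alpha>': "\<alpha>' \<in> lagrangian_cocycles2 H' conn'"
    and F: "F \<in> lie_iso (extension_algebra H conn \<alpha>) (extension_algebra H' conn' \<alpha>')"
    and form: "\<And>x y. x \<in> carrier (extension_algebra H conn \<alpha>) \<Longrightarrow> y \<in> carrier (extension_algebra H conn \<alpha>) \<Longrightarrow>
      extension_form (F x) (F y) = extension_form x y"
    and fibre: "F ` ({\<zero>\<^bsub>H\<^esub>} \<times> carrier (dual_space H)) = {\<zero>\<^bsub>H'\<^esub>} \<times> carrier (dual_space H')"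
  defines "f \<equiv> \<lambda>u. fst (F (u, \<lambda>w\<in>carrier H. 0))"
  shows "f \<in> lie_iso H H'"
    and "\<And>u v. u \<in> carrier H \<Longrightarrow> v \<in> carrier H \<Longrightarrow> f (conn u v) = conn' (f u) (f v)"
    and "\<exists>\<phi>\<in>lagrangian_cochains1 H. \<forall>u\<in>carrier H. \<forall>v\<in>carrier H. \<forall>w\<in>carrier H.
      \<alpha> u v w - \<alpha>' (f u) (f v) (f w) = \<phi> u (conn v w) - \<phi> v (conn u w) - \<phi> (bracket H u v) w"
proof -
  interpret H: flat_lie_algebra H conn using H .
  interpret H': flat_lie_algebra H' conn' using H' .
  let ?G = "extension_algebra H conn \<alpha>" and ?G' = "extension_algebra H' conn' \<alpha>'"
  note C = cocycle_conditionsD[OF H.cocycles2D(1)[OF \<alpha>]] and C' = cocycle_conditionsD[OF H'.cocycles2D(1)[OF \<alpha>']]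
  note F' = lie_isoD[OF F]
  note FD = linear_mapsD[OF F'(1)]
  define ozero where "ozero = (\<lambda>w\<in>carrier H. 0 :: 'k)"
  define \<sigma> where "\<sigma> u = snd (F (u, ozero))" for u
  define \<tau> where "\<tau> \<xi> = snd (F (\<zero>\<^bsub>H\<^esub>, \<xi>))" for \<xi>
  have o: "ozero \<in> carrier (dual_space H)"
    unfolding ozero_def by (rule dual_space_zero_closed[OF H.vectorspace_axioms])
  have oz: "ozero w = 0" if "w \<in> carrier H" for w
    using that by (simp add: ozero_def)
  have Fu: "F (u, ozero) = (f u, \<sigma> u)" for u
    by (simp add: f_def \<sigma>_def ozero_def)
  have F\<xi>: "F (\<zero>\<^bsub>H\<^esub>, \<xi>) = (\<zero>\<^bsub>H'\<^esub>, \<tau> \<xi>)" if "\<xi> \<in> carrier (dual_space H)" for \<xi>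
  proof -
    have "F (\<zero>\<^bsub>H\<^esub>, \<xi>) \<in> {\<zero>\<^bsub>H'\<^esub>} \<times> carrier (dual_space H')" using fibre that by blast
    then show ?thesis by (auto simp: \<tau>_def)
  qed
  have f_cl: "f u \<in> carrier H'" and \<sigma>_cl: "\<sigma> u \<in> carrier (dual_space H')" if "u \<in> carrier H" for u
    using FD(1)[of "(u, ozero)"] that o by (simp_all add: Fu)
  have \<tau>_cl: "\<tau> \<xi> \<in> carrier (dual_space H')" if "\<xi> \<in> carrier (dual_space H)" for \<xi>
    using FD(1)[of "(\<zero>\<^bsub>H\<^esub>, \<xi>)"] that by (simp add: F\<xi>)
  have F_split: "F (u, \<xi>) = (f u, \<lambda>w\<in>carrier H'. \<sigma> u w + \<tau> \<xi> w)"
    if u: "u \<in> carrier H" and \<xi>: "\<xi> \<in> carrier (dual_space H)" for u \<xi>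
  proof -
    have "(u, ozero) \<oplus>\<^bsub>?G\<^esub> (\<zero>\<^bsub>H\<^esub>, \<xi>) = (u, \<xi>)"
      using u dual_spaceD(2)[OF \<xi>] by (simp add: ozero_def cong: restrict_cong)
    then have "F (u, \<xi>) = F (u, ozero) \<oplus>\<^bsub>?G'\<^esub> F (\<zero>\<^bsub>H\<^esub>, \<xi>)"
      using FD(2)[of "(u, ozero)" "(\<zero>\<^bsub>H\<^esub>, \<xi>)"] u \<xi> o by simp
    then show ?thesis using u f_cl by (simp add: Fu F\<xi>[OF \<xi>])
  qed
  have f_lin: "f \<in> linear_maps H H'"
  proof (rule linear_mapsI)
    fix u v assume "u \<in> carrier H" "v \<in> carrier H"
    then show "f (u \<oplus>\<^bsub>H\<^esub> v) = f u \<oplus>\<^bsub>H'\<^esub> f v"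
      using FD(2)[of "(u, ozero)" "(v, ozero)"] o Fu[of u] Fu[of v] Fu[of "u \<oplus>\<^bsub>H\<^esub> v"]
      by (simp add: ozero_def cong: restrict_cong)
  next
    fix c u assume "u \<in> carrier H"
    then show "f (c \<odot>\<^bsub>H\<^esub> u) = c \<odot>\<^bsub>H'\<^esub> f u"
      using FD(3)[of "(u, ozero)" c] o Fu[of u] Fu[of "c \<odot>\<^bsub>H\<^esub> u"]
      by (simp add: ozero_def cong: restrict_cong)
  qed (rule f_cl)
  have f_bij: "bij_betw f (carrier H) (carrier H')"
  proof (rule bij_betw_imageI)
    show "inj_on f (carrier H)"
    proof (rule inj_onI)
      fix u v assume uv: "u \<in> carrier H" "v \<in> carrier H" "f u = f v"
      let ?d = "u \<ominus>\<^bsub>H\<^esub> v"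
      have d: "?d \<in> carrier H" using uv by simp
      have "f ?d = f u \<oplus>\<^bsub>H'\<^esub> f (\<ominus>\<^bsub>H\<^esub> v)"
        using linear_mapsD(2)[OF f_lin, of u "\<ominus>\<^bsub>H\<^esub> v"] uv by (simp add: a_minus_def)
      also have "\<dots> = \<zero>\<^bsub>H'\<^esub>"
        using uv f_cl linear_maps_neg[OF H.vectorspace_axioms H'.vectorspace_axioms f_lin uv(2)]
        by (simp add: H'.M.r_neg)
      \<comment> \<open>The base component of F(u - v, 0) vanishes, so this value is also attained
        on the dual part; injectivity of F then puts (u - v, 0) itself into the dual part.\<close>
      finally have "F (?d, ozero) \<in> F ` ({\<zero>\<^bsub>H\<^esub>} \<times> carrier (dual_space H))"
        using fibre \<sigma>_cl[OF d] by (simp add: Fu)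
      then have "(?d, ozero) \<in> {\<zero>\<^bsub>H\<^esub>} \<times> carrier (dual_space H)"
        by (subst (asm) inj_on_image_mem_iff[OF bij_betw_imp_inj_on[OF F'(2)]]) (use d o in auto)
      then show "u = v" using uv H.minus_eq_zero_iff by auto
    qed
    show "f ` carrier H = carrier H'"
    proof
      show "carrier H' \<subseteq> f ` carrier H"
      proof
        fix u' assume "u' \<in> carrier H'"
        then have "(u', \<lambda>w\<in>carrier H'. 0) \<in> F ` carrier ?G"
          using dual_space_zero_closed[OF H'.vectorspace_axioms] bij_betw_imp_surj_on[OF F'(2)] by simp
        then obtain u \<xi> where "u \<in> carrier H" "\<xi> \<in> carrier (dual_space H)" "(u', \<lambda>w\<in>carrier H'. 0) = F (u, \<xi>)"
          by auto
        then show "u' \<in> f ` carrier H" using F_split by simp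
      qed
    qed (use f_cl in blast)
  qed
  have \<tau>f: "\<tau> \<xi> (f u) = \<xi> u" if "\<xi> \<in> carrier (dual_space H)" "u \<in> carrier H" for \<xi> u
  proof -
    have "\<sigma> u \<zero>\<^bsub>H'\<^esub> = 0"
      using H'.functional_neg(2)[OF dual_spaceD(1)[OF \<sigma>_cl[OF that(2)]], of "\<zero>\<^bsub>H'\<^esub>"] by simp
    then show ?thesis
      using form[of "(\<zero>\<^bsub>H\<^esub>, \<xi>)" "(u, ozero)"] that o by (simp add: F\<xi> Fu oz)
  qed
  have \<sigma>_sym: "\<sigma> u (f v) = \<sigma> v (f u)" if "u \<in> carrier H" "v \<in> carrier H" for u v
    using form[of "(u, ozero)" "(v, ozero)"] that o by (simp add: Fu oz)
  have br: "f (bracket H u v) = bracket H' (f u) (f v)"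
    and br2: "\<And>w. w \<in> carrier H' \<Longrightarrow> \<sigma> (bracket H u v) w + \<tau> (\<alpha> u v) w =
      \<alpha>' (f u) (f v) w - \<sigma> v (conn' (f u) w) + \<sigma> u (conn' (f v) w)"
    if u: "u \<in> carrier H" and v: "v \<in> carrier H" for u v
  proof -
    have \<alpha>uv: "\<alpha> u v \<in> carrier (dual_space H)"
      using dual_spaceI[OF H.vectorspace_axioms C(1)[OF u v]] H.cocycles2D(2)[OF \<alpha> u v] by simp
    have "bracket ?G (u, ozero) (v, ozero) = (bracket H u v, \<alpha> u v)"
      using u v H.cocycles2D(2)[OF \<alpha> u v] by (simp add: ozero_def cong: restrict_cong)
    then have *: "(f (bracket H u v), \<lambda>w\<in>carrier H'. \<sigma> (bracket H u v) w + \<tau> (\<alpha> u v) w) =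
      (bracket H' (f u) (f v), \<lambda>w\<in>carrier H'. \<alpha>' (f u) (f v) w - \<sigma> v (conn' (f u) w) + \<sigma> u (conn' (f v) w))"
      using F'(3)[of "(u, ozero)" "(v, ozero)"] u v o F_split[OF _ \<alpha>uv, of "bracket H u v"] by (simp add: Fu)
    then show "f (bracket H u v) = bracket H' (f u) (f v)" by simp
    fix w assume w: "w \<in> carrier H'"
    have "(\<lambda>w\<in>carrier H'. \<sigma> (bracket H u v) w + \<tau> (\<alpha> u v) w) w =
      (\<lambda>w\<in>carrier H'. \<alpha>' (f u) (f v) w - \<sigma> v (conn' (f u) w) + \<sigma> u (conn' (f v) w)) w"
      using arg_cong[OF *, of snd] by (simp only: snd_conv)
    then show "\<sigma> (bracket H u v) w + \<tau> (\<alpha> u v) w =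
      \<alpha>' (f u) (f v) w - \<sigma> v (conn' (f u) w) + \<sigma> u (conn' (f v) w)" using w by simp
  qed
  show f: "f \<in> lie_iso H H'" using f_lin f_bij br by (simp add: lie_iso_def)
  show conn: "f (conn u v) = conn' (f u) (f v)" if u: "u \<in> carrier H" and v: "v \<in> carrier H" for u v
  proof -
    have "conn' (f u) (f v) \<in> f ` carrier H" using f_bij f_cl u v by (simp add: bij_betw_def)
    then obtain y where y: "y \<in> carrier H" "conn' (f u) (f v) = f y" by blast
    \<comment> \<open>The bracket of (u, 0) with (0, \<xi>) is (0, \<eta>), where \<eta> is the dual
      representation of u on \<xi>. Applying F to it and evaluating at f v yields -\<xi>(conn u v)
      on one side and -\<xi>(y) on the other, both by \<open>\<tau>f\<close>. Linear functionals
      then separate the two vectors.\<close>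
    have key: "\<xi> (conn u v) = \<xi> y" if \<xi>: "\<xi> \<in> carrier (dual_space H)" for \<xi>
    proof -
      define \<eta> where "\<eta> = (\<lambda>w\<in>carrier H. - \<xi> (conn u w))"
      have "(\<lambda>w. - \<xi> (conn u w)) \<in> linear_maps H scalars"
      proof -
        have "conn u \<in> linear_maps H H" using H.conn_bilinear u by (simp add: bilinear_map_def)
        from linear_maps_scalars_scale[OF linear_maps_compose[OF this dual_spaceD(1)[OF \<xi>]], of "-1"]
        show ?thesis by simp
      qed
      then have \<eta>: "\<eta> \<in> carrier (dual_space H)"
        unfolding \<eta>_def by (rule dual_spaceI[OF H.vectorspace_axioms])
      have z: "\<alpha> u \<zero>\<^bsub>H\<^esub> w = 0" if "w \<in> carrier H" for w
        using H.functional_neg(2)[OF C(2)[OF u that] u] .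
      have z': "\<alpha>' (f u) \<zero>\<^bsub>H'\<^esub> w = 0" if "w \<in> carrier H'" for w
        using H'.functional_neg(2)[OF C'(2)[OF f_cl[OF u] that] f_cl[OF u]] .
      have s0: "\<sigma> u \<zero>\<^bsub>H'\<^esub> = 0"
        using H'.functional_neg(2)[OF dual_spaceD(1)[OF \<sigma>_cl[OF u]], of "\<zero>\<^bsub>H'\<^esub>"] by simp
      have "bracket ?G (u, ozero) (\<zero>\<^bsub>H\<^esub>, \<xi>) = (\<zero>\<^bsub>H\<^esub>, \<eta>)"
        using u z by (simp add: \<eta>_def ozero_def cong: restrict_cong)
      then have "(\<zero>\<^bsub>H'\<^esub>, \<tau> \<eta>) = bracket ?G' (f u, \<sigma> u) (\<zero>\<^bsub>H'\<^esub>, \<tau> \<xi>)"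
        using F'(3)[of "(u, ozero)" "(\<zero>\<^bsub>H\<^esub>, \<xi>)"] u \<xi> o by (simp add: Fu F\<xi>[OF \<xi>] F\<xi>[OF \<eta>])
      then have "\<tau> \<eta> = (\<lambda>w\<in>carrier H'. \<alpha>' (f u) \<zero>\<^bsub>H'\<^esub> w - \<tau> \<xi> (conn' (f u) w) + \<sigma> u (conn' \<zero>\<^bsub>H'\<^esub> w))" by simp
      then have "\<tau> \<eta> (f v) = - \<tau> \<xi> (f y)"
        using f_cl[OF v] z' s0 y by simp
      then show ?thesis using \<tau>f[OF \<eta> v] \<tau>f[OF \<xi> y(1)] v by (simp add: \<eta>_def)
    qed
    have "conn u v = y"
    proof (rule ccontr)
      assume ne: "conn u v \<noteq> y"
      have c: "conn u v \<in> carrier H" using u v by simp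
      have "conn u v \<ominus>\<^bsub>H\<^esub> y \<noteq> \<zero>\<^bsub>H\<^esub>" using ne c y(1) H.minus_eq_zero_iff by blast
      then obtain h where h: "h \<in> linear_maps H scalars" "h (conn u v \<ominus>\<^bsub>H\<^esub> y) = 1"
        using H.separating_functional[of "conn u v \<ominus>\<^bsub>H\<^esub> y"] c y(1) by blast
      have "h (conn u v) = h y"
        using key[OF dual_spaceI[OF H.vectorspace_axioms h(1)]] c y(1) by simp
      then show False using H.functional_minus[OF h(1) c y(1)] h(2) by simp
    qed
    then show ?thesis using y by simp
  qed
  \<comment> \<open>The off-diagonal block of F, pulled back along f in its second argument; its
    symmetry is \<open>\<sigma>_sym\<close>.\<close>
  let ?\<phi> = "\<lambda>u\<in>carrier H. \<lambda>w\<in>carrier H. \<sigma> u (f w)"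
  have "?\<phi> \<in> lagrangian_cochains1 H"
    by (rule cochains1I[OF H.vectorspace_axioms linear_maps_compose[OF f_lin]])
      (use dual_spaceD(1)[OF \<sigma>_cl] \<sigma>_sym in auto)
  moreover have "\<alpha> u v w - \<alpha>' (f u) (f v) (f w) = ?\<phi> u (conn v w) - ?\<phi> v (conn u w) - ?\<phi> (bracket H u v) w"
    if "u \<in> carrier H" "v \<in> carrier H" "w \<in> carrier H" for u v w
  proof -
    have \<alpha>uv: "\<alpha> u v \<in> carrier (dual_space H)"
      using dual_spaceI[OF H.vectorspace_axioms C(1)] H.cocycles2D(2)[OF \<alpha>] that by metis
    show ?thesis
      using br2[OF that(1,2) f_cl[OF that(3)]] \<tau>f[OF \<alpha>uv that(3)] that conn by (simp add: algebra_simps)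
  qed
  ultimately show "\<exists>\<phi>\<in>lagrangian_cochains1 H. \<forall>u\<in>carrier H. \<forall>v\<in>carrier H. \<forall>w\<in>carrier H.
      \<alpha> u v w - \<alpha>' (f u) (f v) (f w) = \<phi> u (conn v w) - \<phi> v (conn u w) - \<phi> (bracket H u v) w" by blast
qed

section \<open>The splitting by a Lagrangian complement\<close>

locale symplectic_with_lagrangian = symplectic_lie_algebra L \<omega>
  for L :: "('k::field_char_0, 'a) lie" (structure) and \<omega> :: "'a \<Rightarrow> 'a \<Rightarrow> 'k" +
  fixes I :: "'a set"
  assumes lagrangian: "lagrangian_ideal L \<omega> I"
begin

lemma I_subspace: "subspace class_ring I L"
  and I_ideal: "x \<in> carrier L \<Longrightarrow> a \<in> I \<Longrightarrow> bracket L x a \<in> I"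
  and I_orth: "orth I = I"
  using lagrangian by (auto simp: lagrangian_ideal_def lie_ideal_def)

lemma I_carrier [simp]: "a \<in> I \<Longrightarrow> a \<in> carrier L"
  using subspaceD(1)[OF I_subspace] by blast

lemma form_I: "a \<in> I \<Longrightarrow> b \<in> I \<Longrightarrow> \<omega> a b = 0"
  using I_orth orthD(1) by blast

lemma I_memI: "x \<in> carrier L \<Longrightarrow> (\<And>a. a \<in> I \<Longrightarrow> \<omega> x a = 0) \<Longrightarrow> x \<in> I"
  using I_orth orthI by blast

lemma form_cong_I:
  assumes "x \<in> carrier L" "y \<in> carrier L" "x \<ominus> y \<in> I" "a \<in> I"
  shows "\<omega> x a = \<omega> y a"
  using form_I[OF assms(3,4)] form_minus_left[of a x y] assms by simp

text \<open>By closedness \<open>\<omega>([a, b], x)\<close> is a sum of values of \<open>\<omega>\<close> on the ideal.\<close>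
lemma I_abelian:
  assumes a: "a \<in> I" and b: "b \<in> I"
  shows "bracket L a b = \<zero>"
proof (rule form_nondegenerate)
  fix x assume x: "x \<in> carrier L"
  have "\<omega> (bracket L x a) b = 0" using form_I I_ideal[OF x a] b by blast
  moreover have "\<omega> (bracket L b x) a = 0"
  proof -
    have "bracket L b x \<in> I"
      unfolding bracket_anticomm[OF I_carrier[OF b] x]
      by (rule subspace_neg[OF I_subspace I_ideal[OF x b]])
    then show ?thesis using form_I a by blast
  qed
  ultimately show "\<omega> (bracket L a b) x = 0" using form_closed[of a b x] a b x by simp
qed (use a b in simp)

lemma bracket_minus_left:
  "x \<in> carrier L \<Longrightarrow> y \<in> carrier L \<Longrightarrow> z \<in> carrier L \<Longrightarrow> bracket L (x \<ominus> y) z = bracket L x z \<ominus> bracket L y z"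
  using linear_maps_minus[OF vectorspace_axioms vectorspace_axioms bracket_left_linear] by simp

lemma bracket_minus_right:
  "x \<in> carrier L \<Longrightarrow> y \<in> carrier L \<Longrightarrow> z \<in> carrier L \<Longrightarrow> bracket L z (x \<ominus> y) = bracket L z x \<ominus> bracket L z y"
  using linear_maps_minus[OF vectorspace_axioms vectorspace_axioms bracket_right_linear] by simp

text \<open>I is abelian, so L acts on it through L/I.\<close>

lemma bracket_cong_I:
  assumes "x \<in> carrier L" "y \<in> carrier L" "x \<ominus> y \<in> I" "a \<in> I"
  shows "bracket L x a = bracket L y a"
  using I_abelian[OF assms(3,4)] bracket_minus_left[of x y a] assms minus_eq_zero_iff[of "bracket L x a" "bracket L y a"]
  by simp

end

text \<open>H is a model of L/I with projection p, and the section s stands for a Lagrangian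
  complement, its image. Keeping H, s and the connection abstract removes cosets from the
  computations and lets two sections of the same p share one connection, as needed for the
  independence of the complement.\<close>

locale lagrangian_splitting = symplectic_with_lagrangian L \<omega> I + H: lie_algebra H
  for L :: "('k::field_char_0, 'a) lie" (structure) and \<omega> :: "'a \<Rightarrow> 'a \<Rightarrow> 'k" and I
    and H :: "('k, 'b) lie" +
  fixes p :: "'a \<Rightarrow> 'b" and s :: "'b \<Rightarrow> 'a" and conn :: "'b \<Rightarrow> 'b \<Rightarrow> 'b"
  assumes p_linear: "p \<in> linear_maps L H"
    and p_bracket: "\<lbrakk>x \<in> carrier L; y \<in> carrier L\<rbrakk> \<Longrightarrow> p (bracket L x y) = bracket H (p x) (p y)"
    and p_kernel: "x \<in> carrier L \<Longrightarrow> p x = \<zero>\<^bsub>H\<^esub> \<longleftrightarrow> x \<in> I"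
    and s_linear: "s \<in> linear_maps H L"
    and p_s: "u \<in> carrier H \<Longrightarrow> p (s u) = u"
    and s_isotropic: "\<lbrakk>u \<in> carrier H; v \<in> carrier H\<rbrakk> \<Longrightarrow> \<omega> (s u) (s v) = 0"
    and conn_in_H: "\<lbrakk>u \<in> carrier H; v \<in> carrier H\<rbrakk> \<Longrightarrow> conn u v \<in> carrier H"
    and conn_form: "\<lbrakk>u \<in> carrier H; v \<in> carrier H; a \<in> I\<rbrakk> \<Longrightarrow>
      \<omega> (s (conn u v)) a = - \<omega> (s v) (bracket L (s u) a)"
begin

lemmas p_closed [simp] = linear_mapsD(1)[OF p_linear]
lemmas s_closed [simp] = linear_mapsD(1)[OF s_linear]
lemmas p_add = linear_mapsD(2)[OF p_linear] and p_scal = linear_mapsD(3)[OF p_linear]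
lemmas s_add = linear_mapsD(2)[OF s_linear] and s_scal = linear_mapsD(3)[OF s_linear]
lemmas p_minus = linear_maps_minus[OF vectorspace_axioms H.vectorspace_axioms p_linear]
lemmas s_minus = linear_maps_minus[OF H.vectorspace_axioms vectorspace_axioms s_linear]

declare conn_in_H [simp]

lemma p_eq_iff:
  assumes "x \<in> carrier L" "y \<in> carrier L"
  shows "p x = p y \<longleftrightarrow> x \<ominus> y \<in> I"
  using p_kernel[of "x \<ominus> y"] p_minus[OF assms] H.minus_eq_zero_iff[of "p x" "p y"] assms by simp

lemma p_eqI:
  assumes "x \<in> carrier L" "y \<in> carrier L" "\<And>a. a \<in> I \<Longrightarrow> \<omega> x a = \<omega> y a"
  shows "p x = p y"
  unfolding p_eq_iff[OF assms(1,2)]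
  by (rule I_memI) (use assms form_minus_left in auto)

lemma form_p_cong: "x \<in> carrier L \<Longrightarrow> y \<in> carrier L \<Longrightarrow> p x = p y \<Longrightarrow> a \<in> I \<Longrightarrow> \<omega> x a = \<omega> y a"
  using form_cong_I p_eq_iff by blast

lemma bracket_p_cong: "x \<in> carrier L \<Longrightarrow> y \<in> carrier L \<Longrightarrow> p x = p y \<Longrightarrow> a \<in> I \<Longrightarrow> bracket L x a = bracket L y a"
  using bracket_cong_I p_eq_iff by blast

text \<open>As I is its own orthogonal, the pairing of L/I with I induced by \<omega> has no kernel
  in L/I. Identities in H are therefore proved by pairing with elements of I.\<close>

lemma H_eqI:
  assumes "u \<in> carrier H" "v \<in> carrier H" "\<And>a. a \<in> I \<Longrightarrow> \<omega> (s u) a = \<omega> (s v) a"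
  shows "u = v"
  using p_eqI[of "s u" "s v"] assms by (simp add: p_s)

lemma fibre_part: "x \<in> carrier L \<Longrightarrow> x \<ominus> s (p x) \<in> I"
  using p_eq_iff[of x "s (p x)"] by (simp add: p_s)

text \<open>Up to the pairing with I, \<open>conn u\<close> is the negative transpose of the action
  of u on I. Flatness is then the Jacobi identity, and torsion-freeness is closedness of
  \<omega>.\<close>

lemma flat_conn: "flat_lie_algebra H conn"
proof (intro flat_lie_algebra.intro flat_lie_algebra_axioms.intro)
  show "lie_algebra H" by (rule H.lie_algebra_axioms)
  show "bilinear_map H H H conn"
  proof (rule bilinear_mapI)
    fix x y z assume c: "x \<in> carrier H" "y \<in> carrier H" "z \<in> carrier H"
    show "conn (x \<oplus>\<^bsub>H\<^esub> y) z = conn x z \<oplus>\<^bsub>H\<^esub> conn y z"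
      by (rule H_eqI) (use c in \<open>simp_all add: s_add conn_form form_add_left form_add_right bracket_add_left\<close>)
    show "conn x (y \<oplus>\<^bsub>H\<^esub> z) = conn x y \<oplus>\<^bsub>H\<^esub> conn x z"
      by (rule H_eqI) (use c in \<open>simp_all add: s_add conn_form form_add_left\<close>)
  next
    fix d x y assume c: "x \<in> carrier H" "y \<in> carrier H"
    show "conn (d \<odot>\<^bsub>H\<^esub> x) y = d \<odot>\<^bsub>H\<^esub> conn x y"
      by (rule H_eqI) (use c in \<open>simp_all add: s_scal conn_form form_scal_left form_scal_right bracket_smult_left\<close>)
    show "conn x (d \<odot>\<^bsub>H\<^esub> y) = d \<odot>\<^bsub>H\<^esub> conn x y"
      by (rule H_eqI) (use c in \<open>simp_all add: s_scal conn_form form_scal_left\<close>)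
  qed simp
next
  fix u v assume c: "u \<in> carrier H" "v \<in> carrier H"
  show "conn u v \<ominus>\<^bsub>H\<^esub> conn v u = bracket H u v"
  proof (rule H_eqI)
    fix a assume a: "a \<in> I"
    have "\<omega> (s (bracket H u v)) a = \<omega> (bracket L (s u) (s v)) a"
      by (rule form_p_cong) (use c a in \<open>simp_all add: p_s p_bracket\<close>)
    moreover have "\<omega> (bracket L a (s u)) (s v) = \<omega> (s v) (bracket L (s u) a)"
      unfolding bracket_anticomm[OF I_carrier[OF a] s_closed[OF c(1)]]
      using a c form_antisym[of "s v" "bracket L (s u) a"] by (simp add: form_neg_left)
    moreover have "\<omega> (bracket L (s v) a) (s u) = - \<omega> (s u) (bracket L (s v) a)"
      by (rule form_antisym) (use a c in auto)
    ultimately show "\<omega> (s (conn u v \<ominus>\<^bsub>H\<^esub> conn v u)) a = \<omega> (s (bracket H u v)) a"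
      using form_closed[of "s u" "s v" a] c a by (simp add: s_minus form_minus_left conn_form algebra_simps)
  qed (use c in simp_all)
next
  fix u v w assume c: "u \<in> carrier H" "v \<in> carrier H" "w \<in> carrier H"
  show "conn u (conn v w) \<ominus>\<^bsub>H\<^esub> conn v (conn u w) = conn (bracket H u v) w"
  proof (rule H_eqI)
    fix a assume a: "a \<in> I"
    have 1: "bracket L (s (bracket H u v)) a = bracket L (bracket L (s u) (s v)) a"
      by (rule bracket_p_cong) (use c a in \<open>simp_all add: p_s p_bracket\<close>)
    have 2: "bracket L (bracket L (s u) (s v)) a = bracket L (s u) (bracket L (s v) a) \<ominus> bracket L (s v) (bracket L (s u) a)"
      by (rule bracket_bracket) (use a c in simp_all)
    have "\<omega> (s (conn u' (conn v' w))) a = \<omega> (s w) (bracket L (s v') (bracket L (s u') a))"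
      if "u' \<in> carrier H" "v' \<in> carrier H" for u' v'
      using that a c I_ideal by (simp add: conn_form)
    then show "\<omega> (s (conn u (conn v w) \<ominus>\<^bsub>H\<^esub> conn v (conn u w))) a = \<omega> (s (conn (bracket H u v) w)) a"
      using c a by (simp add: s_minus form_minus_left conn_form 1 2 form_minus_right)
  qed (use c in simp_all)
qed

text \<open>Only the I-component z - s (p z) pairs nontrivially with the isotropic image of s, and
  on I the defining equation of the connection applies. This expresses the connection by brackets of
  L for an arbitrary z.\<close>

lemma form_conn:
  assumes z: "z \<in> carrier L" and u: "u \<in> carrier H" and x: "x \<in> carrier H"
  shows "\<omega> z (s (conn u x)) = \<omega> (bracket L (s u) (s (p z))) (s x) - \<omega> (bracket L (s u) z) (s x)"
proof -
  let ?a = "z \<ominus> s (p z)"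
  have a: "?a \<in> I" using fibre_part[OF z] .
  have "\<omega> z (s (conn u x)) = \<omega> ?a (s (conn u x))"
    using assms by (simp add: form_minus_left s_isotropic)
  also have "\<dots> = - \<omega> (s (conn u x)) ?a" by (rule form_antisym) (use assms in simp_all)
  also have "\<dots> = \<omega> (s x) (bracket L (s u) ?a)" using conn_form[OF u x a] by simp
  also have "\<dots> = - \<omega> (bracket L (s u) ?a) (s x)" by (rule form_antisym) (use assms in simp_all)
  finally show ?thesis using assms by (simp add: bracket_minus_right form_minus_left)
qed

text \<open>Pairing with s w sees only the component of [s u, s v] in I, since the image of s is
  isotropic; so this agrees with the projected bracket in \<open>extension_cocycle\<close>.\<close>

definition cocycle :: "'b \<Rightarrow> 'b \<Rightarrow> 'b \<Rightarrow> 'k" where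
  "cocycle = (\<lambda>u\<in>carrier H. \<lambda>v\<in>carrier H. \<lambda>w\<in>carrier H. \<omega> (bracket L (s u) (s v)) (s w))"

lemma cocycle_in: "cocycle \<in> lagrangian_cocycles2 H conn"
  unfolding cocycle_def
proof (rule flat_lie_algebra.cocycle_restrict[OF flat_conn])
  show "cocycle_conditions H conn (\<lambda>u v w. \<omega> (bracket L (s u) (s v)) (s w))"
    unfolding cocycle_conditions_def
  proof (intro conjI ballI)
    fix u v assume c: "u \<in> carrier H" "v \<in> carrier H"
    show "(\<lambda>w. \<omega> (bracket L (s u) (s v)) (s w)) \<in> linear_maps H scalars"
      by (rule linear_maps_compose[OF s_linear form_linear_right]) (use c in simp)
    show "(\<lambda>w. \<omega> (bracket L (s u) (s w)) (s v)) \<in> linear_maps H scalars"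
      by (rule linear_maps_compose[OF linear_maps_compose[OF s_linear bracket_right_linear] form_linear_left])
        (use c in simp_all)
    show "(\<lambda>w. \<omega> (bracket L (s w) (s u)) (s v)) \<in> linear_maps H scalars"
      by (rule linear_maps_compose[OF linear_maps_compose[OF s_linear bracket_left_linear] form_linear_left])
        (use c in simp_all)
    show "\<omega> (bracket L (s u) (s u)) (s v) = 0" using c by (simp add: bracket_alternating)
  next
    fix u v w assume c: "u \<in> carrier H" "v \<in> carrier H" "w \<in> carrier H"
    show "\<omega> (bracket L (s u) (s v)) (s w) + \<omega> (bracket L (s w) (s u)) (s v) + \<omega> (bracket L (s v) (s w)) (s u) = 0"
      using form_closed c by simp
  next
    fix u v w x assume c: "u \<in> carrier H" "v \<in> carrier H" "w \<in> carrier H" "x \<in> carrier H"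
    let ?a = "\<lambda>u v w. \<omega> (bracket L (s u) (s v)) (s w)"
    \<comment> \<open>Each connection term becomes a term with a bracket of H, cancelling one of the
      last three summands of the cocycle identity, plus a double bracket in L. The three double
      brackets add up to zero by Jacobi.\<close>
    have conn: "?a v w (conn u x) = ?a u (bracket H v w) x - \<omega> (bracket L (s u) (bracket L (s v) (s w))) (s x)"
      if "u \<in> carrier H" "v \<in> carrier H" "w \<in> carrier H" for u v w
      using form_conn[of "bracket L (s v) (s w)" u x] that c by (simp add: p_bracket p_s)
    have anti: "?a u v x = - ?a v u x" if "u \<in> carrier H" "v \<in> carrier H" for u v
      unfolding bracket_anticomm[OF s_closed[OF that(1)] s_closed[OF that(2)]]
      by (rule form_neg_left) (use that c in simp_all)
    have "\<omega> (bracket L (bracket L (s u) (s v)) (s w)) (s x) =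
      \<omega> (bracket L (s u) (bracket L (s v) (s w))) (s x) - \<omega> (bracket L (s v) (bracket L (s u) (s w))) (s x)"
      using c by (simp add: bracket_bracket form_minus_left)
    moreover have "\<omega> (bracket L (bracket L (s u) (s v)) (s w)) (s x) = - \<omega> (bracket L (s w) (bracket L (s u) (s v))) (s x)"
    proof -
      have *: "bracket L (s u) (s v) \<in> carrier L" using c by simp
      show ?thesis
        unfolding bracket_anticomm[OF * s_closed[OF c(3)]]
        by (rule form_neg_left) (use c in simp_all)
    qed
    ultimately have "\<omega> (bracket L (s w) (bracket L (s u) (s v))) (s x) =
      \<omega> (bracket L (s v) (bracket L (s u) (s w))) (s x) - \<omega> (bracket L (s u) (bracket L (s v) (s w))) (s x)"
      by (simp add: minus_equation_iff[of "\<omega> (bracket L (s w) (bracket L (s u) (s v))) (s x)"])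
    then show "- ?a v w (conn u x) + ?a u w (conn v x) - ?a u v (conn w x)
        - ?a (bracket H u v) w x + ?a (bracket H u w) v x - ?a (bracket H v w) u x = 0"
      using c anti[of "bracket H u v" w] anti[of "bracket H u w" v] anti[of "bracket H v w" u]
      by (simp add: conn)
  qed
qed

text \<open>The second component is the I-part of x, seen through \<omega> as a linear form on
  H.\<close>

definition chart :: "'a \<Rightarrow> 'b \<times> ('b \<Rightarrow> 'k)" where
  "chart x = (p x, \<lambda>w\<in>carrier H. \<omega> x (s w))"

text \<open>Brackets and form are compared by expanding [x - s (p x), y - s (p y)] = 0 and its
  analogue for \<omega>, which hold because I is abelian and isotropic. Surjectivity onto the dual
  part is representability of functionals by \<omega>.\<close>

lemma chart_lie_iso: "chart \<in> lie_iso L (extension_algebra H conn cocycle)" (is "_ \<in> lie_iso L ?G")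
  and chart_form: "x \<in> carrier L \<Longrightarrow> y \<in> carrier L \<Longrightarrow> extension_form (chart x) (chart y) = \<omega> x y"
  and chart_ideal: "chart ` I = {\<zero>\<^bsub>H\<^esub>} \<times> carrier (dual_space H)"
proof -
  have dual: "(\<lambda>w\<in>carrier H. \<omega> x (s w)) \<in> carrier (dual_space H)" if "x \<in> carrier L" for x
    by (rule dual_spaceI[OF H.vectorspace_axioms linear_maps_compose[OF s_linear form_linear_right[OF that]]])
  have lin: "chart \<in> linear_maps L ?G"
    by (rule linear_mapsI)
      (simp_all add: chart_def dual p_add p_scal form_add_left form_scal_left fun_eq_iff)
  have inj: "inj_on chart (carrier L)"
  proof (rule inj_onI)
    fix x y assume c: "x \<in> carrier L" "y \<in> carrier L" and eq: "chart x = chart y"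
    let ?d = "x \<ominus> y"
    have "p x = p y" using eq by (simp add: chart_def)
    then have d: "?d \<in> I" using p_eq_iff c by blast
    have ds: "\<omega> ?d (s w) = 0" if w: "w \<in> carrier H" for w
    proof -
      have "\<omega> x (s w) = \<omega> y (s w)"
        using fun_cong[OF arg_cong[OF eq, of snd], of w] w by (simp add: chart_def)
      then show ?thesis using form_minus_left c w by simp
    qed
    have "?d = \<zero>"
    proof (rule form_nondegenerate)
      fix z assume z: "z \<in> carrier L"
      have "\<omega> ?d (z \<ominus> s (p z)) = 0" using form_I[OF d fibre_part[OF z]] .
      then show "\<omega> ?d z = 0" using ds[of "p z"] z c by (simp add: form_minus_right)
    qed (use c in simp)
    then show "x = y" using minus_eq_zero_iff c by blast
  qed
  have fibre: "\<exists>a\<in>I. chart a = (\<zero>\<^bsub>H\<^esub>, \<xi>)" if \<xi>: "\<xi> \<in> carrier (dual_space H)" for \<xi>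
  proof -
    \<comment> \<open>The functional \<xi> \<circ> p vanishes on I, so the vector representing it is
      orthogonal to I and hence lies in I.\<close>
    obtain a where a: "a \<in> carrier L" "\<And>y. y \<in> carrier L \<Longrightarrow> \<xi> (p y) = \<omega> a y"
      using functional_representation[OF linear_maps_compose[OF p_linear dual_spaceD(1)[OF \<xi>]]] by blast
    have aI: "a \<in> I"
    proof (rule I_memI[OF a(1)])
      fix b assume b: "b \<in> I"
      then have "p b = \<zero>\<^bsub>H\<^esub>" using p_kernel by simp
      then show "\<omega> a b = 0"
        using a(2)[of b] b H.functional_neg(2)[OF dual_spaceD(1)[OF \<xi>], of "\<zero>\<^bsub>H\<^esub>"] by simp
    qed
    have "(\<lambda>w\<in>carrier H. \<omega> a (s w)) = (\<lambda>w\<in>carrier H. \<xi> w)"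
      by (rule restrict_ext) (simp flip: a(2) add: p_s)
    then have "chart a = (\<zero>\<^bsub>H\<^esub>, \<xi>)"
      using p_kernel[OF a(1)] aI dual_spaceD(2)[OF \<xi>] by (simp add: chart_def)
    then show ?thesis using aI by blast
  qed
  show ideal: "chart ` I = {\<zero>\<^bsub>H\<^esub>} \<times> carrier (dual_space H)"
  proof
    show "chart ` I \<subseteq> {\<zero>\<^bsub>H\<^esub>} \<times> carrier (dual_space H)" using dual p_kernel by (auto simp: chart_def)
    show "{\<zero>\<^bsub>H\<^esub>} \<times> carrier (dual_space H) \<subseteq> chart ` I"
    proof
      fix z assume "z \<in> {\<zero>\<^bsub>H\<^esub>} \<times> carrier (dual_space H)"
      then obtain \<xi> where "\<xi> \<in> carrier (dual_space H)" "z = (\<zero>\<^bsub>H\<^esub>, \<xi>)" by blast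
      then show "z \<in> chart ` I" using fibre by (metis imageI)
    qed
  qed
  have surj: "chart ` carrier L = carrier ?G"
  proof
    show "carrier ?G \<subseteq> chart ` carrier L"
    proof
      fix z assume "z \<in> carrier ?G"
      then obtain u \<xi> where z: "z = (u, \<xi>)" "u \<in> carrier H" "\<xi> \<in> carrier (dual_space H)" by auto
      obtain a where a: "a \<in> I" "chart a = (\<zero>\<^bsub>H\<^esub>, \<xi>)" using fibre z(3) by blast
      have "chart (a \<oplus> s u) = chart a \<oplus>\<^bsub>?G\<^esub> chart (s u)"
        using linear_mapsD(2)[OF lin, of a "s u"] a z by simp
      also have "chart (s u) = (u, \<lambda>w\<in>carrier H. 0)"
        using z by (simp add: chart_def p_s s_isotropic cong: restrict_cong)
      finally have "chart (a \<oplus> s u) = z"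
        using a z dual_spaceD(2)[OF z(3)] by (simp cong: restrict_cong)
      then show "z \<in> chart ` carrier L" using a z by (metis I_carrier M.a_closed imageI s_closed)
    qed
  qed (use linear_mapsD(1)[OF lin] in blast)
  have br: "chart (bracket L x y) = bracket ?G (chart x) (chart y)" if c: "x \<in> carrier L" "y \<in> carrier L" for x y
  proof -
    have "\<omega> (bracket L x y) (s w) = cocycle (p x) (p y) w - \<omega> y (s (conn (p x) w)) + \<omega> x (s (conn (p y) w))"
      if w: "w \<in> carrier H" for w
    proof -
      have "bracket L (x \<ominus> s (p x)) (y \<ominus> s (p y)) = \<zero>"
        using I_abelian[OF fibre_part fibre_part] c by blast
      then have "\<omega> (bracket L (x \<ominus> s (p x)) (y \<ominus> s (p y))) (s w) = 0" using w by simp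
      then have *: "\<omega> (bracket L x y) (s w) - \<omega> (bracket L (s (p x)) y) (s w) -
        (\<omega> (bracket L x (s (p y))) (s w) - \<omega> (bracket L (s (p x)) (s (p y))) (s w)) = 0"
        using c w by (simp add: bracket_minus_left bracket_minus_right form_minus_left)
      have anti: "\<omega> (bracket L z (s (p y))) (s w) = - \<omega> (bracket L (s (p y)) z) (s w)" if z: "z \<in> carrier L" for z
        unfolding bracket_anticomm[OF z s_closed[OF p_closed[OF c(2)]]]
        by (rule form_neg_left) (use c w z in simp_all)
      have "\<omega> (bracket L x y) (s w) = \<omega> (bracket L (s (p x)) y) (s w) +
        (\<omega> (bracket L x (s (p y))) (s w) - \<omega> (bracket L (s (p x)) (s (p y))) (s w))"
        using * by (simp add: algebra_simps)
      then show ?thesis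
        using anti[OF c(1)] anti[of "s (p x)"] c w
        by (simp add: cocycle_def form_conn)
    qed
    then show ?thesis
      using c by (simp add: chart_def p_bracket fun_eq_iff)
  qed
  show "chart \<in> lie_iso L ?G"
    using lin inj surj br by (simp add: lie_iso_def bij_betw_def)
  show "extension_form (chart x) (chart y) = \<omega> x y" if c: "x \<in> carrier L" "y \<in> carrier L"
  proof -
    have "\<omega> (x \<ominus> s (p x)) (y \<ominus> s (p y)) = 0" using form_I fibre_part c by blast
    then have "\<omega> x y = \<omega> x (s (p y)) + \<omega> (s (p x)) y"
      using c by (simp add: form_minus_left form_minus_right s_isotropic diff_eq_eq)
    moreover have "\<omega> (s (p x)) y = - \<omega> y (s (p x))" by (rule form_antisym) (use c in simp_all)
    ultimately show ?thesis using c by (simp add: chart_def)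
  qed
qed

end

text \<open>One chart composed with the inverse of the other is a symplectic isomorphism of the two
  extension algebras that respects the dual parts and induces the identity on H. Its off-diagonal
  block is the required cochain.\<close>

lemma splitting_cocycles_cohomologous:
  assumes "lagrangian_splitting L \<omega> I H p s conn" "lagrangian_splitting L \<omega> I H p s' conn"
  shows "(lagrangian_splitting.cocycle L \<omega> H s, lagrangian_splitting.cocycle L \<omega> H s') \<in> cohomologous H conn"
proof -
  interpret A: lagrangian_splitting L \<omega> I H p s conn using assms(1) .
  interpret B: lagrangian_splitting L \<omega> I H p s' conn using assms(2) .
  interpret flat_lie_algebra H conn using A.flat_conn .
  let ?G = "extension_algebra H conn A.cocycle" and ?G' = "extension_algebra H conn B.cocycle"
  let ?g = "inv_into (carrier L) A.chart"
  let ?F = "\<lambda>x. B.chart (?g x)"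
  note bij = lie_isoD(2)[OF A.chart_lie_iso]
  have F: "?F \<in> lie_iso ?G ?G'"
    using lie_iso_compose[OF lie_iso_inv[OF A.lie_algebra_axioms A.chart_lie_iso] B.chart_lie_iso] .
  have g: "?g x \<in> carrier L" "A.chart (?g x) = x" if "x \<in> carrier ?G" for x
    using bij_betw_imp_surj_on[OF bij] that by (auto simp: inv_into_into f_inv_into_f simp del: extension_algebra_simps)
  have form: "extension_form (?F x) (?F y) = extension_form x y" if "x \<in> carrier ?G" "y \<in> carrier ?G" for x y
    using A.chart_form[OF g(1)[OF that(1)] g(1)[OF that(2)]] B.chart_form[OF g(1)[OF that(1)] g(1)[OF that(2)]]
      g(2)[OF that(1)] g(2)[OF that(2)] by simp
  have "?g ` ({\<zero>\<^bsub>H\<^esub>} \<times> carrier (dual_space H)) = I"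
    unfolding A.chart_ideal[symmetric]
    using inv_into_image_cancel[OF bij_betw_imp_inj_on[OF bij], of I] A.subspaceD(1)[OF A.I_subspace]
    by (simp add: image_image)
  then have fibre: "?F ` ({\<zero>\<^bsub>H\<^esub>} \<times> carrier (dual_space H)) = {\<zero>\<^bsub>H\<^esub>} \<times> carrier (dual_space H)"
    unfolding image_image[symmetric, of B.chart ?g] using B.chart_ideal by simp
  have id: "fst (?F (u, \<lambda>w\<in>carrier H. 0)) = u" if "u \<in> carrier H" for u
  proof -
    have "(u, \<lambda>w\<in>carrier H. 0) \<in> carrier ?G"
      using that dual_space_zero_closed[OF A.H.vectorspace_axioms] by simp
    from g(2)[OF this] show ?thesis by (simp add: A.chart_def B.chart_def)
  qed
  have "\<exists>\<phi>\<in>lagrangian_cochains1 H. \<forall>u\<in>carrier H. \<forall>v\<in>carrier H. \<forall>w\<in>carrier H.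
      A.cocycle u v w - B.cocycle u v w = \<phi> u (conn v w) - \<phi> v (conn u w) - \<phi> (bracket H u v) w"
    using extension_iso_imp_flat_iso(3)[OF A.flat_conn A.flat_conn A.cocycle_in B.cocycle_in F form fibre]
    by (simp add: id cong: ball_cong bex_cong)
  then have "(B.cocycle, A.cocycle) \<in> cohomologous H conn"
    unfolding cohomologous_iff using A.cocycle_in B.cocycle_in by blast
  then show ?thesis by (rule cohomologous_sym)
qed

section \<open>The extension triple\<close>

context symplectic_with_lagrangian
begin

abbreviation Q :: "('k, 'a set) lie" where "Q \<equiv> quotient_lie L I"

abbreviation proj :: "'a \<Rightarrow> 'a set" where "proj x \<equiv> I +>\<^bsub>L\<^esub> x"

lemma mem_proj:
  assumes x: "x \<in> carrier L"
  shows "y \<in> proj x \<longleftrightarrow> y \<in> carrier L \<and> y \<ominus> x \<in> I"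
proof
  assume "y \<in> proj x"
  then obtain h where h: "h \<in> I" "y = h \<oplus> x" by (auto simp: a_r_coset_def')
  then show "y \<in> carrier L \<and> y \<ominus> x \<in> I" using x minus_add_cancel(2)[of h x] by simp
next
  assume y: "y \<in> carrier L \<and> y \<ominus> x \<in> I"
  then have "y = (y \<ominus> x) \<oplus> x" using x minus_add_cancel(1) by simp
  then show "y \<in> proj x" using y by (auto simp: a_r_coset_def')
qed

lemma self_mem_proj: "x \<in> carrier L \<Longrightarrow> x \<in> proj x"
  using mem_proj subspaceD(2)[OF I_subspace] by (simp add: a_minus_def M.r_neg)

lemma minus_swap: "x \<in> carrier L \<Longrightarrow> y \<in> carrier L \<Longrightarrow> x \<ominus> y \<in> I \<Longrightarrow> y \<ominus> x \<in> I"
  using subspace_neg[OF I_subspace, of "x \<ominus> y"] by (simp add: a_minus_def M.minus_add M.a_comm)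

lemma minus_trans:
  assumes "x \<in> carrier L" "y \<in> carrier L" "z \<in> carrier L" "x \<ominus> y \<in> I" "y \<ominus> z \<in> I"
  shows "x \<ominus> z \<in> I"
proof -
  have "x \<ominus> z = (x \<ominus> y) \<oplus> (y \<ominus> z)"
    using assms(1-3) by (simp add: a_minus_def M.a_ac M.r_neg1 M.r_neg2)
  then show ?thesis using subspaceD(3)[OF I_subspace assms(4,5)] by simp
qed

lemma proj_eq_iff:
  assumes "x \<in> carrier L" "y \<in> carrier L"
  shows "proj x = proj y \<longleftrightarrow> x \<ominus> y \<in> I"
proof
  assume "proj x = proj y"
  then show "x \<ominus> y \<in> I" using self_mem_proj[OF assms(1)] mem_proj[OF assms(2)] by simp
next
  assume xy: "x \<ominus> y \<in> I"
  then show "proj x = proj y"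
    using mem_proj[OF assms(1)] mem_proj[OF assms(2)] minus_trans minus_swap assms by blast
qed

lemma proj_zero: "proj \<zero> = I"
proof -
  have "x \<ominus> \<zero> = x" if "x \<in> carrier L" for x using that minus_add_cancel(1)[of x \<zero>] by simp
  then show ?thesis using mem_proj[OF M.zero_closed] by (metis I_carrier M.zero_closed subsetI subset_antisym)
qed

lemma Q_carrier: "carrier Q = proj ` carrier L"
  by (auto simp: quotient_lie_def A_RCOSETS_def')

lemma Q_zero: "\<zero>\<^bsub>Q\<^esub> = I"
  by (simp add: quotient_lie_def)

lemma Q_add:
  assumes x: "x \<in> carrier L" and y: "y \<in> carrier L"
  shows "proj x \<oplus>\<^bsub>Q\<^esub> proj y = proj (x \<oplus> y)"
proof -
  have "z \<in> proj x <+>\<^bsub>L\<^esub> proj y \<longleftrightarrow> z \<in> proj (x \<oplus> y)" for z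
  proof
    assume "z \<in> proj x <+>\<^bsub>L\<^esub> proj y"
    then obtain h k where *: "h \<in> carrier L" "h \<ominus> x \<in> I" "k \<in> carrier L" "k \<ominus> y \<in> I" "z = h \<oplus> k"
      using mem_proj x y by (auto simp: set_add_def')
    have "z \<ominus> (x \<oplus> y) = (h \<ominus> x) \<oplus> (k \<ominus> y)"
      using * x y by (simp add: a_minus_def M.minus_add M.a_ac)
    then show "z \<in> proj (x \<oplus> y)" using * x y mem_proj subspaceD(3)[OF I_subspace] by simp
  next
    assume "z \<in> proj (x \<oplus> y)"
    then obtain h where h: "h \<in> I" "z = h \<oplus> (x \<oplus> y)" by (auto simp: a_r_coset_def')
    then have "z = (h \<oplus> x) \<oplus> y" using x y by (simp add: M.a_assoc)
    moreover have "h \<oplus> x \<in> proj x" using h by (auto simp: a_r_coset_def')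
    ultimately show "z \<in> proj x <+>\<^bsub>L\<^esub> proj y" using self_mem_proj[OF y] by (auto simp: set_add_def')
  qed
  then show ?thesis by (auto simp: quotient_lie_def)
qed

lemma Q_scal:
  assumes x: "x \<in> carrier L"
  shows "c \<odot>\<^bsub>Q\<^esub> proj x = proj (c \<odot> x)"
proof -
  have "proj (c \<odot> z) = proj (c \<odot> x)" if "z \<in> proj x" for z
  proof -
    have z: "z \<in> carrier L" "z \<ominus> x \<in> I" using that mem_proj x by auto
    have "c \<odot> z \<ominus> c \<odot> x = c \<odot> (z \<ominus> x)"
      using z x smult_r_distr[of c z "\<ominus> x"] by (simp add: a_minus_def smult_r_minus)
    then show ?thesis using proj_eq_iff z x subspace_scal[OF I_subspace] by simp
  qed
  then have "(\<Union>z\<in>proj x. proj (c \<odot> z)) = (\<Union>z\<in>proj x. proj (c \<odot> x))" by (rule SUP_cong[OF refl])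
  also have "\<dots> = proj (c \<odot> x)" using self_mem_proj[OF x] by blast
  finally show ?thesis by (simp add: quotient_lie_def)
qed

text \<open>All members of the union defining the bracket coincide: another choice of
  representatives changes the bracket by an element of the ideal.\<close>

lemma Q_bracket:
  assumes x: "x \<in> carrier L" and y: "y \<in> carrier L"
  shows "bracket Q (proj x) (proj y) = proj (bracket L x y)"
proof -
  have "proj (bracket L z w) = proj (bracket L x y)" if "z \<in> proj x" "w \<in> proj y" for z w
  proof -
    have z: "z \<in> carrier L" "z \<ominus> x \<in> I" and w: "w \<in> carrier L" "w \<ominus> y \<in> I" using that mem_proj x y by auto
    have "bracket L z w \<ominus> bracket L x w \<in> I"
    proof -
      have "bracket L z w \<ominus> bracket L x w = bracket L (z \<ominus> x) w" using z w x bracket_minus_left by simp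
      also have "\<dots> = \<ominus> bracket L w (z \<ominus> x)" by (rule bracket_anticomm) (use z w x in simp_all)
      finally show ?thesis using subspace_neg[OF I_subspace I_ideal[OF w(1) z(2)]] by simp
    qed
    moreover have "bracket L x w \<ominus> bracket L x y \<in> I"
      using bracket_minus_right[OF w(1) y x] I_ideal[OF x w(2)] by simp
    ultimately have "bracket L z w \<ominus> bracket L x y \<in> I"
      using minus_trans[of "bracket L z w" "bracket L x w" "bracket L x y"] z w x y by simp
    then show ?thesis using proj_eq_iff z w x y by simp
  qed
  then have "(\<Union>z\<in>proj x. \<Union>w\<in>proj y. proj (bracket L z w)) = (\<Union>z\<in>proj x. \<Union>w\<in>proj y. proj (bracket L x y))"
    by (intro SUP_cong[OF refl])
  also have "\<dots> = proj (bracket L x y)" using self_mem_proj[OF x] self_mem_proj[OF y] by blast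
  finally show ?thesis by (simp add: quotient_lie_def)
qed

lemma proj_linear: "proj \<in> linear_maps L Q"
  by (rule linear_mapsI) (simp_all add: Q_carrier Q_add Q_scal)

lemma lie_algebra_Q: "lie_algebra Q"
  by (rule lie_algebra_image[OF lie_algebra_axioms proj_linear])
    (simp_all add: Q_carrier Q_bracket Q_zero proj_zero)

lemma proj_kernel: "x \<in> carrier L \<Longrightarrow> proj x = \<zero>\<^bsub>Q\<^esub> \<longleftrightarrow> x \<in> I"
  using proj_eq_iff[of x \<zero>] minus_add_cancel(1)[of x \<zero>] by (simp add: Q_zero proj_zero)

lemma lie_dim_Q: "lie_dim L = 2 * lie_dim Q"
proof -
  interpret Q: lie_algebra Q using lie_algebra_Q .
  have "{x \<in> carrier L. proj x = \<zero>\<^bsub>Q\<^esub>} = I" using proj_kernel I_carrier by blast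
  then have "lie_dim L = lie_dim Q + rk I"
    using linear_maps_rank_nullity[OF vectorspace_axioms Q.vectorspace_axioms fin_dim proj_linear] Q_carrier by simp
  then show ?thesis using rk_lagrangian[OF I_subspace I_orth] by simp
qed

abbreviation conn :: "'a set \<Rightarrow> 'a set \<Rightarrow> 'a set" where "conn \<equiv> quotient_connection L \<omega> I"

text \<open>The description in \<open>quotient_connection\<close> has exactly one solution.
  Independence of the lifts holds because [u,a] depends only on the coset of u and lies in I, where
  pairing depends only on the coset of v; uniqueness holds because I is its own orthogonal.\<close>

lemma quotient_connection_proj:
  assumes x: "x \<in> carrier L" and y: "y \<in> carrier L"
  shows "conn (proj x) (proj y) \<in> carrier Q"
    and "w \<in> conn (proj x) (proj y) \<Longrightarrow> a \<in> I \<Longrightarrow> \<omega> w a = - \<omega> y (bracket L x a)"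
proof -
  let ?P = "\<lambda>W. W \<in> carrier Q \<and> (\<forall>u\<in>proj x. \<forall>v\<in>proj y. \<forall>w\<in>W. \<forall>a\<in>I. \<omega> w a = - \<omega> v (bracket L u a))"
  \<comment> \<open>The prescribed values on I are extended to a functional on all of L in order to
    represent it by a vector z; the values on I determine the coset of z.\<close>
  have "(\<lambda>t. - \<omega> y (bracket L x t)) \<in> linear_maps L scalars"
    using linear_maps_scalars_scale[OF linear_maps_compose[OF bracket_right_linear[OF x] form_linear_right[OF y]], of "-1"]
    by simp
  then obtain z where z: "z \<in> carrier L" "\<And>t. t \<in> carrier L \<Longrightarrow> - \<omega> y (bracket L x t) = \<omega> z t"
    using functional_representation by blast
  have "?P (proj z)"
  proof (intro conjI ballI)
    show "proj z \<in> carrier Q" using z by (simp add: Q_carrier)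
    fix u v w a assume *: "u \<in> proj x" "v \<in> proj y" "w \<in> proj z" and a: "a \<in> I"
    have c: "u \<in> carrier L" "u \<ominus> x \<in> I" "v \<in> carrier L" "v \<ominus> y \<in> I" "w \<in> carrier L" "w \<ominus> z \<in> I"
      using * mem_proj x y z by auto
    have "\<omega> v (bracket L x a) = \<omega> y (bracket L x a)"
      using form_cong_I c y I_ideal[OF x a] by blast
    then show "\<omega> w a = - \<omega> v (bracket L u a)"
      using bracket_cong_I[OF c(1) x c(2) a] form_cong_I[OF c(5) z(1) c(6) a] z(2)[of a] a by simp
  qed
  moreover have "W = proj z" if W: "?P W" for W
  proof -
    obtain z' where z': "z' \<in> carrier L" "W = proj z'" using W by (auto simp: Q_carrier)
    have "\<omega> z' a = \<omega> z a" if a: "a \<in> I" for a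
    proof -
      have "\<omega> z' a = - \<omega> y (bracket L x a)"
        using W a z'(2) self_mem_proj[OF x] self_mem_proj[OF y] self_mem_proj[OF z'(1)] by blast
      then show ?thesis using z(2)[of a] a by simp
    qed
    then have "z' \<ominus> z \<in> I" using z z' form_minus_left by (intro I_memI) auto
    then show ?thesis using proj_eq_iff z z' by simp
  qed
  ultimately have P: "?P (conn (proj x) (proj y))"
    unfolding quotient_connection_def by (rule theI)
  then show "conn (proj x) (proj y) \<in> carrier Q" by blast
  show "\<omega> w a = - \<omega> y (bracket L x a)" if "w \<in> conn (proj x) (proj y)" "a \<in> I"
    using P that self_mem_proj x y by blast
qed

context
  fixes N
  assumes N: "lagrangian_complement L \<omega> I N"
begin

lemma N_subspace: "subspace class_ring N L"
  and N_orth: "orth N = N" and I_Int_N: "I \<inter> N = {\<zero>}" and sum_I_N: "submodule_sum I N = carrier L"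
  using N by (auto simp: lagrangian_complement_def lagrangian_subspace_def set_add_eq_submodule_sum)

lemma N_carrier: "m \<in> N \<Longrightarrow> m \<in> carrier L"
  using subspaceD(1)[OF N_subspace] by blast

lemma proj_Int_N: "m \<in> N \<Longrightarrow> proj m \<inter> N = {m}"
proof -
  assume m: "m \<in> N"
  have "n = m" if "n \<in> proj m" "n \<in> N" for n
  proof -
    have "n \<ominus> m \<in> I \<inter> N" using that m mem_proj N_carrier subspace_minus[OF N_subspace] by blast
    then show ?thesis using I_Int_N minus_eq_zero_iff N_carrier that m by blast
  qed
  then show ?thesis using m self_mem_proj N_carrier by blast
qed

abbreviation lift :: "'a set \<Rightarrow> 'a" where "lift U \<equiv> the_elem (U \<inter> N)"

lemma lift_proj: "m \<in> N \<Longrightarrow> lift (proj m) = m"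
  using proj_Int_N by simp

lemma Q_elim:
  assumes "U \<in> carrier Q"
  obtains m where "m \<in> N" "U = proj m"
proof -
  obtain x where x: "x \<in> carrier L" "U = proj x" using assms by (auto simp: Q_carrier)
  then have "x \<in> submodule_sum I N" using sum_I_N by simp
  then obtain i m where *: "i \<in> I" "m \<in> N" "x = i \<oplus> m" by (rule subspace_sumE)
  then have "proj x = proj m"
    using proj_eq_iff[of x m] x N_carrier minus_add_cancel(2)[of i m] by simp
  then show thesis using that * x by blast
qed

lemma Q_elim2:
  assumes "U \<in> carrier Q" "V \<in> carrier Q"
  obtains m n where "m \<in> N" "U = proj m" "n \<in> N" "V = proj n"
proof -
  obtain m where "m \<in> N" "U = proj m" by (rule Q_elim[OF assms(1)])
  moreover obtain n where "n \<in> N" "V = proj n" by (rule Q_elim[OF assms(2)])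
  ultimately show thesis by (rule that)
qed

lemma lagrangian_splitting_quotient: "lagrangian_splitting L \<omega> I Q proj lift conn"
proof (intro lagrangian_splitting.intro lagrangian_splitting_axioms.intro)
  show "symplectic_with_lagrangian L \<omega> I" by (rule symplectic_with_lagrangian_axioms)
  show "lie_algebra Q" by (rule lie_algebra_Q)
  show "proj \<in> linear_maps L Q" by (rule proj_linear)
  show "\<And>x y. x \<in> carrier L \<Longrightarrow> y \<in> carrier L \<Longrightarrow> proj (bracket L x y) = bracket Q (proj x) (proj y)"
    by (simp add: Q_bracket)
  show "\<And>x. x \<in> carrier L \<Longrightarrow> (proj x = \<zero>\<^bsub>Q\<^esub>) = (x \<in> I)" by (rule proj_kernel)
  show "lift \<in> linear_maps Q L"
  proof (rule linear_mapsI)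
    fix U assume "U \<in> carrier Q"
    then obtain m where "m \<in> N" "U = proj m" by (rule Q_elim)
    then show "lift U \<in> carrier L" using lift_proj N_carrier by simp
  next
    fix U V assume "U \<in> carrier Q" "V \<in> carrier Q"
    then obtain m n where "m \<in> N" "U = proj m" "n \<in> N" "V = proj n" by (rule Q_elim2)
    then show "lift (U \<oplus>\<^bsub>Q\<^esub> V) = lift U \<oplus> lift V"
      using lift_proj N_carrier subspaceD(3)[OF N_subspace] by (simp add: Q_add)
  next
    fix c U assume "U \<in> carrier Q"
    then obtain m where "m \<in> N" "U = proj m" by (rule Q_elim)
    then show "lift (c \<odot>\<^bsub>Q\<^esub> U) = c \<odot> lift U"
      using lift_proj N_carrier subspace_scal[OF N_subspace] by (simp add: Q_scal)
  qed
  show "proj (lift U) = U" if U: "U \<in> carrier Q" for U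
  proof -
    obtain m where "m \<in> N" "U = proj m" by (rule Q_elim[OF U])
    then show ?thesis using lift_proj by simp
  qed
  show "\<omega> (lift U) (lift V) = 0" if UV: "U \<in> carrier Q" "V \<in> carrier Q" for U V
  proof -
    obtain m n where "m \<in> N" "U = proj m" "n \<in> N" "V = proj n" by (rule Q_elim2[OF UV])
    then show ?thesis using lift_proj orthD(1)[of m N n] N_orth by simp
  qed
  show "conn U V \<in> carrier Q" if UV: "U \<in> carrier Q" "V \<in> carrier Q" for U V
  proof -
    obtain m n where "m \<in> N" "U = proj m" "n \<in> N" "V = proj n" by (rule Q_elim2[OF UV])
    then show ?thesis using quotient_connection_proj(1) N_carrier by simp
  qed
  show "\<omega> (lift (conn U V)) a = - \<omega> (lift V) (bracket L (lift U) a)"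
    if UV: "U \<in> carrier Q" "V \<in> carrier Q" and a: "a \<in> I" for U V a
  proof -
    obtain m n where mn: "m \<in> N" "U = proj m" "n \<in> N" "V = proj n" by (rule Q_elim2[OF UV])
    then have "conn U V \<in> carrier Q" using quotient_connection_proj(1) N_carrier by simp
    then obtain k where k: "k \<in> N" "conn U V = proj k" by (rule Q_elim)
    then have "k \<in> conn U V" using self_mem_proj N_carrier by simp
    then show ?thesis
      using quotient_connection_proj(2)[of m n k a] mn k a lift_proj N_carrier by simp
  qed
qed

text \<open>The discarded component lies in N, which is isotropic.\<close>

lemma projection_along_form:
  assumes x: "x \<in> carrier L" and m: "m \<in> N"
  shows "\<omega> (projection_along L I N x) m = \<omega> x m"
proof -
  have "x \<in> submodule_sum I N" using x sum_I_N by simp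
  then obtain i n where *: "i \<in> I" "n \<in> N" "x = i \<oplus> n" by (rule subspace_sumE)
  have eq: "x \<ominus> i = n" using * minus_add_cancel(2)[of n i] N_carrier by (simp add: M.a_comm)
  have "projection_along L I N x = i"
    unfolding projection_along_def
  proof (rule the_equality)
    show "i \<in> I \<and> x \<ominus> i \<in> N" using * eq by simp
    fix a assume a: "a \<in> I \<and> x \<ominus> a \<in> N"
    have ac: "a \<in> carrier L" using a by simp
    have "(x \<ominus> a) \<ominus> (x \<ominus> i) \<in> N"
      by (rule subspace_minus[OF N_subspace]) (use a eq *(2) in simp_all)
    moreover have "(x \<ominus> a) \<ominus> (x \<ominus> i) = i \<ominus> a"
      by (rule minus_minus_cancel) (use x ac *(1) in simp_all)
    ultimately have "i \<ominus> a \<in> I \<inter> N" using a *(1) subspace_minus[OF I_subspace] by simp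
    then have "i \<ominus> a = \<zero>" unfolding I_Int_N by simp
    then show "a = i" using minus_eq_zero_iff[of i a] ac *(1) by simp
  qed
  moreover have "\<omega> n m = 0" using N_orth orthD(1) * m by blast
  moreover have "\<omega> x m = \<omega> i m + \<omega> n m"
    unfolding *(3) by (rule form_add_left) (use * m N_carrier in simp_all)
  ultimately show ?thesis by simp
qed

lemma extension_cocycle_eq: "extension_cocycle L \<omega> I N = lagrangian_splitting.cocycle L \<omega> Q lift"
proof -
  interpret S: lagrangian_splitting L \<omega> I Q proj lift conn using lagrangian_splitting_quotient .
  have "lift U \<in> N" if U: "U \<in> carrier Q" for U
  proof -
    obtain m where "m \<in> N" "U = proj m" by (rule Q_elim[OF U])
    then show ?thesis using lift_proj by simp
  qed
  then show ?thesis
    unfolding extension_cocycle_def S.cocycle_def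
    by (intro restrict_ext) (simp add: projection_along_form N_carrier)
qed

end

text \<open>All complements give cohomologous cocycles, so the description of
  \<open>extension_class\<close> is met by exactly one class. The extension algebra of the chosen
  cocycle is a Lie algebra as the image of L under the chart.\<close>

lemma extension_triple_properties:
  obtains \<alpha> where "flat_lie_algebra Q conn" "\<alpha> \<in> lagrangian_cocycles2 Q conn"
    "extension_class L \<omega> I = cohomologous Q conn `` {\<alpha>}"
    "symplectic_isomorphic (L, \<omega>) (extension_algebra Q conn \<alpha>, extension_form)"
    "lie_algebra (extension_algebra Q conn \<alpha>)"
proof -
  obtain N where N: "lagrangian_complement L \<omega> I N"
    using lagrangian_complement_exists I_subspace I_orth by (auto simp: lagrangian_subspace_def)
  interpret S: lagrangian_splitting L \<omega> I Q proj "lift N" conn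
    using lagrangian_splitting_quotient[OF N] .
  let ?\<alpha> = "extension_cocycle L \<omega> I N"
  have \<alpha>: "?\<alpha> = S.cocycle" using extension_cocycle_eq[OF N] .
  have "extension_class L \<omega> I = cohomologous Q conn `` {?\<alpha>}"
    unfolding extension_class_def
  proof (rule the_equality)
    show "\<exists>N'. lagrangian_complement L \<omega> I N' \<and>
      cohomologous Q conn `` {?\<alpha>} = cohomologous Q conn `` {extension_cocycle L \<omega> I N'}"
      using N by blast
    fix c assume "\<exists>N'. lagrangian_complement L \<omega> I N' \<and> c = cohomologous Q conn `` {extension_cocycle L \<omega> I N'}"
    then obtain N' where N': "lagrangian_complement L \<omega> I N'" "c = cohomologous Q conn `` {extension_cocycle L \<omega> I N'}"
      by blast
    have "(?\<alpha>, extension_cocycle L \<omega> I N') \<in> cohomologous Q conn"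
      unfolding extension_cocycle_eq[OF N] extension_cocycle_eq[OF N'(1)]
      by (rule splitting_cocycles_cohomologous[OF lagrangian_splitting_quotient[OF N] lagrangian_splitting_quotient[OF N'(1)]])
    then show "c = cohomologous Q conn `` {?\<alpha>}"
      using equiv_class_eq[OF flat_lie_algebra.equiv_cohomologous[OF S.flat_conn]] N'(2) by metis
  qed
  moreover have "symplectic_isomorphic (L, \<omega>) (extension_algebra Q conn ?\<alpha>, extension_form)"
    unfolding symplectic_isomorphic_iff \<alpha> using S.chart_lie_iso S.chart_form by blast
  moreover have "lie_algebra (extension_algebra Q conn ?\<alpha>)"
    unfolding \<alpha>
  proof (rule lie_algebra_image[OF lie_algebra_axioms])
    show "S.chart \<zero> = \<zero>\<^bsub>extension_algebra Q conn S.cocycle\<^esub>"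
      using proj_kernel[of \<zero>] subspaceD(2)[OF I_subspace] by (simp add: S.chart_def cong: restrict_cong)
  qed (use lie_isoD[OF S.chart_lie_iso] bij_betw_imp_surj_on in blast)+
  ultimately show thesis using that S.flat_conn S.cocycle_in \<alpha> by simp
qed

end

section \<open>Extension algebras are symplectic\<close>

text \<open>That the extension algebra is a Lie algebra is part of the locale; in the applications
  it is supplied by \<open>filiform\<close>, whose definition contains it.\<close>

locale symplectic_extension = flat_lie_algebra H conn + G: lie_algebra "extension_algebra H conn \<alpha>"
  for H :: "('k::field_char_0, 'b) lie" and conn and \<alpha> +
  assumes cocycle: "\<alpha> \<in> lagrangian_cocycles2 H conn"
begin

abbreviation G where "G \<equiv> extension_algebra H conn \<alpha>"

abbreviation fibre where "fibre \<equiv> {\<zero>\<^bsub>H\<^esub>} \<times> carrier (dual_space H)"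

lemmas dual_add = linear_mapsD(2)[OF dual_spaceD(1), simplified scalars_simps]
lemmas dual_scal = linear_mapsD(3)[OF dual_spaceD(1), simplified scalars_simps]
lemmas dual_diff = functional_minus[OF dual_spaceD(1)]

lemma dual_zero: "\<xi> \<in> carrier (dual_space H) \<Longrightarrow> \<xi> \<zero>\<^bsub>H\<^esub> = 0"
  using functional_neg(2)[OF dual_spaceD(1), of \<xi> "\<zero>\<^bsub>H\<^esub>"] by simp

lemma dual_separates:
  assumes "u \<in> carrier H" "\<And>\<xi>. \<xi> \<in> carrier (dual_space H) \<Longrightarrow> \<xi> u = 0"
  shows "u = \<zero>\<^bsub>H\<^esub>"
proof (rule ccontr)
  assume "u \<noteq> \<zero>\<^bsub>H\<^esub>"
  then obtain h where h: "h \<in> linear_maps H scalars" "h u = 1"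
    using separating_functional assms(1) by blast
  show False using assms(2)[OF dual_spaceI[OF vectorspace_axioms h(1)]] assms(1) h(2) by simp
qed

text \<open>Non-degeneracy is tested on pairs (w, 0) and (0, \<eta>). In the cyclic sum for
  closedness the values of \<alpha> cancel by the Lagrangian condition on cocycles, and the
  remaining terms by torsion-freeness.\<close>

lemma symplectic_G: "symplectic_lie_algebra G extension_form"
proof (intro symplectic_lie_algebra.intro symplectic_lie_algebra_axioms.intro)
  show "lie_algebra G" by (rule G.lie_algebra_axioms)
  show "bilinear_map G G scalars extension_form"
    by (rule bilinear_mapI) (auto simp: dual_add dual_scal algebra_simps)
  show "extension_form x x = 0" if "x \<in> carrier G" for x
    by (cases x) simp
  show "x = \<zero>\<^bsub>G\<^esub>" if x0: "x \<in> carrier G" and z: "\<And>y. y \<in> carrier G \<Longrightarrow> extension_form x y = 0" for x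
  proof -
    obtain u \<xi> where x: "x = (u, \<xi>)" "u \<in> carrier H" "\<xi> \<in> carrier (dual_space H)" using x0 by auto
    have "\<xi> w = 0" if "w \<in> carrier H" for w
      using z[of "(w, \<lambda>w\<in>carrier H. 0)"] that x dual_space_zero_closed[OF vectorspace_axioms] by simp
    then have "\<xi> = (\<lambda>w\<in>carrier H. 0)"
      using dual_spaceD(2)[OF x(3)] by (metis (no_types, lifting) restrict_ext)
    moreover have "u = \<zero>\<^bsub>H\<^esub>"
    proof (rule dual_separates[OF x(2)])
      show "\<eta> u = 0" if "\<eta> \<in> carrier (dual_space H)" for \<eta>
        using z[of "(\<zero>\<^bsub>H\<^esub>, \<eta>)"] that x dual_zero[OF x(3)] by simp
    qed
    ultimately show ?thesis using x by simp
  qed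
  show "extension_form (bracket G x y) z + extension_form (bracket G z x) y + extension_form (bracket G y z) x = 0"
    if "x \<in> carrier G" "y \<in> carrier G" "z \<in> carrier G" for x y z
  proof -
    obtain u \<xi> v \<eta> w \<zeta> where *: "x = (u, \<xi>)" "y = (v, \<eta>)" "z = (w, \<zeta>)"
      and c: "u \<in> carrier H" "v \<in> carrier H" "w \<in> carrier H"
      and d: "\<xi> \<in> carrier (dual_space H)" "\<eta> \<in> carrier (dual_space H)" "\<zeta> \<in> carrier (dual_space H)"
      using \<open>x \<in> carrier G\<close> \<open>y \<in> carrier G\<close> \<open>z \<in> carrier G\<close> by auto
    have tf: "\<theta> (bracket H u' v') = \<theta> (conn u' v') - \<theta> (conn v' u')"
      if "\<theta> \<in> carrier (dual_space H)" "u' \<in> carrier H" "v' \<in> carrier H" for \<theta> u' v'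
      using dual_diff[OF that(1), of "conn u' v'" "conn v' u'"] torsion_free that by simp
    have "\<alpha> u v w + \<alpha> w u v + \<alpha> v w u = 0"
      using cocycle_conditionsD(6)[OF cocycles2D(1)[OF cocycle]] c by blast
    then show ?thesis using c d by (simp add: * tf algebra_simps)
  qed
qed

lemma lagrangian_fibre: "lagrangian_ideal G extension_form fibre"
  unfolding lagrangian_ideal_def lie_ideal_def
proof (intro conjI ballI)
  show "subspace class_ring fibre G"
  proof (rule G.subspaceI)
    show "\<zero>\<^bsub>G\<^esub> \<in> fibre" using dual_space_zero_closed[OF vectorspace_axioms] by simp
    show "x \<oplus>\<^bsub>G\<^esub> y \<in> fibre" if "x \<in> fibre" "y \<in> fibre" for x y
    proof -
      have "x \<oplus>\<^bsub>G\<^esub> y \<in> carrier G" using that by (intro G.M.a_closed) auto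
      then show ?thesis using that by auto
    qed
    show "c \<odot>\<^bsub>G\<^esub> x \<in> fibre" if "x \<in> fibre" for c x
    proof -
      have "c \<odot>\<^bsub>G\<^esub> x \<in> carrier G" using that by (intro G.scal_closed) auto
      then show ?thesis using that smult_r_null[of c] by auto
    qed
  qed auto
  show "bracket G x y \<in> fibre" if "x \<in> carrier G" "y \<in> fibre" for x y
  proof -
    have "bracket G x y \<in> carrier G" using that by (intro G.bracket_closed) auto
    then show ?thesis using that by auto
  qed
  show "orthogonal_space G extension_form fibre = fibre"
  proof
    show "fibre \<subseteq> orthogonal_space G extension_form fibre"
      by (auto simp: orthogonal_space_def dual_zero)
    show "orthogonal_space G extension_form fibre \<subseteq> fibre"
    proof
      fix x assume x: "x \<in> orthogonal_space G extension_form fibre"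
      then obtain u \<xi> where *: "x = (u, \<xi>)" "u \<in> carrier H" "\<xi> \<in> carrier (dual_space H)"
        by (auto simp: orthogonal_space_def)
      have "u = \<zero>\<^bsub>H\<^esub>"
      proof (rule dual_separates[OF *(2)])
        show "\<eta> u = 0" if "\<eta> \<in> carrier (dual_space H)" for \<eta>
          using x that dual_zero[OF *(3)] by (auto simp: orthogonal_space_def *(1))
      qed
      then show "x \<in> fibre" using * by simp
    qed
  qed
qed

text \<open>Rank-nullity for the projection to H leaves the dimension of the dual part, which is
  half of the total because that part is Lagrangian; this avoids dual bases.\<close>

lemma lie_dim_G: "lie_dim G = 2 * lie_dim H"
proof -
  interpret S: symplectic_lie_algebra G extension_form using symplectic_G .
  have lin: "fst \<in> linear_maps G H" by (rule linear_mapsI) auto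
  have surj: "fst ` carrier G = carrier H"
    using dual_space_zero_closed[OF vectorspace_axioms] by (force simp: image_iff)
  have "{x \<in> carrier G. fst x = \<zero>\<^bsub>H\<^esub>} = fibre" by auto
  then have "lie_dim G = lie_dim H + G.rk fibre"
    using linear_maps_rank_nullity[OF G.vectorspace_axioms vectorspace_axioms G.fin_dim lin surj] by simp
  moreover have "2 * G.rk fibre = lie_dim G"
    using S.rk_lagrangian lagrangian_fibre by (simp add: lagrangian_ideal_def lie_ideal_def)
  ultimately show ?thesis by simp
qed

text \<open>This recovers the dual part from the Lie bracket alone, so that every isomorphism has to
  respect it.\<close>

lemma fibre_eq_canonical_ideal:
  assumes "filiform G" "2 \<le> lie_dim H"
  shows "fibre = canonical_ideal G"
  using symplectic_lie_algebra.lagrangian_ideal_unique[OF symplectic_G assms(1) _ lagrangian_fibre] assms(2) lie_dim_G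
  by simp

end

section \<open>Isomorphisms of triples\<close>

lemma pullback_apply:
  "u \<in> carrier H \<Longrightarrow> v \<in> carrier H \<Longrightarrow> w \<in> carrier H \<Longrightarrow> pullback H f \<alpha> u v w = \<alpha> (f u) (f v) (f w)"
  by (simp add: pullback_def)

lemma pullback_cocycle:
  assumes H: "flat_lie_algebra H conn" and H': "flat_lie_algebra H' conn'"
    and f: "f \<in> lie_iso H H'"
    and conn: "\<And>u v. u \<in> carrier H \<Longrightarrow> v \<in> carrier H \<Longrightarrow> f (conn u v) = conn' (f u) (f v)"
    and \<beta>: "\<beta> \<in> lagrangian_cocycles2 H' conn'"
  shows "pullback H f \<beta> \<in> lagrangian_cocycles2 H conn"
proof -
  interpret H: flat_lie_algebra H conn using H .
  interpret H': flat_lie_algebra H' conn' using H' .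
  note f' = lie_isoD[OF f]
  note fc = linear_mapsD(1)[OF f'(1)]
  note D = cocycle_conditionsD[OF H'.cocycles2D(1)[OF \<beta>]]
  show ?thesis
    unfolding pullback_def
  proof (rule H.cocycle_restrict, unfold cocycle_conditions_def, intro conjI ballI)
    fix u v assume c: "u \<in> carrier H" "v \<in> carrier H"
    show "(\<lambda>w. \<beta> (f u) (f v) (f w)) \<in> linear_maps H scalars"
      by (rule linear_maps_compose[OF f'(1) D(1)]) (use c fc in auto)
    show "(\<lambda>w. \<beta> (f u) (f w) (f v)) \<in> linear_maps H scalars"
      by (rule linear_maps_compose[OF f'(1) D(2)]) (use c fc in auto)
    show "(\<lambda>w. \<beta> (f w) (f u) (f v)) \<in> linear_maps H scalars"
      by (rule linear_maps_compose[OF f'(1) D(3)]) (use c fc in auto)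
  next
    fix u v w x assume c: "u \<in> carrier H" "v \<in> carrier H" "w \<in> carrier H" "x \<in> carrier H"
    show "- \<beta> (f v) (f w) (f (conn u x)) + \<beta> (f u) (f w) (f (conn v x)) - \<beta> (f u) (f v) (f (conn w x))
        - \<beta> (f (bracket H u v)) (f w) (f x) + \<beta> (f (bracket H u w)) (f v) (f x) - \<beta> (f (bracket H v w)) (f u) (f x) = 0"
      using D(5)[of "f u" "f v" "f w" "f x"] c fc by (simp add: conn f'(3))
  qed (use D(4,6) fc in auto)
qed

lemma pullback_cochain:
  assumes "vectorspace class_ring H" "f \<in> linear_maps H H'" "\<psi> \<in> lagrangian_cochains1 H'"
  shows "(\<lambda>u\<in>carrier H. \<lambda>v\<in>carrier H. \<psi> (f u) (f v)) \<in> lagrangian_cochains1 H"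
  by (rule cochains1I[OF assms(1) linear_maps_compose[OF assms(2) cochains1D(1)[OF assms(3)]]])
    (use linear_mapsD(1)[OF assms(2)] cochains1D(3)[OF assms(3)] in auto)

text \<open>An isomorphism of triples asks for equality of whole classes as sets. Besides mapping
  cohomologous cocycles to cohomologous ones, the pullback must therefore reach every member of the
  target class; a preimage is the pullback along the inverse of f.\<close>

lemma pullback_cohomology_class:
  assumes H: "flat_lie_algebra H conn" and H': "flat_lie_algebra H' conn'"
    and f: "f \<in> lie_iso H H'"
    and conn: "\<And>u v. u \<in> carrier H \<Longrightarrow> v \<in> carrier H \<Longrightarrow> f (conn u v) = conn' (f u) (f v)"
    and \<alpha>: "\<alpha> \<in> lagrangian_cocycles2 H conn" and \<alpha>': "\<alpha>' \<in> lagrangian_cocycles2 H' conn'"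
    and \<phi>: "\<phi> \<in> lagrangian_cochains1 H"
    and eq: "\<And>u v w. u \<in> carrier H \<Longrightarrow> v \<in> carrier H \<Longrightarrow> w \<in> carrier H \<Longrightarrow>
      \<alpha> u v w - \<alpha>' (f u) (f v) (f w) = \<phi> u (conn v w) - \<phi> v (conn u w) - \<phi> (bracket H u v) w"
  shows "pullback H f ` (cohomologous H' conn' `` {\<alpha>'}) = cohomologous H conn `` {\<alpha>}"
proof -
  interpret H: flat_lie_algebra H conn using H .
  interpret H': flat_lie_algebra H' conn' using H' .
  note f' = lie_isoD[OF f]
  note fc = linear_mapsD(1)[OF f'(1)]
  define g where "g = inv_into (carrier H) f"
  have g: "g \<in> lie_iso H' H" unfolding g_def using lie_iso_inv[OF H.lie_algebra_axioms f] .
  note g' = lie_isoD[OF g]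
  note gc = linear_mapsD(1)[OF g'(1)]
  have gf: "g (f x) = x" if "x \<in> carrier H" for x
    using f'(2) that by (simp add: g_def bij_betw_def)
  have fg: "f (g x) = x" if "x \<in> carrier H'" for x
    using f'(2) that by (simp add: g_def bij_betw_def f_inv_into_f)
  have gconn: "g (conn' u v) = conn (g u) (g v)" if "u \<in> carrier H'" "v \<in> carrier H'" for u v
    using conn[of "g u" "g v"] gf[of "conn (g u) (g v)"] that gc fg by simp
  have pf: "(\<alpha>, pullback H f \<alpha>') \<in> cohomologous H conn"
  proof (rule H.cohomologous_sym)
    show "(pullback H f \<alpha>', \<alpha>) \<in> cohomologous H conn"
      unfolding H.cohomologous_iff
      using pullback_cocycle[OF H H' f conn \<alpha>'] \<alpha> \<phi> eq by (auto simp: pullback_apply)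
  qed
  have pull: "(pullback H f \<alpha>', pullback H f \<beta>') \<in> cohomologous H conn"
    if b: "(\<alpha>', \<beta>') \<in> cohomologous H' conn'" for \<beta>'
  proof -
    obtain \<psi> where \<psi>: "\<psi> \<in> lagrangian_cochains1 H'"
      and e: "\<And>u v w. u \<in> carrier H' \<Longrightarrow> v \<in> carrier H' \<Longrightarrow> w \<in> carrier H' \<Longrightarrow>
        \<beta>' u v w - \<alpha>' u v w = \<psi> u (conn' v w) - \<psi> v (conn' u w) - \<psi> (bracket H' u v) w"
      using b unfolding H'.cohomologous_iff by blast
    have \<beta>': "\<beta>' \<in> lagrangian_cocycles2 H' conn'" using b unfolding H'.cohomologous_iff by blast
    show ?thesis
      unfolding H.cohomologous_iff
    proof (intro conjI bexI[OF _ pullback_cochain[OF H.vectorspace_axioms f'(1) \<psi>]] ballI)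
      show "pullback H f \<alpha>' \<in> lagrangian_cocycles2 H conn" by (rule pullback_cocycle[OF H H' f conn \<alpha>'])
      show "pullback H f \<beta>' \<in> lagrangian_cocycles2 H conn" by (rule pullback_cocycle[OF H H' f conn \<beta>'])
    qed (simp_all add: pullback_apply conn f'(3) e fc)
  qed
  have push: "\<exists>\<beta>'. (\<alpha>', \<beta>') \<in> cohomologous H' conn' \<and> pullback H f \<beta>' = \<beta>"
    if b: "(\<alpha>, \<beta>) \<in> cohomologous H conn" for \<beta>
  proof (intro exI conjI)
    let ?b = "pullback H' g \<beta>"
    have \<beta>: "\<beta> \<in> lagrangian_cocycles2 H conn" using b unfolding H.cohomologous_iff by blast
    have "(pullback H f \<alpha>', \<beta>) \<in> cohomologous H conn"
      using H.cohomologous_trans[OF H.cohomologous_sym[OF pf] b] .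
    then obtain \<psi> where \<psi>: "\<psi> \<in> lagrangian_cochains1 H"
      and e: "\<And>u v w. u \<in> carrier H \<Longrightarrow> v \<in> carrier H \<Longrightarrow> w \<in> carrier H \<Longrightarrow>
        \<beta> u v w - pullback H f \<alpha>' u v w = \<psi> u (conn v w) - \<psi> v (conn u w) - \<psi> (bracket H u v) w"
      unfolding H.cohomologous_iff by blast
    have bZ: "?b \<in> lagrangian_cocycles2 H' conn'" using pullback_cocycle[OF H' H g gconn \<beta>] .
    show "(\<alpha>', ?b) \<in> cohomologous H' conn'"
      unfolding H'.cohomologous_iff
    proof (intro conjI bexI[OF _ pullback_cochain[OF H'.vectorspace_axioms g'(1) \<psi>]] ballI \<alpha>' bZ)
      fix u v w assume c: "u \<in> carrier H'" "v \<in> carrier H'" "w \<in> carrier H'"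
      then show "?b u v w - \<alpha>' u v w =
        (\<lambda>u\<in>carrier H'. \<lambda>v\<in>carrier H'. \<psi> (g u) (g v)) u (conn' v w) -
        (\<lambda>u\<in>carrier H'. \<lambda>v\<in>carrier H'. \<psi> (g u) (g v)) v (conn' u w) -
        (\<lambda>u\<in>carrier H'. \<lambda>v\<in>carrier H'. \<psi> (g u) (g v)) (bracket H' u v) w"
        using e[of "g u" "g v" "g w"] gc fg by (simp add: pullback_apply gconn g'(3))
    qed
    have "pullback H f ?b = (\<lambda>u\<in>carrier H. \<lambda>v\<in>carrier H. \<lambda>w\<in>carrier H. \<beta> u v w)"
      unfolding pullback_def by (intro restrict_ext) (simp add: fc gf)
    then show "pullback H f ?b = \<beta>" using H.cocycles2D(3)[OF \<beta>] by metis
  qed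
  show ?thesis
  proof
    show "pullback H f ` (cohomologous H' conn' `` {\<alpha>'}) \<subseteq> cohomologous H conn `` {\<alpha>}"
      using pull pf H.cohomologous_trans by blast
    show "cohomologous H conn `` {\<alpha>} \<subseteq> pullback H f ` (cohomologous H' conn' `` {\<alpha>'})"
      using push by blast
  qed
qed

lemma quotient_class_eq:
  assumes "equiv A r" "X \<in> A // r" "x \<in> X"
  shows "X = r `` {x}" "x \<in> A"
proof -
  obtain a where a: "a \<in> A" "X = r `` {a}" using assms(2) by (rule quotientE)
  then have "(a, x) \<in> r" using assms(3) by simp
  then show "X = r `` {x}" using equiv_class_eq[OF assms(1)] a by simp
  show "x \<in> A" using \<open>(a, x) \<in> r\<close> equiv_type[OF assms(1)] by blast
qed

lemma triple_isomorphic_iff: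
  assumes H: "flat_lie_algebra H conn" and H': "flat_lie_algebra H' conn'"
    and c: "c \<in> lagrangian_cohomology2 H conn" and c': "c' \<in> lagrangian_cohomology2 H' conn'"
    and \<alpha>: "\<alpha> \<in> c" and \<alpha>': "\<alpha>' \<in> c'"
    and fil: "filiform (extension_algebra H conn \<alpha>)" and fil': "filiform (extension_algebra H' conn' \<alpha>')"
    and dim: "2 \<le> lie_dim H" "2 \<le> lie_dim H'"
  shows "triple_isomorphic (H, conn, c) (H', conn', c') \<longleftrightarrow>
    symplectic_isomorphic (extension_algebra H conn \<alpha>, extension_form) (extension_algebra H' conn' \<alpha>', extension_form)"
    (is "?T \<longleftrightarrow> ?S")
proof -
  interpret H: flat_lie_algebra H conn using H .
  interpret H': flat_lie_algebra H' conn' using H' .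
  note c = quotient_class_eq[OF H.equiv_cohomologous c[unfolded lagrangian_cohomology2_def] \<alpha>]
  note c' = quotient_class_eq[OF H'.equiv_cohomologous c'[unfolded lagrangian_cohomology2_def] \<alpha>']
  interpret E: symplectic_extension H conn \<alpha>
    using H c(2) fil by (simp add: symplectic_extension_def symplectic_extension_axioms_def filiform_def)
  interpret E': symplectic_extension H' conn' \<alpha>'
    using H' c'(2) fil' by (simp add: symplectic_extension_def symplectic_extension_axioms_def filiform_def)
  show ?thesis
  proof
    assume ?T
    then obtain f where f: "f \<in> lie_iso H H'" "\<forall>u\<in>carrier H. \<forall>v\<in>carrier H. f (conn u v) = conn' (f u) (f v)"
      "pullback H f ` c' = c" by (auto simp: triple_isomorphic_def)
    have "pullback H f \<alpha>' \<in> cohomologous H conn `` {\<alpha>}" using f(3) \<alpha>' c(1) by blast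
    then have "(pullback H f \<alpha>', \<alpha>) \<in> cohomologous H conn" using H.cohomologous_sym by blast
    then obtain \<phi> where "\<phi> \<in> lagrangian_cochains1 H"
      "\<forall>u\<in>carrier H. \<forall>v\<in>carrier H. \<forall>w\<in>carrier H.
        \<alpha> u v w - pullback H f \<alpha>' u v w = \<phi> u (conn v w) - \<phi> v (conn u w) - \<phi> (bracket H u v) w"
      unfolding H.cohomologous_iff by blast
    then show ?S
      using extension_symplectic_isomorphic[OF H H' f(1), of \<phi> \<alpha> \<alpha>'] f(2) by (simp add: pullback_apply)
  next
    assume ?S
    then obtain F where F: "F \<in> lie_iso E.G E'.G"
      "\<forall>x\<in>carrier E.G. \<forall>y\<in>carrier E.G. extension_form (F x) (F y) = extension_form x y"
      unfolding symplectic_isomorphic_iff by blast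
    \<comment> \<open>The canonical ideal is a term of the lower central series with an index
      depending on the dimension only, and isomorphisms preserve both.\<close>
    have "F ` canonical_ideal E.G = canonical_ideal E'.G"
      using lower_central_lie_iso[OF E.G.lie_algebra_axioms E'.G.lie_algebra_axioms F(1)]
        lie_iso_dim[OF E.G.lie_algebra_axioms E'.G.lie_algebra_axioms F(1)]
      by (simp add: canonical_ideal_def)
    then have fib: "F ` E.fibre = E'.fibre"
      using E.fibre_eq_canonical_ideal[OF fil dim(1)] E'.fibre_eq_canonical_ideal[OF fil' dim(2)] by simp
    have form: "extension_form (F x) (F y) = extension_form x y" if "x \<in> carrier E.G" "y \<in> carrier E.G" for x y
      using F(2) that by blast
    note K = extension_iso_imp_flat_iso[OF H H' c(2) c'(2) F(1) form fib]
    define f where "f = (\<lambda>u. fst (F (u, \<lambda>w\<in>carrier H. 0)))"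
    have f: "f \<in> lie_iso H H'" unfolding f_def by (rule K(1))
    have conn: "f (conn u v) = conn' (f u) (f v)" if "u \<in> carrier H" "v \<in> carrier H" for u v
      unfolding f_def by (rule K(2)) (use that in simp_all)
    have "\<exists>\<phi>\<in>lagrangian_cochains1 H. \<forall>u\<in>carrier H. \<forall>v\<in>carrier H. \<forall>w\<in>carrier H.
        \<alpha> u v w - \<alpha>' (f u) (f v) (f w) = \<phi> u (conn v w) - \<phi> v (conn u w) - \<phi> (bracket H u v) w"
      unfolding f_def by (rule K(3))
    then obtain \<phi> where \<phi>: "\<phi> \<in> lagrangian_cochains1 H"
      and eq: "\<And>u v w. u \<in> carrier H \<Longrightarrow> v \<in> carrier H \<Longrightarrow> w \<in> carrier H \<Longrightarrow>
        \<alpha> u v w - \<alpha>' (f u) (f v) (f w) = \<phi> u (conn v w) - \<phi> v (conn u w) - \<phi> (bracket H u v) w"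
      by blast
    have "pullback H f ` (cohomologous H' conn' `` {\<alpha>'}) = cohomologous H conn `` {\<alpha>}"
      by (rule pullback_cohomology_class[OF H H' f conn c(2) c'(2) \<phi> eq])
    then have "pullback H f ` c' = c" unfolding c(1)[symmetric] c'(1)[symmetric] .
    then show ?T using f conn by (auto simp: triple_isomorphic_def)
  qed
qed

section \<open>Realising a symplectic Lie algebra on a given type\<close>

text \<open>A field of characteristic 0 is infinite, so pairs of scalars can be coded by single
  scalars; adjoining the vectors of a finite generating set one by one then never needs more than
  the scalars as an index set.\<close>

lemma (in lie_algebra) carrier_subset_range_scalars:
  obtains g :: "'k \<Rightarrow> 'a" where "carrier L \<subseteq> range g"
proof -
  obtain f :: "'k \<times> 'k \<Rightarrow> 'k" where "bij_betw f (UNIV \<times> UNIV) UNIV"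
    using card_of_Times_same_infinite[of "UNIV :: 'k set"] infinite_UNIV_char_0[where 'a = 'k]
      card_of_ordIso[of "UNIV \<times> UNIV :: ('k \<times> 'k) set" "UNIV :: 'k set"] by blast
  then have f: "inj f" by (simp add: bij_betw_def)
  have "\<exists>g :: 'k \<Rightarrow> 'a. span B \<subseteq> range g" if "finite B" "B \<subseteq> carrier L" for B
    using that
  proof (induction B)
    case empty
    show ?case using span_empty by auto
  next
    case (insert b B)
    then obtain g :: "'k \<Rightarrow> 'a" where g: "span B \<subseteq> range g" by blast
    \<comment> \<open>The scalar k codes a pair: c indexes a vector of \<open>span B\<close>, and d
      is the coefficient of the new vector b.\<close>
    let ?h = "\<lambda>k. case inv_into UNIV f k of (c, d) \<Rightarrow> g c \<oplus> d \<odot> b"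
    have "x \<in> range ?h" if x: "x \<in> adjoin (span B) b" for x
    proof -
      obtain w d where w: "w \<in> span B" "x = w \<oplus> d \<odot> b" using x by (rule adjoinE)
      then obtain c where "w = g c" using g by blast
      then have "x = ?h (f (c, d))" using w(2) f by simp
      then show ?thesis by blast
    qed
    then have "span (insert b B) \<subseteq> range ?h"
      using span_insert_adjoin[of B b] insert.prems by auto
    then show ?case by blast
  qed
  then show thesis using that fin_dim unfolding fin_dim_def by metis
qed

lemma symplectic_transport:
  assumes L: "symplectic_lie_algebra L \<omega>" and f: "f \<in> lie_iso L M" and zero: "f \<zero>\<^bsub>L\<^esub> = \<zero>\<^bsub>M\<^esub>"
    and form: "\<And>x y. x \<in> carrier L \<Longrightarrow> y \<in> carrier L \<Longrightarrow> \<omega>' (f x) (f y) = \<omega> x y"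
  shows "symplectic_lie_algebra M \<omega>'"
proof -
  interpret L: symplectic_lie_algebra L \<omega> using L .
  note f' = lie_isoD[OF f]
  note D = linear_mapsD[OF f'(1)]
  have surj: "\<exists>x\<in>carrier L. y = f x" if "y \<in> carrier M" for y
    using f'(2) that by (auto simp: bij_betw_def)
  have M: "lie_algebra M"
    using lie_algebra_image[OF L.lie_algebra_axioms f'(1) bij_betw_imp_surj_on[OF f'(2)] f'(3) zero] .
  show ?thesis
  proof (intro symplectic_lie_algebra.intro symplectic_lie_algebra_axioms.intro M)
    show "bilinear_map M M scalars \<omega>'"
    proof (rule bilinear_mapI)
      fix x y z assume "x \<in> carrier M" "y \<in> carrier M" "z \<in> carrier M"
      then obtain x' y' z' where *: "x' \<in> carrier L" "x = f x'" "y' \<in> carrier L" "y = f y'" "z' \<in> carrier L" "z = f z'"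
        using surj by metis
      show "\<omega>' (x \<oplus>\<^bsub>M\<^esub> y) z = \<omega>' x z \<oplus>\<^bsub>scalars\<^esub> \<omega>' y z"
        using * by (simp flip: D(2) add: form L.form_add_left)
      show "\<omega>' x (y \<oplus>\<^bsub>M\<^esub> z) = \<omega>' x y \<oplus>\<^bsub>scalars\<^esub> \<omega>' x z"
        using * by (simp flip: D(2) add: form L.form_add_right)
    next
      fix c x y assume "x \<in> carrier M" "y \<in> carrier M"
      then obtain x' y' where *: "x' \<in> carrier L" "x = f x'" "y' \<in> carrier L" "y = f y'"
        using surj by metis
      show "\<omega>' (c \<odot>\<^bsub>M\<^esub> x) y = c \<odot>\<^bsub>scalars\<^esub> \<omega>' x y"
        using * by (simp flip: D(3) add: form L.form_scal_left)
      show "\<omega>' x (c \<odot>\<^bsub>M\<^esub> y) = c \<odot>\<^bsub>scalars\<^esub> \<omega>' x y"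
        using * by (simp flip: D(3) add: form L.form_scal_right)
    qed simp
    show "\<omega>' x x = 0" if "x \<in> carrier M" for x
      using surj[OF that] form L.form_alternating by auto
    show "x = \<zero>\<^bsub>M\<^esub>" if x: "x \<in> carrier M" and "\<And>y. y \<in> carrier M \<Longrightarrow> \<omega>' x y = 0" for x
    proof -
      obtain x' where x': "x' \<in> carrier L" "x = f x'" using surj[OF x] by blast
      have "x' = \<zero>\<^bsub>L\<^esub>"
      proof (rule L.form_nondegenerate[OF x'(1)])
        show "\<omega> x' y = 0" if y: "y \<in> carrier L" for y
          using \<open>\<And>y. y \<in> carrier M \<Longrightarrow> \<omega>' x y = 0\<close>[OF D(1)[OF y]] form[OF x'(1) y] x'(2) by simp
      qed
      then show ?thesis using x' zero by simp
    qed
    fix x y z assume "x \<in> carrier M" "y \<in> carrier M" "z \<in> carrier M"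
    then obtain x' y' z' where *: "x' \<in> carrier L" "x = f x'" "y' \<in> carrier L" "y = f y'" "z' \<in> carrier L" "z = f z'"
      using surj by metis
    show "\<omega>' (bracket M x y) z + \<omega>' (bracket M z x) y + \<omega>' (bracket M y z) x = 0"
      using * L.form_closed[of x' y' z'] by (simp flip: f'(3) add: form)
  qed
qed

lemma symplectic_realisation:
  fixes emb :: "'k::field_char_0 \<Rightarrow> 'a" and M :: "('k, 'b) lie"
  assumes emb: "inj emb" and M: "symplectic_lie_algebra M \<omega>"
  obtains L :: "('k, 'a) lie" and \<omega>' where "symplectic_lie_algebra L \<omega>'" "symplectic_isomorphic (M, \<omega>) (L, \<omega>')"
proof -
  interpret M: symplectic_lie_algebra M \<omega> using M .
  obtain g :: "'k \<Rightarrow> 'b" where g: "carrier M \<subseteq> range g" using M.carrier_subset_range_scalars .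
  \<comment> \<open>Each vector is replaced by the image under \<open>emb\<close> of a scalar that g
    maps to it. This is injective because g recovers the vector; the structure of M is then
    transported along e.\<close>
  define e where "e x = emb (inv_into UNIV g x)" for x
  have inj: "inj_on e (carrier M)"
    using g emb by (auto simp: inj_on_def e_def dest!: injD) (metis f_inv_into_f subsetD)
  define d where "d = inv_into (carrier M) e"
  have de: "d (e x) = x" if "x \<in> carrier M" for x
    using inj that by (simp add: d_def)
  define L :: "('k, 'a) lie" where "L = \<lparr>carrier = e ` carrier M, mult = undefined, one = undefined, zero = e \<zero>\<^bsub>M\<^esub>,
    add = \<lambda>x y. e (d x \<oplus>\<^bsub>M\<^esub> d y), smult = \<lambda>c x. e (c \<odot>\<^bsub>M\<^esub> d x), bracket = \<lambda>x y. e (bracket M (d x) (d y))\<rparr>"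
  have iso: "e \<in> lie_iso M L"
    using inj by (auto simp: lie_iso_def L_def bij_betw_def de intro!: linear_mapsI)
  have form: "\<omega> (d (e x)) (d (e y)) = \<omega> x y" if "x \<in> carrier M" "y \<in> carrier M" for x y
    using de that by simp
  have "symplectic_lie_algebra L (\<lambda>x y. \<omega> (d x) (d y))"
    by (rule symplectic_transport[OF M iso]) (simp_all add: L_def form)
  moreover have "symplectic_isomorphic (M, \<omega>) (L, \<lambda>x y. \<omega> (d x) (d y))"
    unfolding symplectic_isomorphic_iff using iso form by blast
  ultimately show thesis using that by blast
qed

section \<open>The correspondence\<close>

text \<open>The image of a class under f is only a part of a class of q, so it is closed up under q.
  The equivalence in \<open>iff\<close> gives injectivity, and it suffices that f is surjective up
  to q.\<close>

lemma bij_betw_quotients: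
  assumes r: "equiv A r" and q: "equiv B q" and f: "\<And>x. x \<in> A \<Longrightarrow> f x \<in> B"
    and iff: "\<And>x y. x \<in> A \<Longrightarrow> y \<in> A \<Longrightarrow> (f x, f y) \<in> q \<longleftrightarrow> (x, y) \<in> r"
    and surj: "\<And>b. b \<in> B \<Longrightarrow> \<exists>a\<in>A. (f a, b) \<in> q"
  shows "bij_betw (\<lambda>X. q `` (f ` X)) (A // r) (B // q)"
proof -
  have cl: "q `` (f ` (r `` {a})) = q `` {f a}" if a: "a \<in> A" for a
  proof
    show "q `` {f a} \<subseteq> q `` (f ` (r `` {a}))"
      using equiv_class_self[OF r a] by blast
    show "q `` (f ` (r `` {a})) \<subseteq> q `` {f a}"
    proof
      fix b assume "b \<in> q `` (f ` (r `` {a}))"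
      then obtain x where x: "(a, x) \<in> r" "(f x, b) \<in> q" by blast
      then have "(f a, f x) \<in> q" using iff[OF a] equiv_type[OF r] by blast
      then show "b \<in> q `` {f a}" using x(2) equivE[OF q] by (meson Image_singleton_iff transD)
    qed
  qed
  show ?thesis
  proof (rule bij_betw_imageI)
    show "inj_on (\<lambda>X. q `` (f ` X)) (A // r)"
    proof (rule inj_onI)
      fix X Y assume "X \<in> A // r" "Y \<in> A // r" and eq: "q `` (f ` X) = q `` (f ` Y)"
      then obtain x y where *: "x \<in> A" "X = r `` {x}" "y \<in> A" "Y = r `` {y}" by (metis quotientE)
      then have "q `` {f x} = q `` {f y}" using eq cl by simp
      then have "(f x, f y) \<in> q" using eq_equiv_class[OF _ q f] * by blast
      then show "X = Y" using iff * equiv_class_eq[OF r] by simp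
    qed
    show "(\<lambda>X. q `` (f ` X)) ` (A // r) = B // q"
    proof
      show "(\<lambda>X. q `` (f ` X)) ` (A // r) \<subseteq> B // q"
      proof
        fix Y assume "Y \<in> (\<lambda>X. q `` (f ` X)) ` (A // r)"
        then obtain a where "a \<in> A" "Y = q `` (f ` (r `` {a}))" by (auto elim!: quotientE)
        then show "Y \<in> B // q" using cl f quotientI[of "f a" B q] by simp
      qed
      show "B // q \<subseteq> (\<lambda>X. q `` (f ` X)) ` (A // r)"
      proof
        fix Y assume "Y \<in> B // q"
        then obtain b where b: "b \<in> B" "Y = q `` {b}" by (rule quotientE)
        obtain a where a: "a \<in> A" "(f a, b) \<in> q" using surj[OF b(1)] by blast
        then have "Y = q `` (f ` (r `` {a}))" using cl b equiv_class_eq[OF q] by simp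
        then show "Y \<in> (\<lambda>X. q `` (f ` X)) ` (A // r)" using quotientI[OF a(1), of r] by blast
      qed
    qed
  qed
qed

text \<open>A relation and not a function, since a filiform class is only required to have some
  representative with filiform extension algebra. It links the isomorphism of triples to that of
  symplectic Lie algebras.\<close>

definition represents :: "('k::field_char_0, 'b \<times> ('b \<Rightarrow> 'k)) sympl \<Rightarrow> ('k, 'b) triple \<Rightarrow> bool" where
  "represents S T \<longleftrightarrow> (case T of (H, conn, c) \<Rightarrow> \<exists>\<alpha>\<in>c. filiform (extension_algebra H conn \<alpha>) \<and>
     S = (extension_algebra H conn \<alpha>, extension_form))"

lemma filiform_lie_algebra: "filiform L \<Longrightarrow> lie_algebra L"
  by (simp only: filiform_def)

lemma represents_exists: "T \<in> filiform_triples \<Longrightarrow> \<exists>S. represents S T"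
  by (auto simp: filiform_triples_def filiform_class_def represents_def)

lemma represents_lie_algebra: "represents S T \<Longrightarrow> lie_algebra (fst S)"
  by (cases T) (auto simp: represents_def dest: filiform_lie_algebra)

lemma represents_isomorphic_iff:
  assumes "T \<in> filiform_triples" "T' \<in> filiform_triples" "represents S T" "represents S' T'"
  shows "triple_isomorphic T T' \<longleftrightarrow> symplectic_isomorphic S S'"
proof -
  obtain H conn c where T: "T = (H, conn, c)" by (cases T)
  obtain H' conn' c' where T': "T' = (H', conn', c')" by (cases T')
  obtain \<alpha> where "\<alpha> \<in> c" "filiform (extension_algebra H conn \<alpha>)" "S = (extension_algebra H conn \<alpha>, extension_form)"
    using assms(3) by (auto simp: represents_def T)
  moreover obtain \<alpha>' where "\<alpha>' \<in> c'" "filiform (extension_algebra H' conn' \<alpha>')" "S' = (extension_algebra H' conn' \<alpha>', extension_form)"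
    using assms(4) by (auto simp: represents_def T')
  ultimately show ?thesis
    using triple_isomorphic_iff[of H conn H' conn' c c' \<alpha> \<alpha>'] assms(1,2)
    by (simp add: filiform_triples_def T T')
qed

lemma symplectic_isomorphic_sym': "lie_algebra (fst S) \<Longrightarrow> symplectic_isomorphic S S' \<Longrightarrow> symplectic_isomorphic S' S"
  and symplectic_isomorphic_trans': "symplectic_isomorphic S S' \<Longrightarrow> symplectic_isomorphic S' S'' \<Longrightarrow> symplectic_isomorphic S S''"
  and symplectic_isomorphic_refl': "symplectic_isomorphic S S"
  using symplectic_isomorphic_sym symplectic_isomorphic_trans symplectic_isomorphic_refl
  by (metis prod.collapse)+

lemma filiform_symplectic_lie_algebra: "S \<in> filiform_symplectic \<Longrightarrow> lie_algebra (fst S)"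
  by (auto simp: filiform_symplectic_def dest: filiform_lie_algebra)

lemma equiv_filiform_symplectic: "equiv filiform_symplectic filiform_symplectic_iso"
proof (rule equivI)
  show "filiform_symplectic_iso \<subseteq> filiform_symplectic \<times> filiform_symplectic"
    by (auto simp: filiform_symplectic_iso_def)
  show "refl_on filiform_symplectic filiform_symplectic_iso"
    using symplectic_isomorphic_refl' by (auto simp: refl_on_def filiform_symplectic_iso_def)
  show "sym filiform_symplectic_iso"
    using symplectic_isomorphic_sym'[OF filiform_symplectic_lie_algebra]
    by (intro symI) (auto simp: filiform_symplectic_iso_def)
  show "trans filiform_symplectic_iso"
    using symplectic_isomorphic_trans' by (intro transI) (auto simp: filiform_symplectic_iso_def)
qed

text \<open>The laws are inherited from symplectic isomorphism of representing extension algebras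
  through \<open>represents_isomorphic_iff\<close>, in place of composing and inverting pullbacks of
  classes.\<close>

lemma equiv_filiform_triples:
  "equiv (filiform_triples :: ('k::field_char_0, 'b) triple set) filiform_triples_iso"
    (is "equiv ?A ?r")
proof (rule equivI)
  show "?r \<subseteq> ?A \<times> ?A"
    by (auto simp: filiform_triples_iso_def)
  have "triple_isomorphic T T" if "T \<in> filiform_triples" for T :: "('k, 'b) triple"
    using represents_exists[OF that] represents_isomorphic_iff[OF that that] symplectic_isomorphic_refl' by blast
  then show "refl_on ?A ?r"
    by (auto simp: refl_on_def filiform_triples_iso_def)
  have "triple_isomorphic T' T" if T: "T \<in> filiform_triples" "T' \<in> filiform_triples" and iso: "triple_isomorphic T T'"
    for T T' :: "('k, 'b) triple"
  proof -
    obtain S where S1: "represents S T" using represents_exists[OF T(1)] ..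
    obtain S' where S2: "represents S' T'" using represents_exists[OF T(2)] ..
    note S = S1 S2
    show ?thesis
      using represents_isomorphic_iff[OF T S] represents_isomorphic_iff[OF T(2,1) S(2,1)] iso
        symplectic_isomorphic_sym'[OF represents_lie_algebra[OF S(1)]] by blast
  qed
  then show "sym ?r" by (intro symI) (auto simp: filiform_triples_iso_def)
  have tr: "triple_isomorphic T T''"
    if T: "T \<in> filiform_triples" "T' \<in> filiform_triples" "T'' \<in> filiform_triples"
      and iso: "triple_isomorphic T T'" "triple_isomorphic T' T''"
    for T T' T'' :: "('k, 'b) triple"
  proof -
    obtain S where S1: "represents S T" using represents_exists[OF T(1)] ..
    obtain S' where S2: "represents S' T'" using represents_exists[OF T(2)] ..
    obtain S'' where S3: "represents S'' T''" using represents_exists[OF T(3)] ..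
    note S = S1 S2 S3
    have "symplectic_isomorphic S S'" using represents_isomorphic_iff[OF T(1,2) S(1,2)] iso(1) by simp
    moreover have "symplectic_isomorphic S' S''" using represents_isomorphic_iff[OF T(2,3) S(2,3)] iso(2) by simp
    ultimately have "symplectic_isomorphic S S''" by (rule symplectic_isomorphic_trans')
    then show ?thesis using represents_isomorphic_iff[OF T(1,3) S(1,3)] by simp
  qed
  show "trans ?r"
  proof (rule transI)
    fix T T' T'' assume "(T, T') \<in> ?r" "(T', T'') \<in> ?r"
    then have T: "T \<in> ?A" "T' \<in> ?A" "T'' \<in> ?A" "triple_isomorphic T T'" "triple_isomorphic T' T''"
      by (auto simp: filiform_triples_iso_def)
    then have "triple_isomorphic T T''" by (rule tr)
    then show "(T, T'') \<in> ?r" using T by (simp add: filiform_triples_iso_def)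
  qed
qed

text \<open>The chart of a Lagrangian complement identifies S with an extension algebra of its own
  triple, and this isomorphism carries the filiform property over.\<close>

lemma canonical_triple_represented:
  assumes "S \<in> filiform_symplectic"
  obtains S' where "canonical_triple S \<in> filiform_triples" "represents S' (canonical_triple S)" "symplectic_isomorphic S S'"
proof -
  obtain L \<omega> where S: "S = (L, \<omega>)" by (cases S)
  then have L: "symplectic_lie_algebra L \<omega>" "filiform L" "4 \<le> lie_dim L"
    using assms by (auto simp: filiform_symplectic_def)
  let ?I = "canonical_ideal L"
  interpret symplectic_lie_algebra L \<omega> using L(1) .
  interpret symplectic_with_lagrangian L \<omega> ?I
    using canonical_ideal_lagrangian[OF L(2,3)] by unfold_locales
  obtain \<alpha> where \<alpha>: "flat_lie_algebra Q conn" "\<alpha> \<in> lagrangian_cocycles2 Q conn"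
    "extension_class L \<omega> ?I = cohomologous Q conn `` {\<alpha>}"
    "symplectic_isomorphic (L, \<omega>) (extension_algebra Q conn \<alpha>, extension_form)"
    "lie_algebra (extension_algebra Q conn \<alpha>)"
    by (rule extension_triple_properties)
  let ?c = "extension_class L \<omega> ?I"
  have T: "canonical_triple S = (Q, conn, ?c)"
    by (simp add: canonical_triple_def extension_triple_def S)
  have \<alpha>c: "\<alpha> \<in> ?c" using flat_lie_algebra.cohomologous_refl[OF \<alpha>(1,2)] \<alpha>(3) by simp
  obtain f where "f \<in> lie_iso L (extension_algebra Q conn \<alpha>)"
    using \<alpha>(4) by (auto simp: symplectic_isomorphic_iff)
  then have fil: "filiform (extension_algebra Q conn \<alpha>)"
    using filiform_lie_iso[OF lie_algebra_axioms \<alpha>(5) _ L(2)] by blast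
  have "?c \<in> lagrangian_cohomology2 Q conn"
    unfolding lagrangian_cohomology2_def \<alpha>(3) by (rule quotientI[OF \<alpha>(2)])
  then have "canonical_triple S \<in> filiform_triples"
    using \<alpha>(1) \<alpha>c fil lie_dim_Q L(3) by (auto simp: T filiform_triples_def filiform_class_def)
  moreover have "represents (extension_algebra Q conn \<alpha>, extension_form) (canonical_triple S)"
    using \<alpha>c fil by (auto simp: represents_def T)
  ultimately show thesis using that \<alpha>(4) S by blast
qed

lemma canonical_triple_isomorphic_iff:
  assumes S: "S \<in> filiform_symplectic" and S': "S' \<in> filiform_symplectic"
  shows "triple_isomorphic (canonical_triple S) (canonical_triple S') \<longleftrightarrow> symplectic_isomorphic S S'"
proof -
  obtain R where R: "canonical_triple S \<in> filiform_triples" "represents R (canonical_triple S)" "symplectic_isomorphic S R"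
    using canonical_triple_represented[OF S] .
  obtain R' where R': "canonical_triple S' \<in> filiform_triples" "represents R' (canonical_triple S')" "symplectic_isomorphic S' R'"
    using canonical_triple_represented[OF S'] .
  have "symplectic_isomorphic R R' \<longleftrightarrow> symplectic_isomorphic S S'"
    using R(3) R'(3) symplectic_isomorphic_trans' symplectic_isomorphic_sym'
      filiform_symplectic_lie_algebra[OF S] filiform_symplectic_lie_algebra[OF S'] by metis
  then show ?thesis using represents_isomorphic_iff[OF R(1) R'(1) R(2) R'(2)] by simp
qed

text \<open>S is a copy, on the type of \<open>emb\<close>, of an extension algebra R representing
  T. The canonical triple of S is represented by some R' isomorphic to S, hence to R, and triples
  with isomorphic representing algebras are isomorphic.\<close>

lemma canonical_triple_surjective:
  fixes emb :: "'k::field_char_0 \<Rightarrow> 'a" and T :: "('k, 'b) triple"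
  assumes emb: "inj emb" and T: "T \<in> filiform_triples"
  obtains S :: "('k, 'a) sympl" where "S \<in> filiform_symplectic" "triple_isomorphic (canonical_triple S) T"
proof -
  obtain R where R: "represents R T" using represents_exists[OF T] by blast
  obtain H conn c where Tc: "T = (H, conn, c)" by (cases T)
  then have H: "flat_lie_algebra H conn" "c \<in> lagrangian_cohomology2 H conn" "2 \<le> lie_dim H"
    using T by (auto simp: filiform_triples_def)
  obtain \<alpha> where \<alpha>: "\<alpha> \<in> c" "filiform (extension_algebra H conn \<alpha>)" "R = (extension_algebra H conn \<alpha>, extension_form)"
    using R by (auto simp: represents_def Tc)
  interpret flat_lie_algebra H conn using H(1) .
  interpret E: symplectic_extension H conn \<alpha>
    using H(1) quotient_class_eq(2)[OF equiv_cohomologous H(2)[unfolded lagrangian_cohomology2_def] \<alpha>(1)] \<alpha>(2)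
    by (simp add: symplectic_extension_def symplectic_extension_axioms_def filiform_def)
  obtain L :: "('k, 'a) lie" and \<omega> where L: "symplectic_lie_algebra L \<omega>" "symplectic_isomorphic (E.G, extension_form) (L, \<omega>)"
    using symplectic_realisation[OF emb E.symplectic_G] .
  interpret L: symplectic_lie_algebra L \<omega> using L(1) .
  obtain f where f: "f \<in> lie_iso E.G L" using L(2) by (auto simp: symplectic_isomorphic_iff)
  have "lie_dim L = 2 * lie_dim H"
    using lie_iso_dim[OF E.G.lie_algebra_axioms L.lie_algebra_axioms f] E.lie_dim_G by simp
  then have S: "(L, \<omega>) \<in> filiform_symplectic"
    using L(1) filiform_lie_iso[OF E.G.lie_algebra_axioms L.lie_algebra_axioms f \<alpha>(2)] H(3)
    by (simp add: filiform_symplectic_def)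
  obtain R' where R': "canonical_triple (L, \<omega>) \<in> filiform_triples" "represents R' (canonical_triple (L, \<omega>))"
    "symplectic_isomorphic (L, \<omega>) R'"
    using canonical_triple_represented[OF S] .
  have "symplectic_isomorphic R R'"
    using symplectic_isomorphic_trans'[OF L(2) R'(3)] \<alpha>(3) by simp
  then have "symplectic_isomorphic R' R"
    using symplectic_isomorphic_sym'[OF represents_lie_algebra[OF R]] by blast
  then show thesis using that S represents_isomorphic_iff[OF R'(1) T R'(2) R] by blast
qed

text \<open>The map on classes closes images up under isomorphism, so its bijectivity alone would
  not say that isomorphic symplectic Lie algebras have isomorphic triples; the third conjunct states
  this. The first one ensures that the canonical triple is formed with a Lagrangian ideal.\<close>

theorem corollary8p6:
  fixes emb :: "'k::field_char_0 \<Rightarrow> 'a"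
  assumes "inj emb"
  shows "(\<forall>(L, \<omega>) \<in> (filiform_symplectic :: ('k, 'a) sympl set). lagrangian_ideal L \<omega> (canonical_ideal L)) \<and>
    canonical_triple ` (filiform_symplectic :: ('k, 'a) sympl set) \<subseteq> filiform_triples \<and>
    (\<forall>(S, S') \<in> (filiform_symplectic_iso :: ('k, 'a) sympl rel).
       (canonical_triple S, canonical_triple S') \<in> filiform_triples_iso) \<and>
    bij_betw (\<lambda>X. filiform_triples_iso `` (canonical_triple ` X))
      ((filiform_symplectic :: ('k, 'a) sympl set) // filiform_symplectic_iso)
      ((filiform_triples :: ('k, 'a set) triple set) // filiform_triples_iso)"
proof (intro conjI)
  have mem: "canonical_triple S \<in> filiform_triples" if "S \<in> filiform_symplectic" for S :: "('k, 'a) sympl"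
    using canonical_triple_represented[OF that] by metis
  have iff: "(canonical_triple S, canonical_triple S') \<in> filiform_triples_iso \<longleftrightarrow> (S, S') \<in> filiform_symplectic_iso"
    if "S \<in> filiform_symplectic" "S' \<in> filiform_symplectic" for S S' :: "('k, 'a) sympl"
    using canonical_triple_isomorphic_iff[OF that] mem that
    by (simp add: filiform_triples_iso_def filiform_symplectic_iso_def)
  show "\<forall>(L, \<omega>) \<in> (filiform_symplectic :: ('k, 'a) sympl set). lagrangian_ideal L \<omega> (canonical_ideal L)"
    using symplectic_lie_algebra.canonical_ideal_lagrangian by (auto simp: filiform_symplectic_def)
  show "canonical_triple ` (filiform_symplectic :: ('k, 'a) sympl set) \<subseteq> filiform_triples"
    using mem by blast
  show "\<forall>(S, S') \<in> (filiform_symplectic_iso :: ('k, 'a) sympl rel).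
       (canonical_triple S, canonical_triple S') \<in> filiform_triples_iso"
    using iff equiv_type[OF equiv_filiform_symplectic] by fast
  show "bij_betw (\<lambda>X. filiform_triples_iso `` (canonical_triple ` X))
      ((filiform_symplectic :: ('k, 'a) sympl set) // filiform_symplectic_iso)
      ((filiform_triples :: ('k, 'a set) triple set) // filiform_triples_iso)"
  proof (rule bij_betw_quotients[OF equiv_filiform_symplectic equiv_filiform_triples mem iff])
    fix T :: "('k, 'a set) triple" assume T: "T \<in> filiform_triples"
    obtain S :: "('k, 'a) sympl" where "S \<in> filiform_symplectic" "triple_isomorphic (canonical_triple S) T"
      using canonical_triple_surjective[OF assms T] .
    then show "\<exists>S\<in>filiform_symplectic. (canonical_triple S, T) \<in> filiform_triples_iso"
      using mem T by (auto simp: filiform_triples_iso_def)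
  qed
qed

end
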